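(* Let $\mathcal A$ be a Gelfand–Kazhdan category over the root lattice, over the field $K=\mathbb Z_p$, with set of simple objects $\Sigma$. Suppose that for every $b\in\Sigma$ $$r(b)^{-1}\sum_{c\in\Sigma}\dim F(b,cc^* )=|\Sigma|\pmod p .$$ Let $P=\langle x_1,\dots,x_n\mid R_1,\dots,R_m\rangle$ be a group presentation, let $1\le k\le n$, and set $$P'=\langle x_1,\dots,x_n,y\mid R_1,\dots,R_m,\;x_kyx_k^{-1}y^{-1}\rangle,\qquad P''=\langle x_1,\dots,x_n\mid R_1,\dots,R_m,\;x_k\rangle .$$ Then $Q(P')=|\Sigma|\,Q(P'')$ in $K$.
   Context: **Gelfand–Kazhdan categories.** Let $G$ be the split simply connected algebraic group over $\mathbb Z_p$ attached to a simple Lie algebra, with $p$ a prime greater than the Coxeter number. The Gelfand–Kazhdan category is the semisimple symmetric tensor category over $K=\mathbb Z_p$ obtained as the quotient of the category of tilting $G$-modules by the negligible morphisms; its simple objects correspond to the simple modules with highest weight inside the fundamental alcove. The category *over the root lattice* is the full subcategory generated by those simple objects whose highest weights lie in the root lattice; it is a semisimple stable autonomous tensor category in the sense below, with $\Sigma$ the finite set of its simple objects, and $a^*$ (for $a\in\Sigma$) the element of $\Sigma$ isomorphic to the dual module of $a$. **Category.** $\mathcal A$ is a symmetric monoidal category (product $\diamond$, also written as juxtaposition; unit $\mathbf 1$; symmetry $\gamma$). It is *autonomous*: each object $A$ has an assigned object $A^*$ and morphisms $\Lambda_A:\mathbf 1\to A^*A$, $\lambda_A:AA^*\to\mathbf 1$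 satisfying the two zig-zag identities. It is *stable*: $(A^* )^*=A$ and $\gamma_{A^*,A}\circ\Lambda_A=\Lambda_{A^*}$. It is *semisimple* over $K$: abelian and $K$-linear (with $\diamond$ bilinear), every object is isomorphic to a finite direct sum of objects of the finite set $\Sigma$ and, for $a,b\in\Sigma$, $\mathrm{Hom}(a,b)=0$ if $a\ne b$ and $\mathrm{Hom}(a,a)=K\cdot\mathrm{id}_a$; $\mathbf 1\in\Sigma$ and $\Sigma$ is closed under $*$. Write $F(A,B)=\mathrm{Hom}_{\mathcal A}(A,B)$ and identify $F(\mathbf 1,\mathbf 1)=K$. Associativity and unit isomorphisms are suppressed; iterated products are bracketed from the left. A *permutation* of tensor factors means the canonical isomorphism built from associativity, unit and symmetry isomorphisms. The *rank* of $A$ is $r(A)=\lambda_{A^*}\circ\Lambda_A\in K$ (nonzero for $A\in\Sigma$). Empty products are $\mathbf 1$. **Dual bases and partial trace.** For $a\in\Sigma$ and an object $A$, a basis $\{\epsilon_i\}$ of $F(a,A)$ has a dual basis $\{\epsilon_i^*\}$ of $F(A,a)$ with $\epsilon_i^*\circ\epsilon_j=\delta_{ij}\,\mathrm{id}_a$. For $\phi:A_1\diamond\dots\diamond A_l\to A_1\diamond\dots\diamond A_l$ and $a\in\Sigma$, $\mathrm{Tr}_{A_k\to a}(\phi)=\sum_i(\mathrm{id}\diamond\epsilon_i^*\diamond\mathrm{id})\circ\phi\circ(\mathrm{id}\diamond\epsilon_i\diamond\mathrm{id})$ with $\{\epsilon_i\}$ a basis of $F(a,A_k)$ inserted in the $k$-th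 factor; it is independent of the basis. Partial traces over different factors commute, and $\mathrm{Tr}_{\{A_k\to a_k\}_k}$ denotes their composite. **The morphisms $f(b,l)$.** For $b\in\Sigma$ and a nonzero integer $l$, $b^l$ denotes the $l$-fold product of $b$ if $l>0$, and the $|l|$-fold product of $b^*$ if $l<0$. Define $f(b,l):b\diamond b^l\to b^l\diamond b$: if $l>0$ it is the identity of $b^{l+1}$ (up to reassociation); if $l=-m<0$, it contracts the initial $b$ with the last ($m$-th) factor $b^*$ of the source by $\lambda_b$, sends the $j$-th factor $b^*$ of the source identically to the $(j+1)$-st factor $b^*$ of the target ($1\le j\le m-1$), and creates the first factor $b^*$ and the final $b$ of the target by $\Lambda_b$. **Definition of $Q(P)$.** Relators are words $R=x_{i_1}^{l_1}\cdots x_{i_s}^{l_s}$ with nonzero integer exponents. For $b\in\Sigma$ put $R(b)=b^{l_1}\diamond\dots\diamond b^{l_s}$. Let $[R,b]^o:b\diamond R(b)\to R(b)\diamond b$ be the composite that moves $b$ successively past $b^{l_1},\dots,b^{l_s}$ using $f(b,l_1),\dots,f(b,l_s)$. Let $[R,b]:R(b)\to R(b)$ be $r(b)$ times the closure of $[R,b]^o$ over $b$, where the closure is the composite $R(b)\xrightarrow{\Lambda_b\diamond\mathrm{id}}b^*bR(b)\xrightarrow{\mathrm{id}\diamond(\gamma_{R(b),b}\circ[R,b]^o)}b^*bR(b)\xrightarrow{\lambda_{b^*}\diamond\mathrm{id}}R(b)$. Let $g_k(R,b)$ be the product, in order, of those $b^{l_r}$ with $x_{i_r}=x_k$. For $P=\langle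 x_1,\dots,x_n\mid R_1,\dots,R_m\rangle$ and $\underline b=(b_1,\dots,b_m)\in\Sigma^{m}$ let $[P,\underline b]=[R_1,b_1]\diamond\dots\diamond[R_m,b_m]$, $G_k(\underline b)=g_k(R_1,b_1)\diamond\dots\diamond g_k(R_m,b_m)$, and let $\xi(P):R_1(b_1)\diamond\dots\diamond R_m(b_m)\to G_1(\underline b)\diamond\dots\diamond G_n(\underline b)$ be the permutation grouping the factors according to generators. Then $$Q(P)=\sum_{\underline b\in\Sigma^{m}}\mathrm{Tr}_{\{G_k(\underline b)\to\mathbf 1\}_{k=1}^n}\big(\xi(P)\circ[P,\underline b]\circ\xi(P)^{-1}\big)\in K.$$ *)

theory Defs
  imports
    "Berlekamp_Zassenhaus.Finite_Field"
    "Jordan_Normal_Form.Matrix"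
    "HOL-Algebra.Algebraic_Closure_Type"
begin

no_notation var ("X\<index>")

section \<open>Semisimple stable autonomous tensor categories\<close>

text \<open>
  \<open>asc X Y Z : (X \<diamond> Y) \<diamond> Z \<rightarrow> X \<diamond> (Y \<diamond> Z)\<close>, \<open>lun X : \<one> \<diamond> X \<rightarrow> X\<close>, \<open>run X : X \<diamond> \<one> \<rightarrow> X\<close>,
  \<open>sym X Y : X \<diamond> Y \<rightarrow> Y \<diamond> X\<close>, \<open>coev X = \<Lambda>\<^sub>X : \<one> \<rightarrow> X* \<diamond> X\<close> and \<open>ev X = \<lambda>\<^sub>X : X \<diamond> X* \<rightarrow> \<one>\<close>.
  Composition \<open>g \<cdot> f\<close> is in the usual order (first \<open>f\<close>); tensor products of objects and of
  morphisms are written \<open>\<diamond>\<close> and \<open>\<boxtimes>\<close>.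
\<close>

record ('o, 'm, 'k) tensor_cat =
  Ob :: "'o set"
  Hm :: "'o \<Rightarrow> 'o \<Rightarrow> 'm set"
  idn :: "'o \<Rightarrow> 'm"
  cmp :: "'m \<Rightarrow> 'm \<Rightarrow> 'm" (infixl "\<cdot>\<index>" 70)
  zer :: "'o \<Rightarrow> 'o \<Rightarrow> 'm"
  plu :: "'m \<Rightarrow> 'm \<Rightarrow> 'm" (infixl "\<oplus>\<^sub>h\<index>" 65)
  scl :: "'k \<Rightarrow> 'm \<Rightarrow> 'm" (infixr "\<odot>\<^sub>h\<index>" 75)
  tob :: "'o \<Rightarrow> 'o \<Rightarrow> 'o" (infixl "\<diamond>\<index>" 72)
  tar :: "'m \<Rightarrow> 'm \<Rightarrow> 'm" (infixl "\<boxtimes>\<index>" 72)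
  unt :: "'o" ("\<one>\<^sub>c\<index>")
  asc :: "'o \<Rightarrow> 'o \<Rightarrow> 'o \<Rightarrow> 'm"
  lun :: "'o \<Rightarrow> 'm"
  run :: "'o \<Rightarrow> 'm"
  sym :: "'o \<Rightarrow> 'o \<Rightarrow> 'm"
  dua :: "'o \<Rightarrow> 'o"
  coev :: "'o \<Rightarrow> 'm"
  ev :: "'o \<Rightarrow> 'm"

context
  fixes A :: "('o, 'm, 'k::field) tensor_cat" (structure)
begin

definition inverse_pair :: "'o \<Rightarrow> 'o \<Rightarrow> 'm \<Rightarrow> 'm \<Rightarrow> bool" where
  "inverse_pair X Y f g \<longleftrightarrow>
     f \<in> Hm A X Y \<and> g \<in> Hm A Y X \<and> g \<cdot> f = idn A X \<and> f \<cdot> g = idn A Y"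

definition iso_arr :: "'o \<Rightarrow> 'o \<Rightarrow> 'm \<Rightarrow> bool" where
  "iso_arr X Y f \<longleftrightarrow> (\<exists>g. inverse_pair X Y f g)"

definition inv_arr :: "'m \<Rightarrow> 'm" where
  "inv_arr f = (THE g. \<exists>X\<in>Ob A. \<exists>Y\<in>Ob A. inverse_pair X Y f g)"

definition hsum :: "'o \<Rightarrow> 'o \<Rightarrow> 'm list \<Rightarrow> 'm" where
  "hsum X Y fs = foldr (\<lambda>f g. f \<oplus>\<^sub>h g) fs (zer A X Y)"

definition is_direct_sum :: "'o \<Rightarrow> 'o list \<Rightarrow> bool" where
  "is_direct_sum X as \<longleftrightarrow> (\<exists>\<iota> \<pi>.
     (\<forall>i<length as. \<iota> i \<in> Hm A (as ! i) X \<and> \<pi> i \<in> Hm A X (as ! i)) \<and>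
     (\<forall>i<length as. \<forall>j<length as.
        \<pi> i \<cdot> \<iota> j = (if i = j then idn A (as ! i) else zer A (as ! j) (as ! i))) \<and>
     hsum X X (map (\<lambda>i. \<iota> i \<cdot> \<pi> i) [0..<length as]) = idn A X)"

definition is_kernel :: "'o \<Rightarrow> 'o \<Rightarrow> 'm \<Rightarrow> 'o \<Rightarrow> 'm \<Rightarrow> bool" where
  "is_kernel X Y f Z k \<longleftrightarrow> Z \<in> Ob A \<and> k \<in> Hm A Z X \<and> f \<cdot> k = zer A Z Y \<and>
     (\<forall>W\<in>Ob A. \<forall>g\<in>Hm A W X. f \<cdot> g = zer A W Y \<longrightarrow> (\<exists>!u. u \<in> Hm A W Z \<and> k \<cdot> u = g))"

definition is_cokernel :: "'o \<Rightarrow> 'o \<Rightarrow> 'm \<Rightarrow> 'o \<Rightarrow> 'm \<Rightarrow> bool" where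
  "is_cokernel X Y f Z q \<longleftrightarrow> Z \<in> Ob A \<and> q \<in> Hm A Y Z \<and> q \<cdot> f = zer A X Z \<and>
     (\<forall>W\<in>Ob A. \<forall>g\<in>Hm A Y W. g \<cdot> f = zer A X W \<longrightarrow> (\<exists>!u. u \<in> Hm A Z W \<and> u \<cdot> q = g))"

definition mono_arr :: "'o \<Rightarrow> 'o \<Rightarrow> 'm \<Rightarrow> bool" where
  "mono_arr X Y f \<longleftrightarrow>
     (\<forall>W\<in>Ob A. \<forall>g\<in>Hm A W X. \<forall>h\<in>Hm A W X. f \<cdot> g = f \<cdot> h \<longrightarrow> g = h)"

definition epi_arr :: "'o \<Rightarrow> 'o \<Rightarrow> 'm \<Rightarrow> bool" where
  "epi_arr X Y f \<longleftrightarrow>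
     (\<forall>W\<in>Ob A. \<forall>g\<in>Hm A Y W. \<forall>h\<in>Hm A Y W. g \<cdot> f = h \<cdot> f \<longrightarrow> g = h)"

definition is_basis :: "'o \<Rightarrow> 'o \<Rightarrow> 'm list \<Rightarrow> bool" where
  "is_basis X Y es \<longleftrightarrow> set es \<subseteq> Hm A X Y \<and>
     (\<forall>f\<in>Hm A X Y. \<exists>!cs. length cs = length es \<and> f = hsum X Y (map2 (scl A) cs es))"

definition hom_dim :: "'o \<Rightarrow> 'o \<Rightarrow> nat" where
  "hom_dim X Y = (THE d. \<exists>es. is_basis X Y es \<and> length es = d)"

end

locale category =
  fixes A :: "('o, 'm, 'k::field) tensor_cat" (structure)
  assumes hom_disjoint: "\<lbrakk>X \<in> Ob A; Y \<in> Ob A; X' \<in> Ob A; Y' \<in> Ob A;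
      f \<in> Hm A X Y; f \<in> Hm A X' Y'\<rbrakk> \<Longrightarrow> X = X' \<and> Y = Y'"
    and idn_closed: "X \<in> Ob A \<Longrightarrow> idn A X \<in> Hm A X X"
    and cmp_closed: "\<lbrakk>X \<in> Ob A; Y \<in> Ob A; Z \<in> Ob A; f \<in> Hm A X Y; g \<in> Hm A Y Z\<rbrakk>
      \<Longrightarrow> g \<cdot> f \<in> Hm A X Z"
    and idn_left: "\<lbrakk>X \<in> Ob A; Y \<in> Ob A; f \<in> Hm A X Y\<rbrakk> \<Longrightarrow> idn A Y \<cdot> f = f"
    and idn_right: "\<lbrakk>X \<in> Ob A; Y \<in> Ob A; f \<in> Hm A X Y\<rbrakk> \<Longrightarrow> f \<cdot> idn A X = f"
    and cmp_assoc: "\<lbrakk>W \<in> Ob A; X \<in> Ob A; Y \<in> Ob A; Z \<in> Ob A;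
      f \<in> Hm A W X; g \<in> Hm A X Y; h \<in> Hm A Y Z\<rbrakk> \<Longrightarrow> (h \<cdot> g) \<cdot> f = h \<cdot> (g \<cdot> f)"

locale linear_category = category +
  assumes zer_closed: "\<lbrakk>X \<in> Ob A; Y \<in> Ob A\<rbrakk> \<Longrightarrow> zer A X Y \<in> Hm A X Y"
    and plu_closed: "\<lbrakk>X \<in> Ob A; Y \<in> Ob A; f \<in> Hm A X Y; g \<in> Hm A X Y\<rbrakk>
      \<Longrightarrow> f \<oplus>\<^sub>h g \<in> Hm A X Y"
    and scl_closed: "\<lbrakk>X \<in> Ob A; Y \<in> Ob A; f \<in> Hm A X Y\<rbrakk> \<Longrightarrow> c \<odot>\<^sub>h f \<in> Hm A X Y"
    and plu_assoc: "\<lbrakk>X \<in> Ob A; Y \<in> Ob A; f \<in> Hm A X Y; g \<in> Hm A X Y; h \<in> Hm A X Y\<rbrakk>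
      \<Longrightarrow> (f \<oplus>\<^sub>h g) \<oplus>\<^sub>h h = f \<oplus>\<^sub>h (g \<oplus>\<^sub>h h)"
    and plu_comm: "\<lbrakk>X \<in> Ob A; Y \<in> Ob A; f \<in> Hm A X Y; g \<in> Hm A X Y\<rbrakk>
      \<Longrightarrow> f \<oplus>\<^sub>h g = g \<oplus>\<^sub>h f"
    and plu_zer: "\<lbrakk>X \<in> Ob A; Y \<in> Ob A; f \<in> Hm A X Y\<rbrakk> \<Longrightarrow> f \<oplus>\<^sub>h zer A X Y = f"
    and plu_neg: "\<lbrakk>X \<in> Ob A; Y \<in> Ob A; f \<in> Hm A X Y\<rbrakk> \<Longrightarrow> f \<oplus>\<^sub>h ((- 1) \<odot>\<^sub>h f) = zer A X Y"
    and scl_plu: "\<lbrakk>X \<in> Ob A; Y \<in> Ob A; f \<in> Hm A X Y; g \<in> Hm A X Y\<rbrakk>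
      \<Longrightarrow> c \<odot>\<^sub>h (f \<oplus>\<^sub>h g) = (c \<odot>\<^sub>h f) \<oplus>\<^sub>h (c \<odot>\<^sub>h g)"
    and plu_scl: "\<lbrakk>X \<in> Ob A; Y \<in> Ob A; f \<in> Hm A X Y\<rbrakk>
      \<Longrightarrow> (c + d) \<odot>\<^sub>h f = (c \<odot>\<^sub>h f) \<oplus>\<^sub>h (d \<odot>\<^sub>h f)"
    and scl_scl: "\<lbrakk>X \<in> Ob A; Y \<in> Ob A; f \<in> Hm A X Y\<rbrakk> \<Longrightarrow> c \<odot>\<^sub>h (d \<odot>\<^sub>h f) = (c * d) \<odot>\<^sub>h f"
    and scl_one: "\<lbrakk>X \<in> Ob A; Y \<in> Ob A; f \<in> Hm A X Y\<rbrakk> \<Longrightarrow> 1 \<odot>\<^sub>h f = f"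
    and cmp_plu_left: "\<lbrakk>X \<in> Ob A; Y \<in> Ob A; Z \<in> Ob A; f \<in> Hm A X Y; g \<in> Hm A Y Z; h \<in> Hm A Y Z\<rbrakk>
      \<Longrightarrow> (g \<oplus>\<^sub>h h) \<cdot> f = (g \<cdot> f) \<oplus>\<^sub>h (h \<cdot> f)"
    and cmp_plu_right: "\<lbrakk>X \<in> Ob A; Y \<in> Ob A; Z \<in> Ob A; f \<in> Hm A X Y; g \<in> Hm A X Y; h \<in> Hm A Y Z\<rbrakk>
      \<Longrightarrow> h \<cdot> (f \<oplus>\<^sub>h g) = (h \<cdot> f) \<oplus>\<^sub>h (h \<cdot> g)"
    and cmp_scl_left: "\<lbrakk>X \<in> Ob A; Y \<in> Ob A; Z \<in> Ob A; f \<in> Hm A X Y; g \<in> Hm A Y Z\<rbrakk>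
      \<Longrightarrow> (c \<odot>\<^sub>h g) \<cdot> f = c \<odot>\<^sub>h (g \<cdot> f)"
    and cmp_scl_right: "\<lbrakk>X \<in> Ob A; Y \<in> Ob A; Z \<in> Ob A; f \<in> Hm A X Y; g \<in> Hm A Y Z\<rbrakk>
      \<Longrightarrow> g \<cdot> (c \<odot>\<^sub>h f) = c \<odot>\<^sub>h (g \<cdot> f)"

locale abelian_category = linear_category +
  assumes direct_sums: "set Xs \<subseteq> Ob A \<Longrightarrow> \<exists>X\<in>Ob A. is_direct_sum A X Xs"
    and kernels: "\<lbrakk>X \<in> Ob A; Y \<in> Ob A; f \<in> Hm A X Y\<rbrakk> \<Longrightarrow> \<exists>Z k. is_kernel A X Y f Z k"
    and cokernels: "\<lbrakk>X \<in> Ob A; Y \<in> Ob A; f \<in> Hm A X Y\<rbrakk> \<Longrightarrow> \<exists>Z q. is_cokernel A X Y f Z q"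
    and mono_normal: "\<lbrakk>X \<in> Ob A; Y \<in> Ob A; f \<in> Hm A X Y; mono_arr A X Y f\<rbrakk>
      \<Longrightarrow> \<exists>Z\<in>Ob A. \<exists>g\<in>Hm A Y Z. is_kernel A Y Z g X f"
    and epi_normal: "\<lbrakk>X \<in> Ob A; Y \<in> Ob A; f \<in> Hm A X Y; epi_arr A X Y f\<rbrakk>
      \<Longrightarrow> \<exists>Z\<in>Ob A. \<exists>g\<in>Hm A Z X. is_cokernel A Z X g Y f"

locale symmetric_monoidal_category = category +
  assumes unt_ob: "\<one>\<^sub>c \<in> Ob A"
    and tob_ob: "\<lbrakk>X \<in> Ob A; Y \<in> Ob A\<rbrakk> \<Longrightarrow> X \<diamond> Y \<in> Ob A"
    and tar_closed: "\<lbrakk>X \<in> Ob A; Y \<in> Ob A; X' \<in> Ob A; Y' \<in> Ob A; f \<in> Hm A X Y; f' \<in> Hm A X' Y'\<rbrakk>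
      \<Longrightarrow> f \<boxtimes> f' \<in> Hm A (X \<diamond> X') (Y \<diamond> Y')"
    and tar_idn: "\<lbrakk>X \<in> Ob A; Y \<in> Ob A\<rbrakk> \<Longrightarrow> idn A X \<boxtimes> idn A Y = idn A (X \<diamond> Y)"
    and tar_cmp: "\<lbrakk>X \<in> Ob A; Y \<in> Ob A; Z \<in> Ob A; X' \<in> Ob A; Y' \<in> Ob A; Z' \<in> Ob A;
      f \<in> Hm A X Y; g \<in> Hm A Y Z; f' \<in> Hm A X' Y'; g' \<in> Hm A Y' Z'\<rbrakk>
      \<Longrightarrow> (g \<cdot> f) \<boxtimes> (g' \<cdot> f') = (g \<boxtimes> g') \<cdot> (f \<boxtimes> f')"
    and asc_iso: "\<lbrakk>X \<in> Ob A; Y \<in> Ob A; Z \<in> Ob A\<rbrakk>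
      \<Longrightarrow> iso_arr A ((X \<diamond> Y) \<diamond> Z) (X \<diamond> (Y \<diamond> Z)) (asc A X Y Z)"
    and lun_iso: "X \<in> Ob A \<Longrightarrow> iso_arr A (\<one>\<^sub>c \<diamond> X) X (lun A X)"
    and run_iso: "X \<in> Ob A \<Longrightarrow> iso_arr A (X \<diamond> \<one>\<^sub>c) X (run A X)"
    and sym_closed: "\<lbrakk>X \<in> Ob A; Y \<in> Ob A\<rbrakk> \<Longrightarrow> sym A X Y \<in> Hm A (X \<diamond> Y) (Y \<diamond> X)"
    and asc_natural: "\<lbrakk>X \<in> Ob A; Y \<in> Ob A; Z \<in> Ob A; X' \<in> Ob A; Y' \<in> Ob A; Z' \<in> Ob A;
      f \<in> Hm A X X'; g \<in> Hm A Y Y'; h \<in> Hm A Z Z'\<rbrakk>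
      \<Longrightarrow> asc A X' Y' Z' \<cdot> ((f \<boxtimes> g) \<boxtimes> h) = (f \<boxtimes> (g \<boxtimes> h)) \<cdot> asc A X Y Z"
    and lun_natural: "\<lbrakk>X \<in> Ob A; Y \<in> Ob A; f \<in> Hm A X Y\<rbrakk>
      \<Longrightarrow> lun A Y \<cdot> (idn A \<one>\<^sub>c \<boxtimes> f) = f \<cdot> lun A X"
    and run_natural: "\<lbrakk>X \<in> Ob A; Y \<in> Ob A; f \<in> Hm A X Y\<rbrakk>
      \<Longrightarrow> run A Y \<cdot> (f \<boxtimes> idn A \<one>\<^sub>c) = f \<cdot> run A X"
    and sym_natural: "\<lbrakk>X \<in> Ob A; Y \<in> Ob A; X' \<in> Ob A; Y' \<in> Ob A; f \<in> Hm A X X'; g \<in> Hm A Y Y'\<rbrakk>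
      \<Longrightarrow> sym A X' Y' \<cdot> (f \<boxtimes> g) = (g \<boxtimes> f) \<cdot> sym A X Y"
    and pentagon: "\<lbrakk>W \<in> Ob A; X \<in> Ob A; Y \<in> Ob A; Z \<in> Ob A\<rbrakk>
      \<Longrightarrow> asc A W X (Y \<diamond> Z) \<cdot> asc A (W \<diamond> X) Y Z =
          (idn A W \<boxtimes> asc A X Y Z) \<cdot> asc A W (X \<diamond> Y) Z \<cdot> (asc A W X Y \<boxtimes> idn A Z)"
    and triangle: "\<lbrakk>X \<in> Ob A; Y \<in> Ob A\<rbrakk>
      \<Longrightarrow> (idn A X \<boxtimes> lun A Y) \<cdot> asc A X \<one>\<^sub>c Y = run A X \<boxtimes> idn A Y"
    and hexagon: "\<lbrakk>X \<in> Ob A; Y \<in> Ob A; Z \<in> Ob A\<rbrakk>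
      \<Longrightarrow> asc A Y Z X \<cdot> sym A X (Y \<diamond> Z) \<cdot> asc A X Y Z =
          (idn A Y \<boxtimes> sym A X Z) \<cdot> asc A Y X Z \<cdot> (sym A X Y \<boxtimes> idn A Z)"
    and sym_sym: "\<lbrakk>X \<in> Ob A; Y \<in> Ob A\<rbrakk> \<Longrightarrow> sym A Y X \<cdot> sym A X Y = idn A (X \<diamond> Y)"

locale autonomous_category = symmetric_monoidal_category +
  assumes dua_ob: "X \<in> Ob A \<Longrightarrow> dua A X \<in> Ob A"
    and coev_closed: "X \<in> Ob A \<Longrightarrow> coev A X \<in> Hm A \<one>\<^sub>c (dua A X \<diamond> X)"
    and ev_closed: "X \<in> Ob A \<Longrightarrow> ev A X \<in> Hm A (X \<diamond> dua A X) \<one>\<^sub>c"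
    and zigzag: "X \<in> Ob A \<Longrightarrow>
      lun A X \<cdot> (ev A X \<boxtimes> idn A X) \<cdot> inv_arr A (asc A X (dua A X) X) \<cdot>
        (idn A X \<boxtimes> coev A X) \<cdot> inv_arr A (run A X) = idn A X"
    and zigzag_dual: "X \<in> Ob A \<Longrightarrow>
      run A (dua A X) \<cdot> (idn A (dua A X) \<boxtimes> ev A X) \<cdot> asc A (dua A X) X (dua A X) \<cdot>
        (coev A X \<boxtimes> idn A (dua A X)) \<cdot> inv_arr A (lun A (dua A X)) = idn A (dua A X)"

locale stable_category = autonomous_category +
  assumes dua_dua: "X \<in> Ob A \<Longrightarrow> dua A (dua A X) = X"
    and sym_coev: "X \<in> Ob A \<Longrightarrow> sym A (dua A X) X \<cdot> coev A X = coev A (dua A X)"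

locale semisimple_stable_category = abelian_category A + stable_category A
  for A :: "('o, 'm, 'k::field) tensor_cat" (structure) +
  fixes S :: "'o set"
  assumes tar_plu_left: "\<lbrakk>X \<in> Ob A; Y \<in> Ob A; X' \<in> Ob A; Y' \<in> Ob A;
      f \<in> Hm A X Y; g \<in> Hm A X Y; h \<in> Hm A X' Y'\<rbrakk>
      \<Longrightarrow> (f \<oplus>\<^sub>h g) \<boxtimes> h = (f \<boxtimes> h) \<oplus>\<^sub>h (g \<boxtimes> h)"
    and tar_plu_right: "\<lbrakk>X \<in> Ob A; Y \<in> Ob A; X' \<in> Ob A; Y' \<in> Ob A;
      f \<in> Hm A X Y; g \<in> Hm A X Y; h \<in> Hm A X' Y'\<rbrakk>
      \<Longrightarrow> h \<boxtimes> (f \<oplus>\<^sub>h g) = (h \<boxtimes> f) \<oplus>\<^sub>h (h \<boxtimes> g)"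
    and tar_scl_left: "\<lbrakk>X \<in> Ob A; Y \<in> Ob A; X' \<in> Ob A; Y' \<in> Ob A;
      f \<in> Hm A X Y; h \<in> Hm A X' Y'\<rbrakk> \<Longrightarrow> (c \<odot>\<^sub>h f) \<boxtimes> h = c \<odot>\<^sub>h (f \<boxtimes> h)"
    and tar_scl_right: "\<lbrakk>X \<in> Ob A; Y \<in> Ob A; X' \<in> Ob A; Y' \<in> Ob A;
      f \<in> Hm A X Y; h \<in> Hm A X' Y'\<rbrakk> \<Longrightarrow> f \<boxtimes> (c \<odot>\<^sub>h h) = c \<odot>\<^sub>h (f \<boxtimes> h)"
    and S_ob: "S \<subseteq> Ob A"
    and S_finite: "finite S"
    and S_generates: "X \<in> Ob A \<Longrightarrow> \<exists>as. set as \<subseteq> S \<and> is_direct_sum A X as"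
    and S_distinct: "\<lbrakk>a \<in> S; b \<in> S; a \<noteq> b\<rbrakk> \<Longrightarrow> Hm A a b = {zer A a b}"
    and S_simple: "a \<in> S \<Longrightarrow> Hm A a a = range (\<lambda>c. c \<odot>\<^sub>h idn A a)"
    and S_nonzero: "a \<in> S \<Longrightarrow> idn A a \<noteq> zer A a a"
    and unt_S: "\<one>\<^sub>c \<in> S"
    and dua_S: "a \<in> S \<Longrightarrow> dua A a \<in> S"


section \<open>Words and reassociation\<close>

text \<open>
  A word (list of objects) stands for its product bracketed from the left. Suppressed
  associativity and unit isomorphisms are made explicit in \<open>merge\<close>, the canonical isomorphism
  from \<open>\<Otimes>xs \<diamond> \<Otimes>ys\<close> to \<open>\<Otimes>(xs @ ys)\<close>. A word morphism is a triple of a source word, a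
  morphism between the products, and a target word; \<open>wten\<close> is \<open>\<diamond>\<close> of such morphisms with
  the reassociation inserted.
\<close>

type_synonym ('o, 'm) word_mor = "'o list \<times> 'm \<times> 'o list"

context
  fixes A :: "('o, 'm, 'k::field) tensor_cat" (structure)
begin

fun wprod :: "'o list \<Rightarrow> 'o" where
  "wprod [] = \<one>\<^sub>c"
| "wprod (x # xs) = foldl (\<lambda>X y. X \<diamond> y) x xs"

text \<open>\<open>reassoc_rev X (rev ys) : X \<diamond> \<Otimes>ys \<rightarrow> (\<dots>(X \<diamond> y\<^sub>1) \<diamond> \<dots>) \<diamond> y\<^sub>r\<close>\<close>

fun reassoc_rev :: "'o \<Rightarrow> 'o list \<Rightarrow> 'm" where
  "reassoc_rev X [] = run A X"
| "reassoc_rev X [y] = idn A (X \<diamond> y)"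
| "reassoc_rev X (y # z # zs) =
     (reassoc_rev X (z # zs) \<boxtimes> idn A y) \<cdot> inv_arr A (asc A X (wprod (rev (z # zs))) y)"

definition merge :: "'o list \<Rightarrow> 'o list \<Rightarrow> 'm" where
  "merge xs ys = (if xs = [] then lun A (wprod ys) else reassoc_rev (wprod xs) (rev ys))"

definition wid :: "'o list \<Rightarrow> ('o, 'm) word_mor" where
  "wid xs = (xs, idn A (wprod xs), xs)"

fun wcmp :: "('o, 'm) word_mor \<Rightarrow> ('o, 'm) word_mor \<Rightarrow> ('o, 'm) word_mor"
    (infixl "\<cdot>\<^sub>w" 70) where
  "(ys', g, zs) \<cdot>\<^sub>w (xs, f, ys) = (xs, g \<cdot> f, zs)"

fun wten :: "('o, 'm) word_mor \<Rightarrow> ('o, 'm) word_mor \<Rightarrow> ('o, 'm) word_mor"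
    (infixl "\<boxtimes>\<^sub>w" 72) where
  "(xs, f, ys) \<boxtimes>\<^sub>w (us, g, vs) =
     (xs @ us, merge ys vs \<cdot> (f \<boxtimes> g) \<cdot> inv_arr A (merge xs us), ys @ vs)"

fun wscl :: "'k \<Rightarrow> ('o, 'm) word_mor \<Rightarrow> ('o, 'm) word_mor" where
  "wscl c (xs, f, ys) = (xs, c \<odot>\<^sub>h f, ys)"

fun winv :: "('o, 'm) word_mor \<Rightarrow> ('o, 'm) word_mor" where
  "winv (xs, f, ys) = (ys, inv_arr A f, xs)"

definition wsym :: "'o list \<Rightarrow> 'o list \<Rightarrow> ('o, 'm) word_mor" where
  "wsym xs ys =
     (xs @ ys, merge ys xs \<cdot> sym A (wprod xs) (wprod ys) \<cdot> inv_arr A (merge xs ys), ys @ xs)"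

definition wcoev :: "'o \<Rightarrow> ('o, 'm) word_mor" where
  "wcoev b = ([], coev A b, [dua A b, b])"

definition wev :: "'o \<Rightarrow> ('o, 'm) word_mor" where
  "wev b = ([b, dua A b], ev A b, [])"

text \<open>\<open>scalar X f\<close> is the \<open>c \<in> K\<close> with \<open>f = c id\<^sub>X\<close>; for \<open>X = \<one> \<diamond> \<dots> \<diamond> \<one>\<close> this is the
  identification of \<open>F(\<one>, \<one>)\<close> with \<open>K\<close>.\<close>

definition scalar :: "'o \<Rightarrow> 'm \<Rightarrow> 'k" where
  "scalar X f = (THE c. f = c \<odot>\<^sub>h idn A X)"

definition rank :: "'o \<Rightarrow> 'k" where
  "rank b = scalar \<one>\<^sub>c (ev A (dua A b) \<cdot> coev A b)"


section \<open>Partial traces\<close>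

definition dual_bases :: "'o \<Rightarrow> 'o \<Rightarrow> 'm list \<Rightarrow> 'm list \<Rightarrow> bool" where
  "dual_bases a X es ds \<longleftrightarrow>
     is_basis A a X es \<and> is_basis A X a ds \<and> length ds = length es \<and>
     (\<forall>i<length es. \<forall>j<length es.
        ds ! i \<cdot> es ! j = (if i = j then idn A a else zer A a a))"

text \<open>\<open>Tr\<^bsub>X\<rightarrow>a\<^esub>\<close> of an endomorphism of the word \<open>us @ xs @ vs\<close>, where \<open>X = \<Otimes>xs\<close>. The choice of
  the basis is immaterial.\<close>

definition partial_trace ::
  "'o list \<Rightarrow> 'o list \<Rightarrow> 'o \<Rightarrow> 'o list \<Rightarrow> ('o, 'm) word_mor \<Rightarrow> ('o, 'm) word_mor" where
  "partial_trace us xs a vs \<phi> =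
     (let (es, ds) = (SOME (es, ds). dual_bases a (wprod xs) es ds);
          W = us @ [a] @ vs
      in (W,
          hsum A (wprod W) (wprod W)
            (map (\<lambda>(e, d). fst (snd
                ((wid us \<boxtimes>\<^sub>w (xs, d, [a]) \<boxtimes>\<^sub>w wid vs) \<cdot>\<^sub>w \<phi> \<cdot>\<^sub>w
                 (wid us \<boxtimes>\<^sub>w ([a], e, xs) \<boxtimes>\<^sub>w wid vs))))
              (zip es ds)),
          W))"

text \<open>Traces over all the factors \<open>X\<^sub>k = \<Otimes>xs\<^sub>k\<close>, from left to right.\<close>

fun traces :: "'o list \<Rightarrow> ('o list \<times> 'o) list \<Rightarrow> ('o, 'm) word_mor \<Rightarrow> ('o, 'm) word_mor" where
  "traces us [] \<phi> = \<phi>"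
| "traces us ((xs, a) # rest) \<phi> =
     traces (us @ [a]) rest (partial_trace us xs a (concat (map fst rest)) \<phi>)"

end


section \<open>The invariant of a presentation\<close>

text \<open>
  A relator is the list of its syllables \<open>(i, l)\<close>, meaning \<open>x\<^sub>i\<^sup>l\<close>; in a presentation
  \<open>(n, Rs)\<close> the generators are numbered \<open>0, \<dots>, n - 1\<close>.
\<close>

type_synonym relator = "(nat \<times> int) list"
type_synonym presentation = "nat \<times> relator list"

definition is_presentation :: "presentation \<Rightarrow> bool" where
  "is_presentation P \<longleftrightarrow> (\<forall>R\<in>set (snd P). \<forall>(i, l)\<in>set R. i < fst P \<and> l \<noteq> 0)"

context
  fixes A :: "('o, 'm, 'k::field) tensor_cat" (structure)
begin

private abbreviation wcmp' (infixl "\<cdot>\<^sub>w" 70) where "wcmp' \<equiv> wcmp A"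
private abbreviation wten' (infixl "\<boxtimes>\<^sub>w" 72) where "wten' \<equiv> wten A"

definition opow :: "'o \<Rightarrow> int \<Rightarrow> 'o list" where
  "opow b l = replicate (nat \<bar>l\<bar>) (if l > 0 then b else dua A b)"

definition rel_word :: "relator \<Rightarrow> 'o \<Rightarrow> 'o list" where
  "rel_word R b = concat (map (\<lambda>(i, l). opow b l) R)"

text \<open>For \<open>l > 0\<close> the words \<open>b # b\<^sup>l\<close> and \<open>b\<^sup>l @ [b]\<close> coincide. For \<open>l = - m < 0\<close> the factors
  \<open>W = (b*)\<^sup>m\<^sup>-\<^sup>1\<close> are kept: \<open>b W b* \<rightarrow> W b b* \<rightarrow> W \<rightarrow> b* b W \<rightarrow> b* W b\<close>.\<close>

definition pass_power :: "'o \<Rightarrow> int \<Rightarrow> ('o, 'm) word_mor" where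
  "pass_power b l =
     (if l > 0 then wid A (b # opow b l)
      else let W = replicate (nat (- l) - 1) (dua A b) in
        (wid A [dua A b] \<boxtimes>\<^sub>w wsym A [b] W) \<cdot>\<^sub>w (wcoev A b \<boxtimes>\<^sub>w wid A W) \<cdot>\<^sub>w
        (wid A W \<boxtimes>\<^sub>w wev A b) \<cdot>\<^sub>w (wsym A [b] W \<boxtimes>\<^sub>w wid A [dua A b]))"

fun rel_open :: "relator \<Rightarrow> 'o \<Rightarrow> ('o, 'm) word_mor" where
  "rel_open [] b = wid A [b]"
| "rel_open ((i, l) # R) b =
     (wid A (opow b l) \<boxtimes>\<^sub>w rel_open R b) \<cdot>\<^sub>w (pass_power b l \<boxtimes>\<^sub>w wid A (rel_word R b))"

definition rel_mor :: "relator \<Rightarrow> 'o \<Rightarrow> ('o, 'm) word_mor" where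
  "rel_mor R b = wscl A (rank A b)
     ((wev A (dua A b) \<boxtimes>\<^sub>w wid A (rel_word R b)) \<cdot>\<^sub>w
      (wid A [dua A b] \<boxtimes>\<^sub>w (wsym A (rel_word R b) [b] \<cdot>\<^sub>w rel_open R b)) \<cdot>\<^sub>w
      (wcoev A b \<boxtimes>\<^sub>w wid A (rel_word R b)))"

definition pres_mor :: "relator list \<Rightarrow> 'o list \<Rightarrow> ('o, 'm) word_mor" where
  "pres_mor Rs bs = foldr (\<lambda>f g. f \<boxtimes>\<^sub>w g) (map2 rel_mor Rs bs) (wid A [])"

text \<open>The factors \<open>b\<^sup>l\<close> of \<open>R\<^sub>1(b\<^sub>1) \<diamond> \<dots> \<diamond> R\<^sub>m(b\<^sub>m)\<close>, each labelled by its generator.\<close>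

definition blocks :: "relator list \<Rightarrow> 'o list \<Rightarrow> (nat \<times> 'o list) list" where
  "blocks Rs bs = concat (map2 (\<lambda>R b. map (\<lambda>(i, l). (i, opow b l)) R) Rs bs)"

definition group_word :: "nat \<Rightarrow> (nat \<times> 'o list) list \<Rightarrow> 'o list" where
  "group_word k B = concat (map snd (filter (\<lambda>(i, w). i = k) B))"

text \<open>\<open>pull_front k B\<close> moves the blocks labelled \<open>k\<close> to the front, keeping the order among them
  and among the others; \<open>grouping\<close> iterates this over a list of labels, giving \<open>\<xi>(P)\<close>.\<close>

fun pull_front :: "nat \<Rightarrow> (nat \<times> 'o list) list \<Rightarrow> ('o, 'm) word_mor" where
  "pull_front k [] = wid A []"
| "pull_front k ((i, w) # B) =
     (if i = k then wid A w \<boxtimes>\<^sub>w pull_front k B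
      else (wsym A w (group_word k B) \<boxtimes>\<^sub>w
              wid A (concat (map snd (filter (\<lambda>(i, w). i \<noteq> k) B)))) \<cdot>\<^sub>w
           (wid A w \<boxtimes>\<^sub>w pull_front k B))"

fun grouping :: "nat list \<Rightarrow> (nat \<times> 'o list) list \<Rightarrow> ('o, 'm) word_mor" where
  "grouping [] B = wid A (concat (map snd B))"
| "grouping (k # ks) B =
     (wid A (group_word k B) \<boxtimes>\<^sub>w grouping ks (filter (\<lambda>(i, w). i \<noteq> k) B)) \<cdot>\<^sub>w pull_front k B"

definition Q_term :: "presentation \<Rightarrow> 'o list \<Rightarrow> 'k" where
  "Q_term P bs =
     (let (n, Rs) = P; B = blocks Rs bs; \<xi> = grouping [0..<n] B in
      scalar A (wprod A (replicate n \<one>\<^sub>c))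
        (fst (snd (traces A [] (map (\<lambda>k. (group_word k B, \<one>\<^sub>c)) [0..<n])
           (\<xi> \<cdot>\<^sub>w pres_mor Rs bs \<cdot>\<^sub>w winv A \<xi>)))))"

definition Q_inv :: "'o set \<Rightarrow> presentation \<Rightarrow> 'k" where
  "Q_inv S P = (\<Sum>bs | set bs \<subseteq> S \<and> length bs = length (snd P). Q_term P bs)"

end


section \<open>Split simply connected simple groups over a prime field\<close>

subsection \<open>Cartan matrices\<close>

text \<open>The convention is \<open>C\<^sub>i\<^sub>j = \<langle>\<alpha>\<^sub>j, \<alpha>\<^sub>i\<^sup>\<or>\<rangle> = \<alpha>\<^sub>j(h\<^sub>i)\<close>.\<close>

definition simple_cartan_matrix :: "nat \<Rightarrow> int mat \<Rightarrow> bool" where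
  "simple_cartan_matrix l C \<longleftrightarrow> 0 < l \<and> C \<in> carrier_mat l l \<and>
     (\<forall>i<l. C $$ (i, i) = 2) \<and>
     (\<forall>i<l. \<forall>j<l. i \<noteq> j \<longrightarrow> C $$ (i, j) \<le> 0) \<and>
     (\<forall>i<l. \<forall>j<l. C $$ (i, j) = 0 \<longleftrightarrow> C $$ (j, i) = 0) \<and>
     (\<forall>I. I \<subseteq> {..<l} \<and> I \<noteq> {} \<and> I \<noteq> {..<l} \<longrightarrow> (\<exists>i\<in>I. \<exists>j\<in>{..<l} - I. C $$ (i, j) \<noteq> 0)) \<and>
     (\<exists>s :: nat \<Rightarrow> rat. (\<forall>i<l. 0 < s i) \<and>
        (\<forall>i<l. \<forall>j<l. s i * of_int (C $$ (i, j)) = s j * of_int (C $$ (j, i))) \<and>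
        (\<forall>x :: nat \<Rightarrow> rat. (\<exists>i<l. x i \<noteq> 0) \<longrightarrow>
           0 < (\<Sum>i<l. \<Sum>j<l. s i * of_int (C $$ (i, j)) * x i * x j)))"

definition root_reflection :: "nat \<Rightarrow> int mat \<Rightarrow> nat \<Rightarrow> int mat" where
  "root_reflection l C i =
     mat l l (\<lambda>(a, b). (if a = b then 1 else 0) - (if a = i then C $$ (i, b) else 0))"

text \<open>The order of the Coxeter element \<open>s\<^sub>1 \<cdots> s\<^sub>l\<close>, acting on the root lattice.\<close>

definition coxeter_number :: "nat \<Rightarrow> int mat \<Rightarrow> nat" where
  "coxeter_number l C =
     (LEAST n. 0 < n \<and> foldr (*) (map (root_reflection l C) [0..<l]) (1\<^sub>m l) ^\<^sub>m n = 1\<^sub>m l)"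

text \<open>Coordinates of the coroots in the basis of simple coroots:
  \<open>s\<^sub>i(\<alpha>\<^sub>j\<^sup>\<or>) = \<alpha>\<^sub>j\<^sup>\<or> - C\<^sub>j\<^sub>i \<alpha>\<^sub>i\<^sup>\<or>\<close>.\<close>

inductive_set coroots :: "nat \<Rightarrow> int mat \<Rightarrow> int vec set" for l C where
  simple: "i < l \<Longrightarrow> unit_vec l i \<in> coroots l C"
| reflect: "v \<in> coroots l C \<Longrightarrow> i < l \<Longrightarrow>
     v - (\<Sum>j<l. v $ j * C $$ (j, i)) \<cdot>\<^sub>v unit_vec l i \<in> coroots l C"

text \<open>Weights are given by \<open>\<mu> i = \<langle>\<mu>, \<alpha>\<^sub>i\<^sup>\<or>\<rangle>\<close>; the alcove is
  \<open>0 < \<langle>\<mu> + \<rho>, \<beta>\<^sup>\<or>\<rangle> < p\<close> for all positive roots \<open>\<beta>\<close>.\<close>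

definition in_alcove :: "nat \<Rightarrow> int mat \<Rightarrow> nat \<Rightarrow> (nat \<Rightarrow> int) \<Rightarrow> bool" where
  "in_alcove l C p \<mu> \<longleftrightarrow>
     (\<forall>v\<in>coroots l C. (\<forall>i<l. 0 \<le> v $ i) \<longrightarrow>
        0 < (\<Sum>i<l. v $ i * (\<mu> i + 1)) \<and> (\<Sum>i<l. v $ i * (\<mu> i + 1)) < int p)"

definition in_root_lattice :: "nat \<Rightarrow> int mat \<Rightarrow> (nat \<Rightarrow> int) \<Rightarrow> bool" where
  "in_root_lattice l C \<mu> \<longleftrightarrow> (\<exists>c. \<forall>i<l. \<mu> i = (\<Sum>j<l. C $$ (i, j) * c j))"


subsection \<open>The Chevalley construction\<close>

text \<open>
  A representation over \<open>\<rat>\<close>, of dimension \<open>dimn\<close>, of the simple Lie algebra with Cartan matrix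
  \<open>cart\<close>, in a weight basis of an admissible lattice: \<open>eop i\<close>, \<open>fop i\<close> are the Chevalley
  generators, and \<open>wt a i\<close> is the eigenvalue of \<open>h\<^sub>i\<close> on the \<open>a\<close>-th basis vector. The group is
  simply connected iff the weights generate the full weight lattice.
\<close>

record chevalley =
  rk :: nat
  cart :: "int mat"
  dimn :: nat
  eop :: "nat \<Rightarrow> rat mat"
  fop :: "nat \<Rightarrow> rat mat"
  wt :: "nat \<Rightarrow> nat \<Rightarrow> int"

definition hop :: "chevalley \<Rightarrow> nat \<Rightarrow> rat mat" where
  "hop D i = mat_diag (dimn D) (\<lambda>a. of_int (wt D a i))"

definition commutator :: "rat mat \<Rightarrow> rat mat \<Rightarrow> rat mat" where
  "commutator X Y = X * Y - Y * X"

definition simply_connected_chevalley :: "chevalley \<Rightarrow> bool" where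
  "simply_connected_chevalley D \<longleftrightarrow>
     simple_cartan_matrix (rk D) (cart D) \<and>
     (\<forall>i<rk D. eop D i \<in> carrier_mat (dimn D) (dimn D) \<and>
               fop D i \<in> carrier_mat (dimn D) (dimn D)) \<and>
     (\<forall>i<rk D. \<forall>j<rk D.
        commutator (eop D i) (fop D j) = (if i = j then hop D i else 0\<^sub>m (dimn D) (dimn D)) \<and>
        commutator (hop D i) (eop D j) = of_int (cart D $$ (i, j)) \<cdot>\<^sub>m eop D j \<and>
        commutator (hop D i) (fop D j) = of_int (- cart D $$ (i, j)) \<cdot>\<^sub>m fop D j) \<and>
     (\<forall>i<rk D. \<forall>j<rk D. i \<noteq> j \<longrightarrow>
        (commutator (eop D i) ^^ nat (1 - cart D $$ (i, j))) (eop D j) = 0\<^sub>m (dimn D) (dimn D) \<and>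
        (commutator (fop D i) ^^ nat (1 - cart D $$ (i, j))) (fop D j) = 0\<^sub>m (dimn D) (dimn D)) \<and>
     (\<forall>i<rk D. \<forall>n. \<forall>a<dimn D. \<forall>b<dimn D.
        (eop D i ^\<^sub>m n) $$ (a, b) / fact n \<in> \<int> \<and> (fop D i ^\<^sub>m n) $$ (a, b) / fact n \<in> \<int>) \<and>
     (\<forall>\<mu>. \<exists>c. \<forall>i<rk D. \<mu> i = (\<Sum>a<dimn D. c a * wt D a i))"

type_synonym 'p gfbar = "'p mod_ring alg_closure"

text \<open>\<open>exp(t X) = \<Sum>\<^sub>n t\<^sup>n X\<^sup>n / n!\<close> for the nilpotent matrices \<open>X = eop i, fop i\<close>; the entries of
  \<open>X\<^sup>n / n!\<close> are integers.\<close>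

definition exp_elt :: "chevalley \<Rightarrow> rat mat \<Rightarrow> 'p::prime_card gfbar \<Rightarrow> 'p gfbar mat" where
  "exp_elt D X t = mat (dimn D) (dimn D)
     (\<lambda>(a, b). \<Sum>n\<le>dimn D. t ^ n * of_int \<lfloor>(X ^\<^sub>m n) $$ (a, b) / fact n\<rfloor>)"

definition torus_elt :: "chevalley \<Rightarrow> nat \<Rightarrow> 'p::prime_card gfbar \<Rightarrow> 'p gfbar mat" where
  "torus_elt D i t = mat_diag (dimn D) (\<lambda>a. t powi wt D a i)"

text \<open>The points of \<open>G\<close> over the algebraic closure of the prime field. The subgroup is
  generated by root subgroups of simple roots and their negatives, and the set of these
  generators is closed under inverses.\<close>

inductive_set chev_group :: "chevalley \<Rightarrow> 'p::prime_card gfbar mat set" for D where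
  one: "1\<^sub>m (dimn D) \<in> chev_group D"
| pos: "g \<in> chev_group D \<Longrightarrow> i < rk D \<Longrightarrow> exp_elt D (eop D i) t * g \<in> chev_group D"
| neg: "g \<in> chev_group D \<Longrightarrow> i < rk D \<Longrightarrow> exp_elt D (fop D i) t * g \<in> chev_group D"

text \<open>Polynomials in the matrix entries with coefficients in the prime field: their
  restrictions to \<open>chev_group D\<close> form the coordinate ring of \<open>G\<close> over the prime field
  (\<open>G\<close> consists of matrices of determinant 1, and is reduced).\<close>

inductive_set regular_funs :: "chevalley \<Rightarrow> ('p::prime_card gfbar mat \<Rightarrow> 'p gfbar) set" for D where
  const: "(\<lambda>g. to_ac c) \<in> regular_funs D"
| entry: "a < dimn D \<Longrightarrow> b < dimn D \<Longrightarrow> (\<lambda>g. g $$ (a, b)) \<in> regular_funs D"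
| add: "\<phi> \<in> regular_funs D \<Longrightarrow> \<psi> \<in> regular_funs D \<Longrightarrow> (\<lambda>g. \<phi> g + \<psi> g) \<in> regular_funs D"
| mult: "\<phi> \<in> regular_funs D \<Longrightarrow> \<psi> \<in> regular_funs D \<Longrightarrow> (\<lambda>g. \<phi> g * \<psi> g) \<in> regular_funs D"


subsection \<open>Rational modules over the prime field\<close>

text \<open>A finite-dimensional rational \<open>G\<close>-module over the prime field, with underlying space
  \<open>K\<^sup>d\<close>, is given by its matrix coefficients; morphisms are matrices over \<open>K\<close>.\<close>

type_synonym 'p gmod = "nat \<times> ('p gfbar mat \<Rightarrow> 'p gfbar mat)"

abbreviation base_change :: "'p::prime_card mod_ring mat \<Rightarrow> 'p gfbar mat" where
  "base_change \<equiv> map_mat to_ac"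

fun is_gmod :: "chevalley \<Rightarrow> 'p::prime_card gmod \<Rightarrow> bool" where
  "is_gmod D (d, \<rho>) \<longleftrightarrow>
     (\<forall>g\<in>chev_group D. \<rho> g \<in> carrier_mat d d) \<and>
     \<rho> (1\<^sub>m (dimn D)) = 1\<^sub>m d \<and>
     (\<forall>g\<in>chev_group D. \<forall>h\<in>chev_group D. \<rho> (g * h) = \<rho> g * \<rho> h) \<and>
     (\<forall>i<d. \<forall>j<d. \<exists>\<phi>\<in>regular_funs D. \<forall>g\<in>chev_group D. \<rho> g $$ (i, j) = \<phi> g)"

definition gmod_hom ::
  "chevalley \<Rightarrow> 'p::prime_card gmod \<Rightarrow> 'p gmod \<Rightarrow> 'p mod_ring mat set" where
  "gmod_hom D V W = {M \<in> carrier_mat (fst W) (fst V).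
     \<forall>g\<in>chev_group D. base_change M * snd V g = snd W g * base_change M}"

definition inj_mat :: "'a::field mat \<Rightarrow> bool" where
  "inj_mat M \<longleftrightarrow> (\<forall>v\<in>carrier_vec (dim_col M). M *\<^sub>v v = 0\<^sub>v (dim_row M) \<longrightarrow> v = 0\<^sub>v (dim_col M))"

definition surj_mat :: "'a::field mat \<Rightarrow> bool" where
  "surj_mat M \<longleftrightarrow> (\<forall>w\<in>carrier_vec (dim_row M). \<exists>v\<in>carrier_vec (dim_col M). M *\<^sub>v v = w)"

definition short_exact ::
  "chevalley \<Rightarrow> 'p::prime_card gmod \<Rightarrow> 'p gmod \<Rightarrow> 'p gmod \<Rightarrow> bool" where
  "short_exact D U V W \<longleftrightarrow> (\<exists>M\<in>gmod_hom D U V. \<exists>N\<in>gmod_hom D V W.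
     inj_mat M \<and> surj_mat N \<and> N * M = 0\<^sub>m (fst W) (fst U) \<and> fst V = fst U + fst W)"

fun dual_gmod :: "chevalley \<Rightarrow> 'p::prime_card gmod \<Rightarrow> 'p gmod" where
  "dual_gmod D (d, \<rho>) =
     (d, \<lambda>g. transpose_mat (\<rho> (THE h. h \<in> chev_group D \<and> h * g = 1\<^sub>m (dimn D))))"

definition kron :: "'a::semiring_0 mat \<Rightarrow> 'a mat \<Rightarrow> 'a mat" where
  "kron M N = mat (dim_row M * dim_row N) (dim_col M * dim_col N)
     (\<lambda>(i, j). M $$ (i div dim_row N, j div dim_col N) * N $$ (i mod dim_row N, j mod dim_col N))"

text \<open>The matrix of \<open>v \<otimes> w \<mapsto> w \<otimes> v\<close> from \<open>K\<^sup>m \<otimes> K\<^sup>n\<close> to \<open>K\<^sup>n \<otimes> K\<^sup>m\<close>, in the bases used by \<open>kron\<close>.\<close>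

definition swap_mat :: "nat \<Rightarrow> nat \<Rightarrow> 'a::zero_neq_one mat" where
  "swap_mat m n = mat (n * m) (m * n)
     (\<lambda>(i, j). if i div m = j mod n \<and> i mod m = j div n then 1 else 0)"

fun tensor_gmod :: "'p::prime_card gmod \<Rightarrow> 'p gmod \<Rightarrow> 'p gmod" where
  "tensor_gmod (d, \<rho>) (e, \<sigma>) = (d * e, \<lambda>g. kron (\<rho> g) (\<sigma> g))"

definition trivial_gmod :: "'p::prime_card gmod" where
  "trivial_gmod = (1, \<lambda>g. 1\<^sub>m 1)"

fun sum_gmod :: "'p::prime_card gmod \<Rightarrow> 'p gmod \<Rightarrow> 'p gmod" where
  "sum_gmod (d, \<rho>) (e, \<sigma>) =
     (d + e, \<lambda>g. four_block_mat (\<rho> g) (0\<^sub>m d e) (0\<^sub>m e d) (\<sigma> g))"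

text \<open>A simple module with highest weight \<open>\<mu>\<close>.\<close>

definition simple_gmod :: "chevalley \<Rightarrow> (nat \<Rightarrow> int) \<Rightarrow> 'p::prime_card gmod \<Rightarrow> bool" where
  "simple_gmod D \<mu> V \<longleftrightarrow> is_gmod D V \<and> 0 < fst V \<and>
     (\<forall>U. is_gmod D U \<longrightarrow> (\<forall>M\<in>gmod_hom D U V. inj_mat M \<longrightarrow> fst U = 0 \<or> fst U = fst V)) \<and>
     (\<exists>v\<in>carrier_vec (fst V). v \<noteq> 0\<^sub>v (fst V) \<and>
        (\<forall>i<rk D. (\<forall>t. snd V (exp_elt D (eop D i) t) *\<^sub>v map_vec to_ac v = map_vec to_ac v) \<and>
           (\<forall>t. t \<noteq> 0 \<longrightarrow>
              snd V (torus_elt D i t) *\<^sub>v map_vec to_ac v = (t powi \<mu> i) \<cdot>\<^sub>v map_vec to_ac v)))"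


subsection \<open>Tilting modules\<close>

text \<open>
  \<open>H\<^sup>0(\<mu>) = {\<phi> \<in> K[G]. \<phi>(g b) = \<mu>(b)\<^sup>-\<^sup>1 \<phi>(g) for b \<in> B}\<close> with \<open>G\<close> acting by
  \<open>(g \<phi>)(x) = \<phi>(g\<^sup>-\<^sup>1 x)\<close>, where \<open>B\<close> is the negative Borel subgroup. For \<open>p\<close> larger than the
  Coxeter number the unipotent radical of \<open>B\<close> is generated by the root subgroups of the negatives
  of the simple roots.
\<close>

definition ind_funs :: "chevalley \<Rightarrow> (nat \<Rightarrow> int) \<Rightarrow> ('p::prime_card gfbar mat \<Rightarrow> 'p gfbar) set" where
  "ind_funs D \<mu> = {\<phi> \<in> regular_funs D. \<forall>g\<in>chev_group D. \<forall>i<rk D.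
     (\<forall>t. \<phi> (g * exp_elt D (fop D i) t) = \<phi> g) \<and>
     (\<forall>t. t \<noteq> 0 \<longrightarrow> \<phi> (g * torus_elt D i t) = t powi (- \<mu> i) * \<phi> g)}"

text \<open>\<open>V\<close> is isomorphic to \<open>H\<^sup>0(\<mu>)\<close>: the \<open>\<beta> j\<close> form a basis of \<open>H\<^sup>0(\<mu>)\<close> in which \<open>G\<close> acts by
  the matrices of \<open>V\<close>, written as \<open>\<beta> j x = (g (\<beta> j)) (g x)\<close>.\<close>

definition induced_gmod :: "chevalley \<Rightarrow> (nat \<Rightarrow> int) \<Rightarrow> 'p::prime_card gmod \<Rightarrow> bool" where
  "induced_gmod D \<mu> V \<longleftrightarrow> is_gmod D V \<and>
     (\<exists>\<beta>. (\<forall>j<fst V. \<beta> j \<in> ind_funs D \<mu>) \<and>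
        (\<forall>\<psi>\<in>ind_funs D \<mu>. \<exists>!c. c \<in> carrier_vec (fst V) \<and>
           (\<forall>g\<in>chev_group D. \<psi> g = (\<Sum>j<fst V. to_ac (c $ j) * \<beta> j g))) \<and>
        (\<forall>g\<in>chev_group D. \<forall>x\<in>chev_group D. \<forall>j<fst V.
           \<beta> j x = (\<Sum>i<fst V. snd V g $$ (i, j) * \<beta> i (g * x))))"

inductive good_filtration :: "chevalley \<Rightarrow> 'p::prime_card gmod \<Rightarrow> bool" for D where
  zero: "is_gmod D V \<Longrightarrow> fst V = 0 \<Longrightarrow> good_filtration D V"
| step: "good_filtration D U \<Longrightarrow> induced_gmod D \<mu> W \<Longrightarrow> \<forall>i<rk D. 0 \<le> \<mu> i \<Longrightarrow>
     is_gmod D V \<Longrightarrow> short_exact D U V W \<Longrightarrow> good_filtration D V"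

text \<open>Weyl modules are the duals of the modules \<open>H\<^sup>0(\<mu>)\<close>, so a Weyl filtration of \<open>V\<close> is a
  good filtration of the dual.\<close>

definition tilting :: "chevalley \<Rightarrow> 'p::prime_card gmod \<Rightarrow> bool" where
  "tilting D V \<longleftrightarrow> is_gmod D V \<and> good_filtration D V \<and> good_filtration D (dual_gmod D V)"


section \<open>Gelfand--Kazhdan categories\<close>

definition mat_trace :: "'a::comm_monoid_add mat \<Rightarrow> 'a" where
  "mat_trace M = (\<Sum>i<dim_row M. M $$ (i, i))"

definition negligible ::
  "chevalley \<Rightarrow> 'p::prime_card gmod \<Rightarrow> 'p gmod \<Rightarrow> 'p mod_ring mat \<Rightarrow> bool" where
  "negligible D V W M \<longleftrightarrow> (\<forall>N\<in>gmod_hom D W V. mat_trace (N * M) = 0)"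

text \<open>Equality of morphisms in the quotient by negligible morphisms.\<close>

definition quot_eq ::
  "chevalley \<Rightarrow> 'p::prime_card gmod \<Rightarrow> 'p gmod \<Rightarrow> 'p mod_ring mat \<Rightarrow> 'p mod_ring mat \<Rightarrow> bool" where
  "quot_eq D V W M N \<longleftrightarrow>
     M \<in> gmod_hom D V W \<and> N \<in> gmod_hom D V W \<and> negligible D V W (M - N)"

definition quot_iso ::
  "chevalley \<Rightarrow> 'p::prime_card gmod \<Rightarrow> 'p gmod \<Rightarrow> 'p mod_ring mat \<Rightarrow> bool" where
  "quot_iso D V W M \<longleftrightarrow> M \<in> gmod_hom D V W \<and>
     (\<exists>N\<in>gmod_hom D W V. quot_eq D V V (N * M) (1\<^sub>m (fst V)) \<and> quot_eq D W W (M * N) (1\<^sub>m (fst W)))"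

inductive alcove_root_sum :: "chevalley \<Rightarrow> 'p::prime_card gmod \<Rightarrow> bool" for D where
  zero: "is_gmod D V \<Longrightarrow> fst V = 0 \<Longrightarrow> alcove_root_sum D V"
| step: "simple_gmod D \<mu> (U :: 'p gmod) \<Longrightarrow> in_alcove (rk D) (cart D) CARD('p) \<mu> \<Longrightarrow>
     in_root_lattice (rk D) (cart D) \<mu> \<Longrightarrow> alcove_root_sum D V \<Longrightarrow>
     alcove_root_sum D (sum_gmod U V)"

text \<open>Objects of the quotient category generated by the simple objects over the root lattice.\<close>

definition root_object :: "chevalley \<Rightarrow> 'p::prime_card gmod \<Rightarrow> bool" where
  "root_object D V \<longleftrightarrow> tilting D V \<and> (\<exists>W M. tilting D W \<and> alcove_root_sum D W \<and> quot_iso D V W M)"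

text \<open>
  A \<open>K\<close>-linear symmetric monoidal equivalence from \<open>A\<close> to the full subcategory of root objects
  in the quotient of tilting modules: \<open>T\<close> on objects, \<open>F\<close> on morphisms (representatives),
  \<open>J X Y : T X \<otimes> T Y \<rightarrow> T (X \<diamond> Y)\<close> and \<open>u : K \<rightarrow> T \<one>\<close>. Modules have chosen bases, for which
  the associativity and unit isomorphisms of \<open>tensor_gmod\<close> are identity matrices.
\<close>

definition gk_equivalence ::
  "('o, 'm, 'p::prime_card mod_ring) tensor_cat \<Rightarrow> chevalley \<Rightarrow> ('o \<Rightarrow> 'p gmod) \<Rightarrow>
   ('m \<Rightarrow> 'p mod_ring mat) \<Rightarrow> ('o \<Rightarrow> 'o \<Rightarrow> 'p mod_ring mat) \<Rightarrow> 'p mod_ring mat \<Rightarrow> bool" where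
  "gk_equivalence A D T F J u \<longleftrightarrow>
     (\<forall>X\<in>Ob A. root_object D (T X)) \<and>
     (\<forall>V. root_object D V \<longrightarrow> (\<exists>X\<in>Ob A. \<exists>M. quot_iso D V (T X) M)) \<and>
     (\<forall>X\<in>Ob A. quot_eq D (T X) (T X) (F (idn A X)) (1\<^sub>m (fst (T X)))) \<and>
     (\<forall>X\<in>Ob A. \<forall>Y\<in>Ob A. \<forall>Z\<in>Ob A. \<forall>f\<in>Hm A X Y. \<forall>g\<in>Hm A Y Z.
        quot_eq D (T X) (T Z) (F (cmp A g f)) (F g * F f)) \<and>
     (\<forall>X\<in>Ob A. \<forall>Y\<in>Ob A. \<forall>f\<in>Hm A X Y. \<forall>g\<in>Hm A X Y.
        quot_eq D (T X) (T Y) (F (plu A f g)) (F f + F g) \<and>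
        (\<forall>c. quot_eq D (T X) (T Y) (F (scl A c f)) (c \<cdot>\<^sub>m F f)) \<and>
        (quot_eq D (T X) (T Y) (F f) (F g) \<longrightarrow> f = g)) \<and>
     (\<forall>X\<in>Ob A. \<forall>Y\<in>Ob A. \<forall>M\<in>gmod_hom D (T X) (T Y).
        \<exists>f\<in>Hm A X Y. quot_eq D (T X) (T Y) (F f) M) \<and>
     quot_iso D trivial_gmod (T (unt A)) u \<and>
     (\<forall>X\<in>Ob A. \<forall>Y\<in>Ob A. quot_iso D (tensor_gmod (T X) (T Y)) (T (tob A X Y)) (J X Y)) \<and>
     (\<forall>X\<in>Ob A. \<forall>Y\<in>Ob A. \<forall>X'\<in>Ob A. \<forall>Y'\<in>Ob A. \<forall>f\<in>Hm A X X'. \<forall>g\<in>Hm A Y Y'.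
        quot_eq D (tensor_gmod (T X) (T Y)) (T (tob A X' Y'))
          (F (tar A f g) * J X Y) (J X' Y' * kron (F f) (F g))) \<and>
     (\<forall>X\<in>Ob A. \<forall>Y\<in>Ob A. \<forall>Z\<in>Ob A.
        quot_eq D (tensor_gmod (tensor_gmod (T X) (T Y)) (T Z)) (T (tob A X (tob A Y Z)))
          (F (asc A X Y Z) * (J (tob A X Y) Z * kron (J X Y) (1\<^sub>m (fst (T Z)))))
          (J X (tob A Y Z) * kron (1\<^sub>m (fst (T X))) (J Y Z))) \<and>
     (\<forall>X\<in>Ob A.
        quot_eq D (T X) (T X)
          (F (lun A X) * (J (unt A) X * kron u (1\<^sub>m (fst (T X))))) (1\<^sub>m (fst (T X))) \<and>
        quot_eq D (T X) (T X)
          (F (run A X) * (J X (unt A) * kron (1\<^sub>m (fst (T X))) u)) (1\<^sub>m (fst (T X)))) \<and>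
     (\<forall>X\<in>Ob A. \<forall>Y\<in>Ob A.
        quot_eq D (tensor_gmod (T X) (T Y)) (T (tob A Y X))
          (F (sym A X Y) * J X Y) (J Y X * swap_mat (fst (T X)) (fst (T Y))))"

text \<open>A Gelfand--Kazhdan category over the root lattice, for \<open>p = CARD('p)\<close>, presented as a
  semisimple stable autonomous tensor category with set \<open>S\<close> of simple objects. (The assignment of
  dual objects with \<open>X** = X\<close> is part of the structure \<open>A\<close>, not of the category of modules.)\<close>

definition gelfand_kazhdan_root_category ::
  "('o, 'm, 'p::prime_card mod_ring) tensor_cat \<Rightarrow> 'o set \<Rightarrow> bool" where
  "gelfand_kazhdan_root_category A S \<longleftrightarrow>
     semisimple_stable_category A S \<and>
     (\<exists>D. simply_connected_chevalley D \<and> coxeter_number (rk D) (cart D) < CARD('p) \<and>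
        (\<exists>T F J u. gk_equivalence A D T F J u))"

end

theory Submission
  imports Defs
begin

text \<open>
  \<open>Tr\<^bsub>X\<rightarrow>\<one>\<^esub>\<close> is cyclic in \<open>X\<close>, hence additive over direct sum decompositions of \<open>X\<close>. Closing up the
  strands of \<open>y\<close> in \<open>[x y x\<^sup>-\<^sup>1 y\<^sup>-\<^sup>1, c]\<close> leaves the identity of \<open>c \<diamond> c*\<close>, whereas \<open>[x, b]\<close> is \<open>r(b)\<close>
  times the identity of \<open>b\<close>. Decomposing \<open>c \<diamond> c*\<close> into simple objects, the terms of \<open>Q(P')\<close> become
  \<open>\<Sum>\<^sub>b dim F(b, c \<diamond> c*) \<tau>(b)\<close> and those of \<open>Q(P'')\<close> are \<open>r(b) \<tau>(b)\<close> with the same \<open>\<tau>\<close>, so the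
  hypothesis, summed over \<open>c\<close>, gives the factor \<open>|\<Sigma>|\<close>.

  Morphisms of words form a strict symmetric monoidal category, in which equalities of diagrams are
  checked by sliding generators, padded with identities on both sides, past each other.
\<close>

subsection \<open>Arrows without explicit hom-sets\<close>

text \<open>The definitions spell out associators and unit isomorphisms and take dual bases by
  \<open>SOME\<close>. So two things precede any diagram: a coherence statement strong enough to
  make words strict, and independence of traces from the chosen bases, which is cyclicity applied to
  an identity morphism. The ranks balance as follows. [R, b] carries a factor r(b) in both
  presentations. In P' the group of y is c c*, whose dual bases are the unit and r(c)^{-1} times the
  counit, so tracing out y cancels r(c). In P'' nothing cancels and r(b) stays, which explains the
  r(b)^{-1} in the hypothesis. Since \<open>inverse 0 = 0\<close>, the hypothesis can be exploited
  only after r(b) is shown to be nonzero; this comes from nondegeneracy of dual bases. The remaining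
  obstacle is position: the new relator is appended last, while its letters belong to the group of
  x_k in the middle. Sliding them there by symmetries leaves the same endomorphism of the old groups
  in both presentations.\<close>

context category
begin

text \<open>In the axioms every morphism comes with a named source and target.
  \<open>hom_disjoint\<close> makes them functions of the morphism, so that typing turns into
  equations between \<open>src\<close> and \<open>tgt\<close> which the simplifier settles.\<close>

definition arr :: "'m \<Rightarrow> bool" where
  "arr f \<longleftrightarrow> (\<exists>X\<in>Ob A. \<exists>Y\<in>Ob A. f \<in> Hm A X Y)"

definition src :: "'m \<Rightarrow> 'o" where
  "src f = (THE X. X \<in> Ob A \<and> (\<exists>Y\<in>Ob A. f \<in> Hm A X Y))"

definition tgt :: "'m \<Rightarrow> 'o" where
  "tgt f = (THE Y. Y \<in> Ob A \<and> (\<exists>X\<in>Ob A. f \<in> Hm A X Y))"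

lemma hom_arr:
  assumes "X \<in> Ob A" "Y \<in> Ob A" "f \<in> Hm A X Y"
  shows "arr f" "src f = X" "tgt f = Y"
  unfolding arr_def src_def tgt_def using assms hom_disjoint by blast+

lemma arr_hom:
  assumes "arr f"
  shows "src f \<in> Ob A" "tgt f \<in> Ob A" "f \<in> Hm A (src f) (tgt f)"
  using assms hom_arr unfolding arr_def by auto

lemma hom_iff: "X \<in> Ob A \<Longrightarrow> Y \<in> Ob A \<Longrightarrow> f \<in> Hm A X Y \<longleftrightarrow> arr f \<and> src f = X \<and> tgt f = Y"
  using hom_arr arr_hom by metis

lemma arr_idn [simp]:
  assumes "X \<in> Ob A"
  shows "arr (idn A X)" "src (idn A X) = X" "tgt (idn A X) = X"
  using hom_arr[OF assms assms idn_closed[OF assms]] by auto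

lemma arr_cmp [simp]:
  assumes "arr f" "arr g" "src g = tgt f"
  shows "arr (g \<cdot> f)" "src (g \<cdot> f) = src f" "tgt (g \<cdot> f) = tgt g"
proof -
  have "g \<cdot> f \<in> Hm A (src f) (tgt g)"
    using cmp_closed[of "src f" "tgt f" "tgt g" f g] assms arr_hom by metis
  then show "arr (g \<cdot> f)" "src (g \<cdot> f) = src f" "tgt (g \<cdot> f) = tgt g"
    using hom_arr assms arr_hom by metis+
qed

lemma cmp_idn_left [simp]: "arr f \<Longrightarrow> X = tgt f \<Longrightarrow> idn A X \<cdot> f = f"
  using idn_left arr_hom by metis

lemma cmp_idn_right [simp]: "arr f \<Longrightarrow> X = src f \<Longrightarrow> f \<cdot> idn A X = f"
  using idn_right arr_hom by metis

lemma cmp_arr_assoc: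
  assumes "arr f" "arr g" "arr h" "src g = tgt f" "src h = tgt g"
  shows "(h \<cdot> g) \<cdot> f = h \<cdot> (g \<cdot> f)"
  using cmp_assoc[of "src f" "tgt f" "tgt g" "tgt h" f g h] assms arr_hom by metis

definition iso :: "'m \<Rightarrow> bool" where
  "iso f \<longleftrightarrow> arr f \<and> iso_arr A (src f) (tgt f) f"

lemma iso_arr_iso: "X \<in> Ob A \<Longrightarrow> Y \<in> Ob A \<Longrightarrow> iso_arr A X Y f \<Longrightarrow> iso f \<and> src f = X \<and> tgt f = Y"
  unfolding iso_def iso_arr_def inverse_pair_def using hom_arr by metis

lemma inverse_unique:
  assumes "arr f" "arr g" "arr h" "src g = tgt f" "tgt g = src f" "src h = tgt f" "tgt h = src f"
    and "g \<cdot> f = idn A (src f)" "f \<cdot> h = idn A (tgt f)"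
  shows "g = h"
  using assms cmp_arr_assoc[of h f g] by simp

text \<open>\<open>inv_arr\<close> is a definite description ranging over all pairs of objects.
  Disjointness of hom-sets forces every competing pair to be \<open>src f\<close>,
  \<open>tgt f\<close>, and then inverses are unique as in a monoid.\<close>

lemma inv_arr_eqI:
  assumes "arr f" "arr g" "src g = tgt f" "tgt g = src f"
    and "g \<cdot> f = idn A (src f)" "f \<cdot> g = idn A (tgt f)"
  shows "inv_arr A f = g" "iso f"
proof -
  have ip: "inverse_pair A (src f) (tgt f) f g"
    using assms arr_hom unfolding inverse_pair_def by metis
  show "inv_arr A f = g" unfolding inv_arr_def
  proof (rule the_equality)
    show "\<exists>X\<in>Ob A. \<exists>Y\<in>Ob A. inverse_pair A X Y f g"
      using ip arr_hom[OF assms(1)] by blast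
  next
    fix h assume "\<exists>X\<in>Ob A. \<exists>Y\<in>Ob A. inverse_pair A X Y f h"
    then obtain X Y where XY: "X \<in> Ob A" "Y \<in> Ob A" "inverse_pair A X Y f h" by blast
    then have "src f = X" "tgt f = Y" "arr h" "src h = Y" "tgt h = X" "h \<cdot> f = idn A X"
      using hom_arr unfolding inverse_pair_def by metis+
    then show "h = g" using inverse_unique[of f h g] assms by auto
  qed
  show "iso f" using ip assms(1) unfolding iso_def iso_arr_def by blast
qed

lemma iso_is_arr: "iso f \<Longrightarrow> arr f"
  unfolding iso_def by blast

lemma iso_inv [simp]:
  assumes "iso f"
  shows "arr (inv_arr A f)" "src (inv_arr A f) = tgt f" "tgt (inv_arr A f) = src f"
    "inv_arr A f \<cdot> f = idn A (src f)" "f \<cdot> inv_arr A f = idn A (tgt f)" "iso (inv_arr A f)"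
proof -
  obtain g where g: "inverse_pair A (src f) (tgt f) f g" and f: "arr f"
    using assms unfolding iso_def iso_arr_def by blast
  then have ag: "arr g" "src g = tgt f" "tgt g = src f" "g \<cdot> f = idn A (src f)" "f \<cdot> g = idn A (tgt f)"
    using hom_arr[of "tgt f" "src f" g] arr_hom[of f] unfolding inverse_pair_def by auto
  then have "inv_arr A f = g" using inv_arr_eqI[of f g] f by blast
  then show "arr (inv_arr A f)" "src (inv_arr A f) = tgt f" "tgt (inv_arr A f) = src f"
    "inv_arr A f \<cdot> f = idn A (src f)" "f \<cdot> inv_arr A f = idn A (tgt f)" "iso (inv_arr A f)"
    using ag f inv_arr_eqI(2)[of g f] by auto
qed

lemma iso_cancel_left [simp]:
  "iso f \<Longrightarrow> arr g \<Longrightarrow> tgt g = src f \<Longrightarrow> inv_arr A f \<cdot> (f \<cdot> g) = g"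
  "iso f \<Longrightarrow> arr g \<Longrightarrow> tgt g = tgt f \<Longrightarrow> f \<cdot> (inv_arr A f \<cdot> g) = g"
  by (simp_all add: iso_is_arr flip: cmp_arr_assoc)

lemma iso_cancel_right [simp]:
  "iso f \<Longrightarrow> arr g \<Longrightarrow> src g = tgt f \<Longrightarrow> (g \<cdot> f) \<cdot> inv_arr A f = g"
  "iso f \<Longrightarrow> arr g \<Longrightarrow> src g = src f \<Longrightarrow> (g \<cdot> inv_arr A f) \<cdot> f = g"
  by (simp_all add: cmp_arr_assoc iso_is_arr)

lemma iso_idn [simp]:
  assumes "X \<in> Ob A"
  shows "iso (idn A X)" "inv_arr A (idn A X) = idn A X"
  by - (rule inv_arr_eqI[of _ "idn A X"]; simp add: assms)+

lemma iso_cmp [simp]: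
  assumes "iso f" "iso g" "src g = tgt f"
  shows "iso (g \<cdot> f)" "inv_arr A (g \<cdot> f) = inv_arr A f \<cdot> inv_arr A g"
  by - (rule inv_arr_eqI[of _ "inv_arr A f \<cdot> inv_arr A g"]; simp add: assms iso_is_arr cmp_arr_assoc)+

lemma iso_inv_inv [simp]: "iso f \<Longrightarrow> inv_arr A (inv_arr A f) = f"
  by (rule inv_arr_eqI) (simp_all add: iso_is_arr)

lemma iso_cancel_iff:
  assumes "iso f" "arr g" "arr h" "src g = tgt f" "src h = tgt f" "g \<cdot> f = h \<cdot> f"
  shows "g = h"
  using assms iso_cancel_right(1) by metis

lemma iso_left_cancel_iff:
  assumes "iso f" "arr g" "arr h" "tgt g = src f" "tgt h = src f" "f \<cdot> g = f \<cdot> h"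
  shows "g = h"
  using assms iso_cancel_left(1) by metis

end

subsection \<open>Unit coherence\<close>

context symmetric_monoidal_category
begin

lemma unt_ob' [simp]: "\<one>\<^sub>c \<in> Ob A" by (rule unt_ob)
lemma tob_ob' [simp]: "X \<in> Ob A \<Longrightarrow> Y \<in> Ob A \<Longrightarrow> X \<diamond> Y \<in> Ob A" by (rule tob_ob)

lemma src_tgt_ob [simp]: "arr f \<Longrightarrow> src f \<in> Ob A" "arr f \<Longrightarrow> tgt f \<in> Ob A"
  using arr_hom by auto

lemma arr_tar [simp]:
  assumes "arr f" "arr g"
  shows "arr (f \<boxtimes> g)" "src (f \<boxtimes> g) = src f \<diamond> src g" "tgt (f \<boxtimes> g) = tgt f \<diamond> tgt g"
proof -
  have h: "f \<boxtimes> g \<in> Hm A (src f \<diamond> src g) (tgt f \<diamond> tgt g)"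
    using tar_closed arr_hom assms by metis
  from this show "arr (f \<boxtimes> g)" "src (f \<boxtimes> g) = src f \<diamond> src g" "tgt (f \<boxtimes> g) = tgt f \<diamond> tgt g"
    using hom_arr[OF _ _ h] arr_hom assms by auto
qed

lemma interchange:
  assumes "arr f" "arr g" "arr f'" "arr g'" "src g = tgt f" "src g' = tgt f'"
  shows "(g \<boxtimes> g') \<cdot> (f \<boxtimes> f') = (g \<cdot> f) \<boxtimes> (g' \<cdot> f')"
  using tar_cmp[of "src f" "tgt f" "tgt g" "src f'" "tgt f'" "tgt g'" f g f' g'] assms
    arr_hom[of f] arr_hom[of g] arr_hom[of f'] arr_hom[of g'] by simp

lemma interchange_rest:
  assumes "arr f" "arr g" "arr f'" "arr g'" "arr h" "src g = tgt f" "src g' = tgt f'"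
    "tgt h = src f \<diamond> src f'"
  shows "(g \<boxtimes> g') \<cdot> ((f \<boxtimes> f') \<cdot> h) = ((g \<cdot> f) \<boxtimes> (g' \<cdot> f')) \<cdot> h"
  using assms by (simp add: interchange flip: cmp_arr_assoc)

lemma iso_tar [simp]:
  assumes "iso f" "iso g"
  shows "iso (f \<boxtimes> g)" "inv_arr A (f \<boxtimes> g) = inv_arr A f \<boxtimes> inv_arr A g"
  by - (rule inv_arr_eqI[of _ "inv_arr A f \<boxtimes> inv_arr A g"];
      simp add: assms iso_is_arr interchange tar_idn)+

lemma iso_asc [simp]:
  assumes "X \<in> Ob A" "Y \<in> Ob A" "Z \<in> Ob A"
  shows "arr (asc A X Y Z)" "iso (asc A X Y Z)" "src (asc A X Y Z) = (X \<diamond> Y) \<diamond> Z" "tgt (asc A X Y Z) = X \<diamond> (Y \<diamond> Z)"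
  using iso_arr_iso[OF _ _ asc_iso[OF assms]] assms iso_is_arr by auto

lemma iso_lun [simp]:
  assumes "X \<in> Ob A" shows "arr (lun A X)" "iso (lun A X)" "src (lun A X) = \<one>\<^sub>c \<diamond> X" "tgt (lun A X) = X"
  using iso_arr_iso[OF _ _ lun_iso[OF assms]] assms iso_is_arr by auto

lemma iso_run [simp]:
  assumes "X \<in> Ob A" shows "arr (run A X)" "iso (run A X)" "src (run A X) = X \<diamond> \<one>\<^sub>c" "tgt (run A X) = X"
  using iso_arr_iso[OF _ _ run_iso[OF assms]] assms iso_is_arr by auto

lemma arr_sym [simp]:
  assumes "X \<in> Ob A" "Y \<in> Ob A"
  shows "arr (sym A X Y)" "src (sym A X Y) = X \<diamond> Y" "tgt (sym A X Y) = Y \<diamond> X"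
  using hom_arr[OF _ _ sym_closed[OF assms]] assms by auto

lemma iso_sym [simp]:
  assumes "X \<in> Ob A" "Y \<in> Ob A"
  shows "iso (sym A X Y)" "inv_arr A (sym A X Y) = sym A Y X"
  by - (rule inv_arr_eqI[of _ "sym A Y X"]; simp add: assms sym_sym)+

lemma asc_nat:
  assumes "arr f" "arr g" "arr h"
  shows "asc A (tgt f) (tgt g) (tgt h) \<cdot> ((f \<boxtimes> g) \<boxtimes> h) = (f \<boxtimes> (g \<boxtimes> h)) \<cdot> asc A (src f) (src g) (src h)"
  using asc_natural[OF _ _ _ _ _ _ arr_hom(3) arr_hom(3) arr_hom(3)] assms by simp

lemma lun_nat: "arr f \<Longrightarrow> lun A (tgt f) \<cdot> (idn A \<one>\<^sub>c \<boxtimes> f) = f \<cdot> lun A (src f)"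
  using lun_natural[OF _ _ arr_hom(3)] by simp

lemma run_nat: "arr f \<Longrightarrow> run A (tgt f) \<cdot> (f \<boxtimes> idn A \<one>\<^sub>c) = f \<cdot> run A (src f)"
  using run_natural[OF _ _ arr_hom(3)] by simp

lemma sym_nat:
  "arr f \<Longrightarrow> arr g \<Longrightarrow> sym A (tgt f) (tgt g) \<cdot> (f \<boxtimes> g) = (g \<boxtimes> f) \<cdot> sym A (src f) (src g)"
  using sym_natural[OF _ _ _ _ arr_hom(3) arr_hom(3)] by simp

text \<open>\<open>lun\<close> is a natural isomorphism from tensoring with the unit to the identity
  functor. Hence an equation may be checked after tensoring with the unit, where the triangle axiom
  applies.\<close>

lemma unt_tar_faithful:
  assumes "arr f" "arr g" "src f = src g" "tgt f = tgt g" "idn A \<one>\<^sub>c \<boxtimes> f = idn A \<one>\<^sub>c \<boxtimes> g"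
  shows "f = g"
proof -
  have "f \<cdot> lun A (src f) = g \<cdot> lun A (src f)"
    using trans[OF lun_nat[OF assms(1), symmetric, unfolded assms(3-5)] lun_nat[OF assms(2)]]
    by (simp only: assms(3))
  then show ?thesis
    by (rule iso_cancel_iff[OF iso_lun(2) assms(1,2), rotated -1])
      (simp_all only: assms(3) src_tgt_ob(1)[OF assms(2)] iso_lun(4))
qed

lemma tar_unt_faithful:
  assumes "arr f" "arr g" "src f = src g" "tgt f = tgt g" "f \<boxtimes> idn A \<one>\<^sub>c = g \<boxtimes> idn A \<one>\<^sub>c"
  shows "f = g"
proof -
  have "f \<cdot> run A (src f) = g \<cdot> run A (src f)"
    using trans[OF run_nat[OF assms(1), symmetric, unfolded assms(3-5)] run_nat[OF assms(2)]]
    by (simp only: assms(3))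
  then show ?thesis
    by (rule iso_cancel_iff[OF iso_run(2) assms(1,2), rotated -1])
      (simp_all only: assms(3) src_tgt_ob(1)[OF assms(2)] iso_run(4))
qed

text \<open>Kelly's argument: the triangle axiom only concerns a unit in the middle. After tensoring
  with a further unit on the left, the pentagon for \<open>\<one>\<^sub>c\<close>,
  \<open>\<one>\<^sub>c\<close>, \<open>X\<close>, \<open>Y\<close> expresses both sides through
  middle units.\<close>

lemma lun_tob:
  assumes X [simp]: "X \<in> Ob A" and Y [simp]: "Y \<in> Ob A"
  shows "lun A (X \<diamond> Y) \<cdot> asc A \<one>\<^sub>c X Y = lun A X \<boxtimes> idn A Y"
proof (rule unt_tar_faithful)
  let ?I = "\<one>\<^sub>c" and ?i = "idn A \<one>\<^sub>c"
  \<comment> \<open>Two edges of the pentagon. Precomposing with this isomorphism makes the pentagon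
    applicable, and it is cancelled at the end.\<close>
  let ?p = "asc A ?I (?I \<diamond> X) Y \<cdot> (asc A ?I ?I X \<boxtimes> idn A Y)"
  have "(?i \<boxtimes> (lun A (X \<diamond> Y) \<cdot> asc A ?I X Y)) \<cdot> ?p
      = (?i \<boxtimes> lun A (X \<diamond> Y)) \<cdot> ((?i \<boxtimes> asc A ?I X Y) \<cdot> asc A ?I (?I \<diamond> X) Y \<cdot> (asc A ?I ?I X \<boxtimes> idn A Y))"
    by (simp add: cmp_arr_assoc interchange_rest)
  also have "\<dots> = (?i \<boxtimes> lun A (X \<diamond> Y)) \<cdot> asc A ?I ?I (X \<diamond> Y) \<cdot> asc A (?I \<diamond> ?I) X Y"
    by (subst pentagon[symmetric]) (simp_all add: cmp_arr_assoc)
  also have "\<dots> = (run A ?I \<boxtimes> (idn A X \<boxtimes> idn A Y)) \<cdot> asc A (?I \<diamond> ?I) X Y"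
    by (simp add: triangle tar_idn)
  also have "\<dots> = asc A ?I X Y \<cdot> ((run A ?I \<boxtimes> idn A X) \<boxtimes> idn A Y)"
    using asc_nat[of "run A ?I" "idn A X" "idn A Y"] by simp
  also have "\<dots> = asc A ?I X Y \<cdot> (((?i \<boxtimes> lun A X) \<boxtimes> idn A Y) \<cdot> (asc A ?I ?I X \<boxtimes> idn A Y))"
    by (simp add: interchange triangle)
  also have "\<dots> = (asc A ?I X Y \<cdot> ((?i \<boxtimes> lun A X) \<boxtimes> idn A Y)) \<cdot> (asc A ?I ?I X \<boxtimes> idn A Y)"
    by (simp add: cmp_arr_assoc)
  also have "\<dots> = (?i \<boxtimes> (lun A X \<boxtimes> idn A Y)) \<cdot> ?p"
    using asc_nat[of "?i" "lun A X" "idn A Y"] by (simp add: cmp_arr_assoc)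
  finally show "?i \<boxtimes> (lun A (X \<diamond> Y) \<cdot> asc A ?I X Y) = ?i \<boxtimes> (lun A X \<boxtimes> idn A Y)"
    by (rule iso_cancel_iff[rotated -1]) simp_all
qed simp_all

text \<open>The mirror image of \<open>lun_tob\<close>: the pentagon for \<open>X\<close>,
  \<open>Y\<close>, \<open>\<one>\<^sub>c\<close>, \<open>\<one>\<^sub>c\<close>, with the extra
  unit tensored on the right.\<close>

lemma run_tob:
  assumes X [simp]: "X \<in> Ob A" and Y [simp]: "Y \<in> Ob A"
  shows "(idn A X \<boxtimes> run A Y) \<cdot> asc A X Y \<one>\<^sub>c = run A (X \<diamond> Y)"
proof (rule tar_unt_faithful)
  let ?I = "\<one>\<^sub>c" and ?i = "idn A \<one>\<^sub>c"
  let ?l = "idn A X \<boxtimes> (idn A Y \<boxtimes> lun A ?I)"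
  have "asc A X Y ?I \<cdot> (run A (X \<diamond> Y) \<boxtimes> ?i)
      = asc A X Y ?I \<cdot> (((idn A X \<boxtimes> idn A Y) \<boxtimes> lun A ?I) \<cdot> asc A (X \<diamond> Y) ?I ?I)"
    by (simp add: triangle tar_idn)
  also have "\<dots> = ?l \<cdot> (asc A X Y (?I \<diamond> ?I) \<cdot> asc A (X \<diamond> Y) ?I ?I)"
    using asc_nat[of "idn A X" "idn A Y" "lun A ?I"] by (simp flip: cmp_arr_assoc)
  also have "\<dots> = ?l \<cdot> ((idn A X \<boxtimes> asc A Y ?I ?I) \<cdot> (asc A X (Y \<diamond> ?I) ?I \<cdot> (asc A X Y ?I \<boxtimes> ?i)))"
    by (subst pentagon) (simp_all add: cmp_arr_assoc)
  also have "\<dots> = (idn A X \<boxtimes> (run A Y \<boxtimes> ?i)) \<cdot> (asc A X (Y \<diamond> ?I) ?I \<cdot> (asc A X Y ?I \<boxtimes> ?i))"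
    by (simp add: interchange_rest triangle)
  also have "\<dots> = ((idn A X \<boxtimes> (run A Y \<boxtimes> ?i)) \<cdot> asc A X (Y \<diamond> ?I) ?I) \<cdot> (asc A X Y ?I \<boxtimes> ?i)"
    by (simp add: cmp_arr_assoc)
  also have "\<dots> = asc A X Y ?I \<cdot> (((idn A X \<boxtimes> run A Y) \<boxtimes> ?i) \<cdot> (asc A X Y ?I \<boxtimes> ?i))"
    using asc_nat[of "idn A X" "run A Y" "?i"] by (simp add: cmp_arr_assoc[symmetric])
  finally have "asc A X Y ?I \<cdot> (run A (X \<diamond> Y) \<boxtimes> ?i)
      = asc A X Y ?I \<cdot> (((idn A X \<boxtimes> run A Y) \<cdot> asc A X Y ?I) \<boxtimes> ?i)"
    by (simp add: interchange)
  then show "((idn A X \<boxtimes> run A Y) \<cdot> asc A X Y ?I) \<boxtimes> ?i = run A (X \<diamond> Y) \<boxtimes> ?i"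
    by (rule iso_left_cancel_iff[rotated -1, symmetric]) simp_all
qed simp_all

text \<open>Naturality of \<open>lun\<close> at its own component identifies two ways of removing a
  unit; \<open>lun_tob\<close> and the triangle axiom then compare \<open>lun\<close> with
  \<open>run\<close>. This reconciles the clauses of \<open>merge\<close> when both words are
  empty.\<close>

lemma lun_unt: "lun A \<one>\<^sub>c = run A \<one>\<^sub>c"
proof (rule tar_unt_faithful)
  let ?I = "\<one>\<^sub>c" and ?i = "idn A \<one>\<^sub>c"
  have "lun A ?I \<cdot> (?i \<boxtimes> lun A ?I) = lun A ?I \<cdot> lun A (?I \<diamond> ?I)"
    using lun_nat[of "lun A ?I"] by simp
  then have e: "?i \<boxtimes> lun A ?I = lun A (?I \<diamond> ?I)"
    by (rule iso_left_cancel_iff[rotated -1]) simp_all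
  have "lun A ?I \<boxtimes> ?i = lun A (?I \<diamond> ?I) \<cdot> asc A ?I ?I ?I" by (simp add: lun_tob)
  also have "\<dots> = run A ?I \<boxtimes> ?i" by (simp add: triangle flip: e)
  finally show "lun A ?I \<boxtimes> ?i = run A ?I \<boxtimes> ?i" .
qed simp_all

subsection \<open>Coherence of the reassociation isomorphisms\<close>

abbreviation wcmp_syntax (infixl "\<star>" 70) where "f \<star> g \<equiv> wcmp A f g"
abbreviation wten_syntax (infixl "\<diamondop>" 72) where "f \<diamondop> g \<equiv> wten A f g"

definition wob where "wob xs \<longleftrightarrow> set xs \<subseteq> Ob A"

lemma wob_simps [simp]:
  "wob []" "wob (x # xs) \<longleftrightarrow> x \<in> Ob A \<and> wob xs" "wob (xs @ ys) \<longleftrightarrow> wob xs \<and> wob ys"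
  by (auto simp: wob_def)

lemma wprod_snoc: "xs \<noteq> [] \<Longrightarrow> wprod A (xs @ [z]) = wprod A xs \<diamond> z"
  by (cases xs) auto

lemma wprod_ob [simp]: "wob xs \<Longrightarrow> wprod A xs \<in> Ob A"
proof (induction xs rule: rev_induct)
  case (snoc z xs)
  then show ?case by (cases "xs = []") (auto simp: wprod_snoc)
qed simp

lemma inv_asc_nat:
  assumes "arr f" "arr g" "arr h"
  shows "inv_arr A (asc A (tgt f) (tgt g) (tgt h)) \<cdot> (f \<boxtimes> (g \<boxtimes> h))
       = ((f \<boxtimes> g) \<boxtimes> h) \<cdot> inv_arr A (asc A (src f) (src g) (src h))"
proof (rule iso_left_cancel_iff[of "asc A (tgt f) (tgt g) (tgt h)"])
  show "asc A (tgt f) (tgt g) (tgt h) \<cdot> (inv_arr A (asc A (tgt f) (tgt g) (tgt h)) \<cdot> (f \<boxtimes> (g \<boxtimes> h)))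
    = asc A (tgt f) (tgt g) (tgt h) \<cdot> (((f \<boxtimes> g) \<boxtimes> h) \<cdot> inv_arr A (asc A (src f) (src g) (src h)))"
    using assms by (subst cmp_arr_assoc[symmetric], simp_all) (simp add: asc_nat)
qed (use assms in simp_all)

text \<open>The pentagon rearranged so that the associators that split off the last factor
  \<open>Z\<close> occur inverted, as they do in the recursion of \<open>merge\<close>.\<close>

lemma inv_pentagon:
  assumes [simp]: "W \<in> Ob A" "X \<in> Ob A" "Y \<in> Ob A" "Z \<in> Ob A"
  shows "inv_arr A (asc A W (X \<diamond> Y) Z) \<cdot> ((idn A W \<boxtimes> inv_arr A (asc A X Y Z)) \<cdot> asc A W X (Y \<diamond> Z))
    = (asc A W X Y \<boxtimes> idn A Z) \<cdot> inv_arr A (asc A (W \<diamond> X) Y Z)"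
proof (rule iso_cancel_iff[of "asc A (W \<diamond> X) Y Z"])
  have "((idn A W \<boxtimes> inv_arr A (asc A X Y Z)) \<cdot> asc A W X (Y \<diamond> Z)) \<cdot> asc A (W \<diamond> X) Y Z
    = (idn A W \<boxtimes> inv_arr A (asc A X Y Z)) \<cdot> (idn A W \<boxtimes> asc A X Y Z) \<cdot> asc A W (X \<diamond> Y) Z \<cdot> (asc A W X Y \<boxtimes> idn A Z)"
    by (simp add: cmp_arr_assoc pentagon)
  also have "\<dots> = asc A W (X \<diamond> Y) Z \<cdot> (asc A W X Y \<boxtimes> idn A Z)"
    by (simp add: interchange tar_idn)
  finally show "inv_arr A (asc A W (X \<diamond> Y) Z) \<cdot> ((idn A W \<boxtimes> inv_arr A (asc A X Y Z)) \<cdot> asc A W X (Y \<diamond> Z)) \<cdot> asc A (W \<diamond> X) Y Z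
    = (asc A W X Y \<boxtimes> idn A Z) \<cdot> inv_arr A (asc A (W \<diamond> X) Y Z) \<cdot> asc A (W \<diamond> X) Y Z"
    by (simp add: cmp_arr_assoc)
qed simp_all

lemma merge_nil_left: "merge A [] ys = lun A (wprod A ys)"
  by (simp add: merge_def)

lemma merge_nil_right: "merge A xs [] = run A (wprod A xs)"
  by (cases xs) (auto simp: merge_def lun_unt)

lemma merge_single: "xs \<noteq> [] \<Longrightarrow> merge A xs [y] = idn A (wprod A xs \<diamond> y)"
  by (simp add: merge_def)

text \<open>For empty \<open>xs\<close> the definition of \<open>merge\<close> is a different
  clause, and the recursion holds by \<open>lun_tob\<close>. The word \<open>ys\<close> has to be
  nonempty because the product of \<open>[z]\<close> is \<open>z\<close> itself and not
  \<open>\<one>\<^sub>c \<diamond> z\<close>.\<close>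

lemma merge_snoc:
  assumes "wob xs" "wob ys" "z \<in> Ob A" "ys \<noteq> []"
  shows "merge A xs (ys @ [z])
    = (merge A xs ys \<boxtimes> idn A z) \<cdot> inv_arr A (asc A (wprod A xs) (wprod A ys) z)"
proof (cases "xs = []")
  case True
  then show ?thesis using assms lun_tob[of "wprod A ys" z, symmetric]
    by (simp add: merge_nil_left wprod_snoc)
next
  case False
  moreover obtain y zs where "rev ys = y # zs" using assms(4) by (cases "rev ys") auto
  moreover from this have "ys = rev zs @ [y]" by (simp add: rev_eq_Cons_iff)
  ultimately show ?thesis by (simp add: merge_def)
qed

lemma iso_merge [simp]:
  assumes xs: "wob xs" and "wob ys"
  shows "arr (merge A xs ys)" "iso (merge A xs ys)"
    "src (merge A xs ys) = wprod A xs \<diamond> wprod A ys" "tgt (merge A xs ys) = wprod A (xs @ ys)"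
proof -
  have "arr (merge A xs ys) \<and> iso (merge A xs ys) \<and>
    src (merge A xs ys) = wprod A xs \<diamond> wprod A ys \<and> tgt (merge A xs ys) = wprod A (xs @ ys)"
    using \<open>wob ys\<close>
  proof (induction ys rule: rev_induct)
    case Nil
    then show ?case using xs by (simp add: merge_nil_right)
  next
    case (snoc z ys)
    consider "ys = []" "xs = []" | "ys = []" "xs \<noteq> []" | "ys \<noteq> []" by blast
    then show ?case
    proof cases
      case 1 then show ?thesis using snoc.prems by (simp add: merge_nil_left)
    next
      case 2 then show ?thesis using snoc.prems xs by (simp add: merge_single wprod_snoc)
    next
      case 3 then show ?thesis using snoc xs wprod_snoc[of "xs @ ys" z]
        by (simp add: merge_snoc wprod_snoc)
    qed
  qed
  then show "arr (merge A xs ys)" "iso (merge A xs ys)"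
    "src (merge A xs ys) = wprod A xs \<diamond> wprod A ys" "tgt (merge A xs ys) = wprod A (xs @ ys)"
    by auto
qed

text \<open>All the coherence that words require. The induction on the last word uses one pentagon
  per letter. The unit laws enter through empty words: \<open>run_tob\<close> when the last word is
  empty, the triangle axiom when it receives its first letter while the middle word is
  empty.\<close>

lemma merge_assoc:
  assumes xs [simp]: "wob xs" and ys [simp]: "wob ys" and "wob zs"
  shows "merge A (xs @ ys) zs \<cdot> (merge A xs ys \<boxtimes> idn A (wprod A zs))
    = merge A xs (ys @ zs) \<cdot> ((idn A (wprod A xs) \<boxtimes> merge A ys zs)
        \<cdot> asc A (wprod A xs) (wprod A ys) (wprod A zs))"
  using \<open>wob zs\<close>
proof (induction zs rule: rev_induct)
  case Nil
  have "run A (wprod A (xs @ ys)) \<cdot> (merge A xs ys \<boxtimes> idn A \<one>\<^sub>c)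
      = merge A xs ys \<cdot> run A (wprod A xs \<diamond> wprod A ys)"
    using run_nat[of "merge A xs ys"] by simp
  then show ?case by (simp add: merge_nil_right run_tob)
next
  case (snoc z zs)
  then have z [simp]: "z \<in> Ob A" and zs [simp]: "wob zs" by simp_all
  let ?X = "wprod A xs" and ?Y = "wprod A ys" and ?Z = "wprod A zs"
  consider "zs = []" "ys = []" | "zs = []" "ys \<noteq> []" | "zs \<noteq> []" by blast
  then show ?case
  proof cases
    case 1
    then show ?thesis by (simp add: merge_nil_right merge_nil_left triangle)
  next
    case 2
    then show ?thesis
      by (simp add: merge_single merge_snoc tar_idn wprod_snoc cmp_arr_assoc)
  next
    case 3
    let ?m = "merge A xs ys" and ?M = "merge A (xs @ ys) zs"
      and ?n = "merge A ys zs" and ?N = "merge A xs (ys @ zs)"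
    have "merge A (xs @ ys) (zs @ [z]) \<cdot> (?m \<boxtimes> idn A (wprod A (zs @ [z])))
        = (?M \<boxtimes> idn A z) \<cdot> (inv_arr A (asc A (wprod A (xs @ ys)) ?Z z) \<cdot> (?m \<boxtimes> (idn A ?Z \<boxtimes> idn A z)))"
      using 3 by (simp add: merge_snoc wprod_snoc tar_idn cmp_arr_assoc)
    also have "\<dots> = (?M \<boxtimes> idn A z) \<cdot> (((?m \<boxtimes> idn A ?Z) \<boxtimes> idn A z) \<cdot> inv_arr A (asc A (?X \<diamond> ?Y) ?Z z))"
      using inv_asc_nat[of ?m "idn A ?Z" "idn A z"] by simp
    also have "\<dots> = ((?M \<cdot> (?m \<boxtimes> idn A ?Z)) \<boxtimes> idn A z) \<cdot> inv_arr A (asc A (?X \<diamond> ?Y) ?Z z)"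
      by (simp add: interchange_rest)
    also have "\<dots> = ((?N \<cdot> ((idn A ?X \<boxtimes> ?n) \<cdot> asc A ?X ?Y ?Z)) \<boxtimes> idn A z) \<cdot> inv_arr A (asc A (?X \<diamond> ?Y) ?Z z)"
      using snoc.IH by simp
    also have "\<dots> = (?N \<boxtimes> idn A z) \<cdot> (((idn A ?X \<boxtimes> ?n) \<boxtimes> idn A z) \<cdot> ((asc A ?X ?Y ?Z \<boxtimes> idn A z) \<cdot> inv_arr A (asc A (?X \<diamond> ?Y) ?Z z)))"
      by (simp add: interchange_rest)
    also have "\<dots> = (?N \<boxtimes> idn A z) \<cdot> (((idn A ?X \<boxtimes> ?n) \<boxtimes> idn A z) \<cdot> (inv_arr A (asc A ?X (?Y \<diamond> ?Z) z) \<cdot> ((idn A ?X \<boxtimes> inv_arr A (asc A ?Y ?Z z)) \<cdot> asc A ?X ?Y (?Z \<diamond> z))))"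
      by (simp only: inv_pentagon wprod_ob xs ys z zs)
    also have "\<dots> = (?N \<boxtimes> idn A z) \<cdot> ((((idn A ?X \<boxtimes> ?n) \<boxtimes> idn A z) \<cdot> inv_arr A (asc A ?X (?Y \<diamond> ?Z) z)) \<cdot> ((idn A ?X \<boxtimes> inv_arr A (asc A ?Y ?Z z)) \<cdot> asc A ?X ?Y (?Z \<diamond> z)))"
      by (simp add: cmp_arr_assoc)
    also have "\<dots> = (?N \<boxtimes> idn A z) \<cdot> ((inv_arr A (asc A ?X (wprod A (ys @ zs)) z) \<cdot> (idn A ?X \<boxtimes> (?n \<boxtimes> idn A z))) \<cdot> ((idn A ?X \<boxtimes> inv_arr A (asc A ?Y ?Z z)) \<cdot> asc A ?X ?Y (?Z \<diamond> z)))"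
      using inv_asc_nat[of "idn A ?X" ?n "idn A z"] by simp
    also have "\<dots> = ((?N \<boxtimes> idn A z) \<cdot> inv_arr A (asc A ?X (wprod A (ys @ zs)) z)) \<cdot> ((idn A ?X \<boxtimes> ((?n \<boxtimes> idn A z) \<cdot> inv_arr A (asc A ?Y ?Z z))) \<cdot> asc A ?X ?Y (?Z \<diamond> z))"
      by (simp add: cmp_arr_assoc interchange_rest)
    also have "\<dots> = merge A xs (ys @ (zs @ [z])) \<cdot> ((idn A ?X \<boxtimes> merge A ys (zs @ [z])) \<cdot> asc A ?X ?Y (wprod A (zs @ [z])))"
      using 3 merge_snoc[of xs "ys @ zs" z] by (simp add: merge_snoc wprod_snoc)
    finally show ?thesis .
  qed
qed

subsection \<open>The strict category of words\<close>

abbreviation wsrc where "wsrc f \<equiv> fst f"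
abbreviation wtgt where "wtgt f \<equiv> snd (snd f)"
abbreviation wmor where "wmor f \<equiv> fst (snd f)"

text \<open>Word morphisms are untyped triples. Their ends are recorded as lists and not as products
  because different words, such as \<open>[X, Y]\<close> and \<open>[X \<diamond> Y]\<close>, can
  have the same product.\<close>

definition warr where
  "warr f \<longleftrightarrow> wob (wsrc f) \<and> wob (wtgt f) \<and> arr (wmor f) \<and>
     src (wmor f) = wprod A (wsrc f) \<and> tgt (wmor f) = wprod A (wtgt f)"

lemma warrD:
  assumes "warr f"
  shows "wob (wsrc f)" "wob (wtgt f)" "arr (wmor f)"
    "src (wmor f) = wprod A (wsrc f)" "tgt (wmor f) = wprod A (wtgt f)"
  using assms by (auto simp: warr_def)

lemma warr_wob [simp]: "warr f \<Longrightarrow> wob (wsrc f)" "warr f \<Longrightarrow> wob (wtgt f)"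
  using warrD by auto

lemma word_mor_eqI: "wsrc f = wsrc g \<Longrightarrow> wmor f = wmor g \<Longrightarrow> wtgt f = wtgt g \<Longrightarrow> f = g"
  by (simp add: prod_eq_iff)

lemma wcmp_sel [simp]:
  "wsrc (g \<star> f) = wsrc f" "wtgt (g \<star> f) = wtgt g" "wmor (g \<star> f) = wmor g \<cdot> wmor f"
  by (cases f; cases g; simp)+

lemma wten_sel:
  "wsrc (f \<diamondop> g) = wsrc f @ wsrc g" "wtgt (f \<diamondop> g) = wtgt f @ wtgt g"
  "wmor (f \<diamondop> g) = merge A (wtgt f) (wtgt g) \<cdot> (wmor f \<boxtimes> wmor g) \<cdot> inv_arr A (merge A (wsrc f) (wsrc g))"
  by (cases f; cases g; simp)+

lemmas wten_sel12 [simp] = wten_sel(1,2)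

lemma wid_sel [simp]:
  "wsrc (wid A xs) = xs" "wtgt (wid A xs) = xs" "wmor (wid A xs) = idn A (wprod A xs)"
  by (simp_all add: wid_def)

lemma wsym_sel [simp]:
  "wsrc (wsym A xs ys) = xs @ ys" "wtgt (wsym A xs ys) = ys @ xs"
  by (simp_all add: wsym_def)

lemma wmor_wsym:
  "wmor (wsym A xs ys) = merge A ys xs \<cdot> sym A (wprod A xs) (wprod A ys) \<cdot> inv_arr A (merge A xs ys)"
  by (simp add: wsym_def)

lemma warr_wid [simp]: "warr (wid A xs) \<longleftrightarrow> wob xs"
  by (auto simp: warr_def)

lemma warr_wcmp [simp]:
  assumes "warr f" "warr g" "wsrc g = wtgt f" shows "warr (g \<star> f)"
  using assms warrD[OF assms(1)] warrD[OF assms(2)] unfolding warr_def[of "g \<star> f"] by simp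

lemma warr_wten [simp]:
  assumes "warr f" "warr g" shows "warr (f \<diamondop> g)"
  using assms warrD[OF assms(1)] warrD[OF assms(2)] unfolding warr_def[of "f \<diamondop> g"]
  by (simp add: wten_sel)

lemma warr_wsym [simp]:
  assumes "wob xs" "wob ys" shows "warr (wsym A xs ys)"
  using assms unfolding warr_def by (simp add: wmor_wsym)

lemma wcmp_assoc:
  assumes "warr f" "warr g" "warr h" "wsrc g = wtgt f" "wsrc h = wtgt g"
  shows "(h \<star> g) \<star> f = h \<star> (g \<star> f)"
  using warrD[OF assms(1)] warrD[OF assms(2)] warrD[OF assms(3)] assms
  by (intro word_mor_eqI) (simp_all add: cmp_arr_assoc)

lemma wcmp_wid [simp]:
  "warr f \<Longrightarrow> xs = wtgt f \<Longrightarrow> wid A xs \<star> f = f"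
  "warr f \<Longrightarrow> xs = wsrc f \<Longrightarrow> f \<star> wid A xs = f"
  using warrD[of f] by (auto intro!: word_mor_eqI)

lemma winterchange:
  assumes "warr f" "warr g" "warr f'" "warr g'" "wsrc g = wtgt f" "wsrc g' = wtgt f'"
  shows "(g \<diamondop> g') \<star> (f \<diamondop> f') = (g \<star> f) \<diamondop> (g' \<star> f')"
proof (rule word_mor_eqI)
  note a = assms warrD[OF assms(1)] warrD[OF assms(2)] warrD[OF assms(3)] warrD[OF assms(4)]
  show "wmor ((g \<diamondop> g') \<star> (f \<diamondop> f')) = wmor ((g \<star> f) \<diamondop> (g' \<star> f'))"
    using a by (simp add: wten_sel cmp_arr_assoc interchange_rest)
qed (simp_all)

lemma wten_wid: "wob xs \<Longrightarrow> wob ys \<Longrightarrow> wid A xs \<diamondop> wid A ys = wid A (xs @ ys)"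
  by (intro word_mor_eqI) (simp_all add: wten_sel tar_idn)

lemma wten_nil_left [simp]:
  assumes "warr f" shows "wid A [] \<diamondop> f = f"
proof (rule word_mor_eqI)
  note a = warrD[OF assms]
  have "lun A (tgt (wmor f)) \<cdot> (idn A \<one>\<^sub>c \<boxtimes> wmor f) \<cdot> inv_arr A (lun A (src (wmor f))) = wmor f"
    using a lun_nat[of "wmor f"] by simp
  then show "wmor (wid A [] \<diamondop> f) = wmor f" using a by (simp add: wten_sel merge_nil_left)
qed simp_all

lemma wten_nil_right [simp]:
  assumes "warr f" shows "f \<diamondop> wid A [] = f"
proof (rule word_mor_eqI)
  note a = warrD[OF assms]
  have "run A (tgt (wmor f)) \<cdot> (wmor f \<boxtimes> idn A \<one>\<^sub>c) \<cdot> inv_arr A (run A (src (wmor f))) = wmor f"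
    using a run_nat[of "wmor f"] by simp
  then show "wmor (f \<diamondop> wid A []) = wmor f" using a by (simp add: wten_sel merge_nil_right)
qed simp_all

lemma merge_assoc_inv:
  assumes [simp]: "wob xs" "wob ys" "wob zs"
  shows "inv_arr A (merge A xs (ys @ zs)) \<cdot> (merge A (xs @ ys) zs)
    = (idn A (wprod A xs) \<boxtimes> merge A ys zs) \<cdot> (asc A (wprod A xs) (wprod A ys) (wprod A zs) \<cdot>
       (inv_arr A (merge A xs ys) \<boxtimes> idn A (wprod A zs)))"
proof (rule iso_left_cancel_iff[of "merge A xs (ys @ zs)"])
  let ?m = "merge A xs ys \<boxtimes> idn A (wprod A zs)"
  have "merge A (xs @ ys) zs = (merge A (xs @ ys) zs \<cdot> ?m) \<cdot> inv_arr A ?m"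
    by (simp del: iso_tar(2))
  also have "\<dots> = merge A xs (ys @ zs) \<cdot> ((idn A (wprod A xs) \<boxtimes> merge A ys zs) \<cdot>
    (asc A (wprod A xs) (wprod A ys) (wprod A zs) \<cdot> (inv_arr A (merge A xs ys) \<boxtimes> idn A (wprod A zs))))"
    by (simp add: merge_assoc cmp_arr_assoc)
  finally show "merge A xs (ys @ zs) \<cdot> (inv_arr A (merge A xs (ys @ zs)) \<cdot> (merge A (xs @ ys) zs))
    = merge A xs (ys @ zs) \<cdot> ((idn A (wprod A xs) \<boxtimes> merge A ys zs) \<cdot>
      (asc A (wprod A xs) (wprod A ys) (wprod A zs) \<cdot> (inv_arr A (merge A xs ys) \<boxtimes> idn A (wprod A zs))))"
    by simp
qed simp_all

text \<open>Strictness, the gain from using words: concatenation of lists is associative on the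
  nose, and the associator hidden between the two sides is absorbed by \<open>merge_assoc\<close> at
  the target and by \<open>merge_assoc_inv\<close> at the source.\<close>

lemma wten_assoc:
  assumes "warr f" "warr g" "warr h"
  shows "(f \<diamondop> g) \<diamondop> h = f \<diamondop> (g \<diamondop> h)"
proof (rule word_mor_eqI)
  note a = warrD[OF assms(1)] warrD[OF assms(2)] warrD[OF assms(3)]
  obtain x f' x' y g' y' z h' z' where e: "f = (x, f', x')" "g = (y, g', y')" "h = (z, h', z')"
    by (metis prod_cases3)
  then have a: "wob x" "wob x'" "wob y" "wob y'" "wob z" "wob z'" "arr f'" "arr g'" "arr h'"
    "src f' = wprod A x" "src g' = wprod A y" "src h' = wprod A z"
    "tgt f' = wprod A x'" "tgt g' = wprod A y'" "tgt h' = wprod A z'"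
    using a by auto
  let ?m = "merge A x y" and ?M = "merge A (x @ y) z" and ?n = "merge A y z" and ?N = "merge A x (y @ z)"
  let ?m' = "merge A x' y'" and ?M' = "merge A (x' @ y') z'" and ?n' = "merge A y' z'" and ?N' = "merge A x' (y' @ z')"
  let ?a = "asc A (wprod A x) (wprod A y) (wprod A z)" and ?a' = "asc A (wprod A x') (wprod A y') (wprod A z')"
  let ?iz = "idn A (wprod A z)" and ?iz' = "idn A (wprod A z')" and ?ix = "idn A (wprod A x)" and ?ix' = "idn A (wprod A x')"
  have "wmor ((f \<diamondop> g) \<diamondop> h) = ?M' \<cdot> (((?m' \<cdot> ((f' \<boxtimes> g') \<cdot> inv_arr A ?m)) \<boxtimes> h') \<cdot> inv_arr A ?M)"
    using a by (simp add: e cmp_arr_assoc)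
  also have "(?m' \<cdot> ((f' \<boxtimes> g') \<cdot> inv_arr A ?m)) \<boxtimes> h' = (?m' \<boxtimes> ?iz') \<cdot> (((f' \<boxtimes> g') \<boxtimes> h') \<cdot> (inv_arr A ?m \<boxtimes> ?iz))"
    using a by (simp add: interchange)
  also have "?M' \<cdot> (\<dots> \<cdot> inv_arr A ?M) = (?M' \<cdot> (?m' \<boxtimes> ?iz')) \<cdot> (((f' \<boxtimes> g') \<boxtimes> h') \<cdot> ((inv_arr A ?m \<boxtimes> ?iz) \<cdot> inv_arr A ?M))"
    using a by (simp add: cmp_arr_assoc)
  also have "\<dots> = (?N' \<cdot> (?ix' \<boxtimes> ?n')) \<cdot> ((?a' \<cdot> ((f' \<boxtimes> g') \<boxtimes> h')) \<cdot> ((inv_arr A ?m \<boxtimes> ?iz) \<cdot> inv_arr A ?M))"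
    using a by (simp add: merge_assoc cmp_arr_assoc)
  also have "?a' \<cdot> ((f' \<boxtimes> g') \<boxtimes> h') = (f' \<boxtimes> (g' \<boxtimes> h')) \<cdot> ?a"
    using a asc_nat[of f' g' h'] by simp
  also have "(?N' \<cdot> (?ix' \<boxtimes> ?n')) \<cdot> (((f' \<boxtimes> (g' \<boxtimes> h')) \<cdot> ?a) \<cdot> ((inv_arr A ?m \<boxtimes> ?iz) \<cdot> inv_arr A ?M))
      = ?N' \<cdot> ((f' \<boxtimes> (?n' \<cdot> ((g' \<boxtimes> h') \<cdot> inv_arr A ?n))) \<cdot> (((?ix \<boxtimes> ?n) \<cdot> (?a \<cdot> (inv_arr A ?m \<boxtimes> ?iz))) \<cdot> inv_arr A ?M))"
    using a by (simp add: cmp_arr_assoc interchange_rest)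
  also have "(?ix \<boxtimes> ?n) \<cdot> (?a \<cdot> (inv_arr A ?m \<boxtimes> ?iz)) = inv_arr A ?N \<cdot> ?M"
    using a by (simp add: merge_assoc_inv)
  also have "?N' \<cdot> ((f' \<boxtimes> (?n' \<cdot> ((g' \<boxtimes> h') \<cdot> inv_arr A ?n))) \<cdot> ((inv_arr A ?N \<cdot> ?M) \<cdot> inv_arr A ?M))
     = wmor (f \<diamondop> (g \<diamondop> h))"
    using a by (simp add: e cmp_arr_assoc)
  finally show "wmor ((f \<diamondop> g) \<diamondop> h) = wmor (f \<diamondop> (g \<diamondop> h))" .
qed simp_all

lemma wsym_nat:
  assumes "warr f" "warr g"
  shows "wsym A (wtgt f) (wtgt g) \<star> (f \<diamondop> g) = (g \<diamondop> f) \<star> wsym A (wsrc f) (wsrc g)"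
proof (rule word_mor_eqI)
  note a = warrD[OF assms(1)] warrD[OF assms(2)]
  let ?s = "sym A (wprod A (wsrc f)) (wprod A (wsrc g))" and ?s' = "sym A (wprod A (wtgt f)) (wprod A (wtgt g))"
  let ?k = "inv_arr A (merge A (wsrc f) (wsrc g))" and ?m = "merge A (wtgt g) (wtgt f)"
  have "wmor (wsym A (wtgt f) (wtgt g) \<star> (f \<diamondop> g)) = ?m \<cdot> ((?s' \<cdot> (wmor f \<boxtimes> wmor g)) \<cdot> ?k)"
    using a by (simp add: wten_sel wmor_wsym cmp_arr_assoc)
  also have "?s' \<cdot> (wmor f \<boxtimes> wmor g) = (wmor g \<boxtimes> wmor f) \<cdot> ?s"
    using a sym_nat[of "wmor f" "wmor g"] by simp
  also have "?m \<cdot> (\<dots> \<cdot> ?k) = wmor ((g \<diamondop> f) \<star> wsym A (wsrc f) (wsrc g))"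
    using a by (simp add: wten_sel wmor_wsym cmp_arr_assoc)
  finally show "wmor (wsym A (wtgt f) (wtgt g) \<star> (f \<diamondop> g)) = wmor ((g \<diamondop> f) \<star> wsym A (wsrc f) (wsrc g))" .
qed simp_all

lemma wsym_wsym [simp]:
  assumes [simp]: "wob xs" "wob ys" shows "wsym A ys xs \<star> wsym A xs ys = wid A (xs @ ys)"
proof (rule word_mor_eqI)
  have "sym A (wprod A ys) (wprod A xs) \<cdot> (sym A (wprod A xs) (wprod A ys) \<cdot> h) = h"
    if "arr h" "tgt h = wprod A xs \<diamond> wprod A ys" for h
    using that sym_sym by (simp flip: cmp_arr_assoc)
  then show "wmor (wsym A ys xs \<star> wsym A xs ys) = wmor (wid A (xs @ ys))"
    by (simp add: wmor_wsym cmp_arr_assoc)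
qed simp_all

text \<open>The hexagon axiom conjugated by \<open>merge\<close>; its associators are absorbed by
  \<open>merge_assoc\<close> and \<open>merge_assoc_inv\<close>.\<close>

lemma wsym_append_right:
  assumes [simp]: "wob xs" "wob ys" "wob zs"
  shows "wsym A xs (ys @ zs) = (wid A ys \<diamondop> wsym A xs zs) \<star> (wsym A xs ys \<diamondop> wid A zs)"
proof (rule word_mor_eqI)
  let ?X = "wprod A xs" and ?Y = "wprod A ys" and ?Z = "wprod A zs"
  let ?iX = "idn A ?X" and ?iY = "idn A ?Y" and ?iZ = "idn A ?Z"
  let ?R = "inv_arr A (merge A xs ys) \<boxtimes> ?iZ" and ?M = "inv_arr A (merge A (xs @ ys) zs)"
  have "wmor ((wid A ys \<diamondop> wsym A xs zs) \<star> (wsym A xs ys \<diamondop> wid A zs))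
    = merge A ys (zs @ xs) \<cdot> ((?iY \<boxtimes> (merge A zs xs \<cdot> (sym A ?X ?Z \<cdot> inv_arr A (merge A xs zs))))
      \<cdot> ((inv_arr A (merge A ys (xs @ zs)) \<cdot> merge A (ys @ xs) zs)
      \<cdot> (((merge A ys xs \<cdot> (sym A ?X ?Y \<cdot> inv_arr A (merge A xs ys))) \<boxtimes> ?iZ) \<cdot> ?M)))"
    by (simp add: wten_sel wmor_wsym cmp_arr_assoc)
  also have "\<dots> = merge A ys (zs @ xs) \<cdot> ((?iY \<boxtimes> merge A zs xs) \<cdot> (((?iY \<boxtimes> sym A ?X ?Z)
      \<cdot> asc A ?Y ?X ?Z \<cdot> (sym A ?X ?Y \<boxtimes> ?iZ)) \<cdot> (?R \<cdot> ?M)))"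
    by (simp add: merge_assoc_inv cmp_arr_assoc interchange_rest)
  also have "\<dots> = merge A ys (zs @ xs) \<cdot> ((?iY \<boxtimes> merge A zs xs) \<cdot> ((asc A ?Y ?Z ?X \<cdot> sym A ?X (?Y \<diamond> ?Z)
      \<cdot> asc A ?X ?Y ?Z) \<cdot> (?R \<cdot> ?M)))"
    by (simp add: hexagon)
  also have "\<dots> = (merge A ys (zs @ xs) \<cdot> ((?iY \<boxtimes> merge A zs xs) \<cdot> asc A ?Y ?Z ?X)) \<cdot> (sym A ?X (?Y \<diamond> ?Z)
      \<cdot> (asc A ?X ?Y ?Z \<cdot> (?R \<cdot> ?M)))"
    by (simp add: cmp_arr_assoc)
  also have "merge A ys (zs @ xs) \<cdot> ((?iY \<boxtimes> merge A zs xs) \<cdot> asc A ?Y ?Z ?X) = merge A (ys @ zs) xs \<cdot> (merge A ys zs \<boxtimes> ?iX)"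
    by (simp add: merge_assoc)
  also have "(merge A (ys @ zs) xs \<cdot> (merge A ys zs \<boxtimes> ?iX)) \<cdot> (sym A ?X (?Y \<diamond> ?Z) \<cdot> (asc A ?X ?Y ?Z \<cdot> (?R \<cdot> ?M)))
    = merge A (ys @ zs) xs \<cdot> (((merge A ys zs \<boxtimes> ?iX) \<cdot> sym A ?X (?Y \<diamond> ?Z)) \<cdot> (asc A ?X ?Y ?Z \<cdot> (?R \<cdot> ?M)))"
    by (simp add: cmp_arr_assoc)
  also have "(merge A ys zs \<boxtimes> ?iX) \<cdot> sym A ?X (?Y \<diamond> ?Z) = sym A ?X (wprod A (ys @ zs)) \<cdot> (?iX \<boxtimes> merge A ys zs)"
    using sym_nat[of ?iX "merge A ys zs"] by simp
  also have "merge A (ys @ zs) xs \<cdot> ((sym A ?X (wprod A (ys @ zs)) \<cdot> (?iX \<boxtimes> merge A ys zs)) \<cdot> (asc A ?X ?Y ?Z \<cdot> (?R \<cdot> ?M)))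
    = merge A (ys @ zs) xs \<cdot> (sym A ?X (wprod A (ys @ zs)) \<cdot> (((?iX \<boxtimes> merge A ys zs) \<cdot> (asc A ?X ?Y ?Z \<cdot> ?R)) \<cdot> ?M))"
    by (simp add: cmp_arr_assoc)
  also have "(?iX \<boxtimes> merge A ys zs) \<cdot> (asc A ?X ?Y ?Z \<cdot> ?R) = inv_arr A (merge A xs (ys @ zs)) \<cdot> (merge A (xs @ ys) zs)"
    by (simp add: merge_assoc_inv)
  also have "merge A (ys @ zs) xs \<cdot> (sym A ?X (wprod A (ys @ zs)) \<cdot> ((inv_arr A (merge A xs (ys @ zs)) \<cdot> (merge A (xs @ ys) zs)) \<cdot> ?M))
    = wmor (wsym A xs (ys @ zs))"
    by (simp add: wmor_wsym cmp_arr_assoc)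
  finally show "wmor (wsym A xs (ys @ zs)) = wmor ((wid A ys \<diamondop> wsym A xs zs) \<star> (wsym A xs ys \<diamondop> wid A zs))"
    by (rule sym)
qed simp_all

text \<open>This is \<open>wsym_append_right\<close> inverted: the symmetry is an involution, so it
  suffices that the right-hand side is a one-sided inverse of
  \<open>wsym A zs (xs @ ys)\<close>.\<close>

lemma wsym_append_left:
  assumes [simp]: "wob xs" "wob ys" "wob zs"
  shows "wsym A (xs @ ys) zs = (wsym A xs zs \<diamondop> wid A ys) \<star> (wid A xs \<diamondop> wsym A ys zs)"
proof -
  let ?g = "(wsym A xs zs \<diamondop> wid A ys) \<star> (wid A xs \<diamondop> wsym A ys zs)"
  let ?h = "(wid A xs \<diamondop> wsym A zs ys) \<star> (wsym A zs xs \<diamondop> wid A ys)"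
  have "?g \<star> ?h = (wsym A xs zs \<diamondop> wid A ys) \<star> (((wid A xs \<diamondop> wsym A ys zs) \<star> (wid A xs \<diamondop> wsym A zs ys)) \<star> (wsym A zs xs \<diamondop> wid A ys))"
    by (simp add: wcmp_assoc)
  also have "\<dots> = wid A (zs @ xs @ ys)" by (simp add: winterchange wten_wid)
  finally have 1: "?g \<star> wsym A zs (xs @ ys) = wid A (zs @ xs @ ys)"
    by (simp add: wsym_append_right)
  have "wsym A (xs @ ys) zs = (?g \<star> wsym A zs (xs @ ys)) \<star> wsym A (xs @ ys) zs"
    by (simp only: 1) simp
  also have "\<dots> = ?g \<star> (wsym A zs (xs @ ys) \<star> wsym A (xs @ ys) zs)"
    by (rule wcmp_assoc) simp_all
  also have "\<dots> = ?g" by simp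
  finally show ?thesis .
qed

text \<open>By the hexagon \<open>wsym xs []\<close> is idempotent, and it is invertible.\<close>

lemma wsym_nil_right [simp]:
  assumes [simp]: "wob xs" shows "wsym A xs [] = wid A xs"
proof -
  let ?s = "wsym A xs []"
  have "?s = ?s \<star> ?s"
    using wsym_append_right[of xs "[]" "[]"] by simp
  then have "?s \<star> wsym A [] xs = (?s \<star> ?s) \<star> wsym A [] xs" by simp
  also have "\<dots> = ?s \<star> (?s \<star> wsym A [] xs)" by (rule wcmp_assoc) simp_all
  finally show ?thesis by simp
qed

lemma wsym_nil_left [simp]:
  assumes [simp]: "wob xs" shows "wsym A [] xs = wid A xs"
proof -
  have "wsym A [] xs = wsym A [] xs \<star> wsym A xs []" by simp
  then show ?thesis using wsym_wsym[of xs "[]"] by simp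
qed

subsection \<open>Padding with identities\<close>

text \<open>Whiskering. Diagrams are brought into the form of a composite of padded generators, in
  which the interchange law takes the shape of \<open>exchange\<close> and rewriting acts on one
  generator at a time.\<close>

definition pad where "pad L f R = wid A L \<diamondop> (f \<diamondop> wid A R)"

lemma pad_sel [simp]:
  "wsrc (pad L f R) = L @ wsrc f @ R" "wtgt (pad L f R) = L @ wtgt f @ R"
  by (simp_all add: pad_def)

lemma warr_pad [simp]: "warr f \<Longrightarrow> wob L \<Longrightarrow> wob R \<Longrightarrow> warr (pad L f R)"
  by (simp add: pad_def)

lemma pad_pad [simp]:
  assumes [simp]: "warr f" "wob L" "wob L'" "wob R" "wob R'"
  shows "pad L (pad L' f R') R = pad (L @ L') f (R' @ R)"
proof -
  have "pad (L @ L') f (R' @ R) = (wid A L \<diamondop> wid A L') \<diamondop> (f \<diamondop> (wid A R' \<diamondop> wid A R))"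
    by (simp add: pad_def wten_wid)
  then show ?thesis by (simp add: pad_def wten_assoc)
qed

lemma pad_cmp:
  "warr f \<Longrightarrow> warr g \<Longrightarrow> wsrc g = wtgt f \<Longrightarrow> wob L \<Longrightarrow> wob R \<Longrightarrow>
    pad L (g \<star> f) R = pad L g R \<star> pad L f R"
  by (simp add: pad_def winterchange)

lemma pad_wid [simp]: "wob L \<Longrightarrow> wob xs \<Longrightarrow> wob R \<Longrightarrow> pad L (wid A xs) R = wid A (L @ xs @ R)"
  by (simp add: pad_def wten_wid)

lemma pad_nil [simp]: "warr f \<Longrightarrow> pad [] f [] = f"
  by (simp add: pad_def)

lemma wten_wid_left: "warr f \<Longrightarrow> wob L \<Longrightarrow> wid A L \<diamondop> f = pad L f []"
  by (simp add: pad_def)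

lemma wten_wid_right: "warr f \<Longrightarrow> wob R \<Longrightarrow> f \<diamondop> wid A R = pad [] f R"
  by (simp add: pad_def)

lemma wten_pad:
  assumes "warr f" "warr g"
  shows "f \<diamondop> g = pad [] f (wtgt g) \<star> pad (wsrc f) g []"
    "f \<diamondop> g = pad (wtgt f) g [] \<star> pad [] f (wsrc g)"
  using assms by (simp_all add: winterchange flip: wten_wid_left wten_wid_right)

text \<open>The word \<open>M\<close> lets the two morphisms act at distant positions; it is
  absorbed into a padded \<open>g\<close>, which reduces the claim to adjacent factors.\<close>

lemma exchange:
  assumes [simp]: "warr f" "warr g" "wob L" "wob M" "wob R"
  shows "pad L f (M @ wtgt g @ R) \<star> pad (L @ wsrc f @ M) g R
    = pad (L @ wtgt f @ M) g R \<star> pad L f (M @ wsrc g @ R)"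
proof -
  have "pad [] f (M @ wtgt g) \<star> pad (wsrc f @ M) g []
    = pad (wtgt f @ M) g [] \<star> pad [] f (M @ wsrc g)"
    using wten_pad[of f "pad M g []"] by simp
  then have "pad L (pad [] f (M @ wtgt g) \<star> pad (wsrc f @ M) g []) R
    = pad L (pad (wtgt f @ M) g [] \<star> pad [] f (M @ wsrc g)) R" by (rule arg_cong)
  then show ?thesis by (simp add: pad_cmp)
qed

text \<open>\<open>wcmp_assoc\<close> brackets composites to the right, so the two sides of a
  rewrite are separated by brackets as soon as a further morphism follows. This variant and
  \<open>wcmp_rest\<close> carry that tail \<open>h\<close> along.\<close>

lemma exchange_rest:
  assumes [simp]: "warr f" "warr g" "wob L" "wob M" "wob R" "warr h" "wtgt h = L @ wsrc f @ M @ wsrc g @ R"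
  shows "pad L f (M @ wtgt g @ R) \<star> (pad (L @ wsrc f @ M) g R \<star> h)
    = pad (L @ wtgt f @ M) g R \<star> (pad L f (M @ wsrc g @ R) \<star> h)"
  using arg_cong[OF exchange[of f g L M R], of "\<lambda>x. x \<star> h"] by (simp add: wcmp_assoc)

lemma wcmp_rest:
  assumes "f \<star> g = k" "warr f" "warr g" "warr h" "wsrc f = wtgt g" "wtgt h = wsrc g"
  shows "f \<star> (g \<star> h) = k \<star> h"
  using assms by (simp add: wcmp_assoc[symmetric])

lemma pad_eq:
  assumes "f \<star> g = k" "warr f" "warr g" "wsrc f = wtgt g" "wob L" "wob R"
  shows "pad L f R \<star> pad L g R = pad L k R"
  using assms by (simp add: pad_cmp[symmetric])

lemma wsym_nat_left:
  "warr f \<Longrightarrow> wob zs \<Longrightarrow>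
    wsym A (wtgt f) zs \<star> pad [] f zs = pad zs f [] \<star> wsym A (wsrc f) zs"
  using wsym_nat[of f "wid A zs"] by (simp add: wten_wid_left wten_wid_right)

lemma wsym_nat_right:
  "warr f \<Longrightarrow> wob zs \<Longrightarrow>
    wsym A zs (wtgt f) \<star> pad zs f [] = pad [] f zs \<star> wsym A zs (wsrc f)"
  using wsym_nat[of "wid A zs" f] by (simp add: wten_wid_left wten_wid_right)

lemma wsym_append_right':
  "wob xs \<Longrightarrow> wob ys \<Longrightarrow> wob zs \<Longrightarrow>
    wsym A xs (ys @ zs) = pad ys (wsym A xs zs) [] \<star> pad [] (wsym A xs ys) zs"
  by (simp add: wsym_append_right wten_wid_left wten_wid_right)

lemma wsym_append_left':
  "wob xs \<Longrightarrow> wob ys \<Longrightarrow> wob zs \<Longrightarrow>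
    wsym A (xs @ ys) zs = pad [] (wsym A xs zs) ys \<star> pad xs (wsym A ys zs) []"
  by (simp add: wsym_append_left wten_wid_left wten_wid_right)

end

subsection \<open>Duality\<close>

context stable_category
begin

lemma dua_ob' [simp]: "X \<in> Ob A \<Longrightarrow> dua A X \<in> Ob A" by (rule dua_ob)

lemma dua_dua' [simp]: "X \<in> Ob A \<Longrightarrow> dua A (dua A X) = X" by (rule dua_dua)

lemma wcoev_sel [simp]: "wsrc (wcoev A b) = []" "wtgt (wcoev A b) = [dua A b, b]" "wmor (wcoev A b) = coev A b"
  by (simp_all add: wcoev_def)

lemma wev_sel [simp]: "wsrc (wev A b) = [b, dua A b]" "wtgt (wev A b) = []" "wmor (wev A b) = ev A b"
  by (simp_all add: wev_def)

lemma arr_coev_ev [simp]: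
  assumes "X \<in> Ob A"
  shows "arr (coev A X)" "src (coev A X) = \<one>\<^sub>c" "tgt (coev A X) = dua A X \<diamond> X"
    "arr (ev A X)" "src (ev A X) = X \<diamond> dua A X" "tgt (ev A X) = \<one>\<^sub>c"
  using hom_arr[OF _ _ coev_closed[OF assms]] hom_arr[OF _ _ ev_closed[OF assms]] assms by auto

lemma warr_wcoev [simp]: "b \<in> Ob A \<Longrightarrow> warr (wcoev A b)"
  by (simp add: warr_def)

lemma warr_wev [simp]: "b \<in> Ob A \<Longrightarrow> warr (wev A b)"
  by (simp add: warr_def)

text \<open>The unit isomorphisms of the axiom are exactly what \<open>merge\<close> supplies for
  the empty word, and its inverse associator is \<open>merge A [c] [dua A c, c]\<close>. In words
  only the snake is left.\<close>

lemma wzigzag: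
  assumes [simp]: "c \<in> Ob A"
  shows "pad [] (wev A c) [c] \<star> pad [c] (wcoev A c) [] = wid A [c]"
proof (rule word_mor_eqI)
  have m: "merge A [c] [dua A c, c] = inv_arr A (asc A c (dua A c) c)"
    using merge_snoc[of "[c]" "[dua A c]" c] by (simp add: merge_single tar_idn)
  show "wmor (pad [] (wev A c) [c] \<star> pad [c] (wcoev A c) []) = wmor (wid A [c])"
    using zigzag[of c] m
    by (simp add: wten_sel merge_nil_left merge_nil_right merge_single cmp_arr_assoc
        flip: wten_wid_left wten_wid_right)
qed simp_all

lemma wzigzag_dual:
  assumes [simp]: "c \<in> Ob A"
  shows "pad [dua A c] (wev A c) [] \<star> pad [] (wcoev A c) [dua A c] = wid A [dua A c]"
proof (rule word_mor_eqI)
  have m: "merge A [dua A c] [c, dua A c] = inv_arr A (asc A (dua A c) c (dua A c))"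
    using merge_snoc[of "[dua A c]" "[c]" "dua A c"] by (simp add: merge_single tar_idn)
  show "wmor (pad [dua A c] (wev A c) [] \<star> pad [] (wcoev A c) [dua A c]) = wmor (wid A [dua A c])"
    using zigzag_dual[of c] m
    by (simp add: wten_sel merge_nil_left merge_nil_right merge_single cmp_arr_assoc
        flip: wten_wid_left wten_wid_right)
qed simp_all

lemma wsym_wcoev:
  assumes [simp]: "c \<in> Ob A"
  shows "wsym A [dua A c] [c] \<star> wcoev A c = wcoev A (dua A c)"
  by (rule word_mor_eqI) (simp_all add: wmor_wsym merge_single sym_coev)

text \<open>A counit is determined by the unit, and \<open>wev c \<star> wsym [c*] [c]\<close> is a counit for
  \<open>wcoev c*\<close>.\<close>

lemma wev_wsym:
  assumes [simp]: "c \<in> Ob A"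
  shows "wev A c \<star> wsym A [dua A c] [c] = wev A (dua A c)"
proof -
  define d where "d = dua A c"
  have [simp]: "d \<in> Ob A" "dua A d = c" "dua A c = d" by (simp_all add: d_def)
  let ?dd = "wsym A [d] [d]" and ?dc = "wsym A [d] [c]"
  let ?e = "wev A c \<star> ?dc"
  have hex: "wsym A [d] [c, d] = pad [c] ?dd [] \<star> pad [] ?dc [d]"
    using wsym_append_right'[of "[d]" "[c]" "[d]"] by simp
  have n1: "pad [d] (wev A c) [] = pad [] (wev A c) [d] \<star> wsym A [d] [c, d]"
    using wsym_nat_right[of "wev A c" "[d]"] by simp
  have n2: "pad [] (wcoev A d) [d] = wsym A [d] [c, d] \<star> pad [d] (wcoev A d) []"
    using wsym_nat_right[of "wcoev A d" "[d]"] by simp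
  \<comment> \<open>Naturality produces the crossing of \<open>d\<close> with itself twice, once
    from the counit and once from the unit; as an involution it cancels.\<close>
  have dd: "pad [c] ?dd [] \<star> pad [c] ?dd [] = wid A [c, d, d]"
    using pad_eq[OF wsym_wsym[of "[d]" "[d]"], of "[c]" "[]"] by simp
  have dc: "pad [] ?dc [d] \<star> pad [] (wcoev A c) [d] = pad [] (wcoev A d) [d]"
    using pad_eq[OF wsym_wcoev[of c], of "[]" "[d]"] by simp
  have "wid A [d] = pad [d] (wev A c) [] \<star> pad [] (wcoev A c) [d]"
    using wzigzag_dual[of c] by simp
  also have "\<dots> = pad [] (wev A c) [d] \<star> (pad [c] ?dd [] \<star> (pad [] ?dc [d] \<star> pad [] (wcoev A c) [d]))"
    by (simp add: n1 hex wcmp_assoc)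
  also have "\<dots> = pad [] (wev A c) [d] \<star> (pad [c] ?dd [] \<star> (pad [c] ?dd [] \<star> (pad [] ?dc [d] \<star> pad [d] (wcoev A d) [])))"
    by (simp add: dc n2 hex wcmp_assoc)
  also have "\<dots> = pad [] ?e [d] \<star> pad [d] (wcoev A d) []"
    by (simp add: wcmp_rest[OF dd] pad_cmp wcmp_assoc)
  finally have 1: "pad [] ?e [d] \<star> pad [d] (wcoev A d) [] = wid A [d]" by simp
  have "?e = ?e \<star> pad [d] (pad [c] (wev A d) [] \<star> pad [] (wcoev A d) [c]) []"
    using wzigzag_dual[of d] by simp
  also have "\<dots> = ?e \<star> (pad [d, c] (wev A d) [] \<star> pad [d] (wcoev A d) [c])"
    by (simp add: pad_cmp)
  also have "\<dots> = wev A d \<star> (pad [] ?e [d, c] \<star> pad [d] (wcoev A d) [c])"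
    using exchange_rest[of ?e "wev A d" "[]" "[]" "[]" "pad [d] (wcoev A d) [c]"] by simp
  also have "\<dots> = wev A d \<star> pad [] (wid A [d]) [c]"
    using pad_eq[OF 1, of "[]" "[c]"] by simp
  finally show ?thesis by simp
qed

text \<open>Moving \<open>c\<close> around the word \<open>M c*\<close> and closing up over the strand created next to \<open>c*\<close>.\<close>

lemma wsym_wcoev_slide:
  assumes [simp]: "c \<in> Ob A" "wob M"
  shows "wsym A (M @ [dua A c]) [c] \<star> pad M (wcoev A c) []
    = pad [c] (wsym A [dua A c] M) [] \<star> pad [] (wcoev A (dua A c)) M"
proof -
  define d where "d = dua A c"
  have [simp]: "d \<in> Ob A" "dua A d = c" "dua A c = d" by (simp_all add: d_def)
  let ?k = "pad [c] (wsym A [d] M) []"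
  have k: "?k \<star> pad [c] (wsym A M [d]) [] = wid A ([c] @ M @ [d])"
    using pad_eq[OF wsym_wsym[of M "[d]"], of "[c]" "[]"] by simp
  have "wsym A (M @ [d]) [c] \<star> pad M (wcoev A c) []
      = pad [] (wsym A M [c]) [d] \<star> (pad M (wsym A [d] [c]) [] \<star> pad M (wcoev A c) [])"
    by (simp add: wsym_append_left' wcmp_assoc)
  also have "\<dots> = pad [] (wsym A M [c]) [d] \<star> pad M (wcoev A d) []"
    using pad_eq[OF wsym_wcoev[of c], of M "[]"] by simp
  also have "\<dots> = ?k \<star> (pad [c] (wsym A M [d]) [] \<star> (pad [] (wsym A M [c]) [d] \<star> pad M (wcoev A d) []))"
    by (simp add: wcmp_rest[OF k])
  also have "\<dots> = ?k \<star> (wsym A M [c, d] \<star> pad M (wcoev A d) [])"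
    using wsym_append_right'[of M "[c]" "[d]"] by (simp add: wcmp_assoc)
  also have "\<dots> = ?k \<star> pad [] (wcoev A d) M"
    using wsym_nat_right[of "wcoev A d" M] by simp
  finally show ?thesis by simp
qed

text \<open>\<open>wsym_wcoev_slide\<close> brings the created pair next to the cap of the closure.
  The crossing with \<open>M\<close> slides off by \<open>exchange\<close>, and a zigzag straightens
  the rest.\<close>

lemma closure_slide:
  assumes [simp]: "c \<in> Ob A" "wob M"
  shows "pad [] (wev A (dua A c)) (M @ [dua A c]) \<star>
      pad [dua A c] (wsym A (M @ [dua A c]) [c] \<star> pad M (wcoev A c) []) []
    = wsym A [dua A c] M"
proof -
  define d where "d = dua A c"
  have [simp]: "d \<in> Ob A" "dua A d = c" "dua A c = d" by (simp_all add: d_def)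
  have "pad [] (wev A d) (M @ [d]) \<star> pad [d] (wsym A (M @ [d]) [c] \<star> pad M (wcoev A c) []) []
      = pad [] (wev A d) (M @ [d]) \<star> (pad [d, c] (wsym A [d] M) [] \<star> pad [d] (wcoev A d) M)"
    using wsym_wcoev_slide[of c M] by (simp add: pad_cmp)
  also have "\<dots> = wsym A [d] M \<star> (pad [] (wev A d) (d # M) \<star> pad [d] (wcoev A d) M)"
    using exchange_rest[of "wev A d" "wsym A [d] M" "[]" "[]" "[]" "pad [d] (wcoev A d) M"] by simp
  also have "\<dots> = wsym A [d] M"
    using pad_eq[OF wzigzag[of d], of "[]" M] by simp
  finally show ?thesis by simp
qed

section \<open>Relators: open morphisms and their closures\<close>

lemma rel_open_word: "\<forall>(i, l)\<in>set R. l \<noteq> 0 \<Longrightarrow> b \<in> Ob A \<Longrightarrow>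
    wob (rel_word A R b) \<and> warr (rel_open A R b) \<and>
    wsrc (rel_open A R b) = b # rel_word A R b \<and> wtgt (rel_open A R b) = rel_word A R b @ [b]"
proof (induction R)
  case Nil
  then show ?case by (simp add: rel_word_def)
next
  case (Cons x R)
  obtain i l where x: "x = (i, l)" by force
  let ?d = "dua A b"
  have l: "l \<noteq> 0" and R: "wob (rel_word A R b)" "warr (rel_open A R b)"
    "wsrc (rel_open A R b) = b # rel_word A R b" "wtgt (rel_open A R b) = rel_word A R b @ [b]"
    using Cons by (auto simp: x)
  have o: "wob (opow A b l)" using Cons.prems by (auto simp: opow_def wob_def)
  have p: "warr (pass_power A b l) \<and> wsrc (pass_power A b l) = b # opow A b l \<and>
    wtgt (pass_power A b l) = opow A b l @ [b]"
  proof (cases "l > 0")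
    case True
    then have "b # opow A b l = opow A b l @ [b]"
      by (simp add: opow_def replicate_append_same)
    then show ?thesis using True o Cons.prems by (simp add: pass_power_def)
  next
    case False
    \<comment> \<open>A negative power is split both at its first and at its last letter:
      \<open>pass_power\<close> contracts the last letter of its source and creates the first letter
      of its target.\<close>
    define W where "W = replicate (nat (- l) - 1) ?d"
    have "nat (- l) = Suc (nat (- l) - 1)" using False l by simp
    moreover have "opow A b l = replicate (nat (- l)) ?d" using False by (simp add: opow_def)
    ultimately have W: "opow A b l = ?d # W" "opow A b l = W @ [?d]"
      unfolding W_def by (metis replicate_Suc, metis replicate_Suc replicate_append_same)
    have wW: "wob W" using Cons.prems by (auto simp: W_def wob_def)
    have pp: "pass_power A b l = (wid A [?d] \<diamondop> wsym A [b] W) \<star> (wcoev A b \<diamondop> wid A W) \<star>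
        (wid A W \<diamondop> wev A b) \<star> (wsym A [b] W \<diamondop> wid A [?d])"
      using False by (simp add: pass_power_def W_def Let_def)
    have "warr (pass_power A b l) \<and> wsrc (pass_power A b l) = b # W @ [?d] \<and>
      wtgt (pass_power A b l) = ?d # W @ [b]"
      unfolding pp using wW Cons.prems by simp
    then show ?thesis using W by simp
  qed
  have "rel_word A (x # R) b = opow A b l @ rel_word A R b" by (simp add: x rel_word_def)
  then show ?case using p o R Cons.prems by (simp add: x)
qed

text \<open>\<open>[R, b]\<close> without the factor \<open>r(b)\<close>.\<close>

definition rel_closure where
  "rel_closure R b =
     (wev A (dua A b) \<diamondop> wid A (rel_word A R b)) \<star>
      (wid A [dua A b] \<diamondop> (wsym A (rel_word A R b) [b] \<star> rel_open A R b)) \<star>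
      (wcoev A b \<diamondop> wid A (rel_word A R b))"

lemma rel_mor_closure: "rel_mor A R b = wscl A (rank A b) (rel_closure R b)"
  by (simp add: rel_mor_def rel_closure_def)

lemma rel_closure_pad:
  assumes R: "\<forall>(i, l)\<in>set R. l \<noteq> 0" and b [simp]: "b \<in> Ob A"
  shows "rel_closure R b = pad [] (wev A (dua A b)) (rel_word A R b) \<star>
    (pad [dua A b] (wsym A (rel_word A R b) [b] \<star> rel_open A R b) [] \<star>
     pad [] (wcoev A b) (rel_word A R b))"
  using rel_open_word[OF R b]
  by (simp add: rel_closure_def wten_wid_left wten_wid_right wcmp_assoc)

lemma rel_closure_word [simp]:
  assumes "\<forall>(i, l)\<in>set R. l \<noteq> 0" "b \<in> Ob A"
  shows "warr (rel_closure R b)" "wsrc (rel_closure R b) = rel_word A R b"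
    "wtgt (rel_closure R b) = rel_word A R b"
  using rel_open_word[OF assms] assms(2) by (simp_all add: rel_closure_pad[OF assms])

text \<open>For exponent 1 the open relator is an identity, so the closure is a single self-crossing
  of \<open>c\<close>, a curl. Rewriting its cap as a cap after a crossing (\<open>wev_wsym\<close>)
  lets naturality pull the cup across, and a zigzag remains.\<close>

lemma rel_closure_generator:
  assumes [simp]: "c \<in> Ob A"
  shows "rel_closure [(k, 1)] c = wid A [c]"
proof -
  define d where "d = dua A c"
  have [simp]: "d \<in> Ob A" "dua A d = c" "dua A c = d" by (simp_all add: d_def)
  have w: "rel_word A [(k, 1)] c = [c]" by (simp add: rel_word_def opow_def)
  have o: "rel_open A [(k, 1)] c = wid A [c, c]"
    using w by (simp add: opow_def pass_power_def rel_word_def wten_wid)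
  have e: "pad [] (wev A d) [c] = pad [] (wev A c) [c] \<star> pad [] (wsym A [d] [c]) [c]"
    using wev_wsym[of c] by (simp add: pad_cmp[symmetric])
  have "rel_closure [(k, 1)] c = pad [] (wev A d) [c] \<star> (pad [d] (wsym A [c] [c]) [] \<star> pad [] (wcoev A c) [c])"
    by (simp add: rel_closure_pad w o del: rel_open.simps)
  also have "\<dots> = pad [] (wev A c) [c] \<star> (wsym A [d, c] [c] \<star> pad [] (wcoev A c) [c])"
    using wsym_append_left'[of "[d]" "[c]" "[c]"] by (simp add: e wcmp_assoc)
  also have "\<dots> = pad [] (wev A c) [c] \<star> pad [c] (wcoev A c) []"
    using wsym_nat_left[of "wcoev A c" "[c]"] by simp
  finally show ?thesis by (simp add: wzigzag)
qed

text \<open>The two ways of moving \<open>d\<close> past the pair \<open>c\<close>, \<open>d\<close>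
  share the crossing of \<open>d\<close> with itself. Trading one hexagon for the other lets
  naturality pull the cap over the strand \<open>d\<close>.\<close>

lemma wsym_wev_slide:
  assumes [simp]: "c \<in> Ob A"
  shows "pad [dua A c] (wev A c) [] \<star> (pad [] (wsym A [c] [dua A c]) [dua A c] \<star>
      wsym A [dua A c] [c, dua A c]) = pad [] (wev A (dua A c)) [dua A c]"
proof -
  define d where "d = dua A c"
  have [simp]: "d \<in> Ob A" "dua A d = c" "dua A c = d" by (simp_all add: d_def)
  have hex: "wsym A [d] [c, d] = pad [c] (wsym A [d] [d]) [] \<star> pad [] (wsym A [d] [c]) [d]"
    using wsym_append_right'[of "[d]" "[c]" "[d]"] by simp
  have hex': "wsym A [c, d] [d] = pad [] (wsym A [c] [d]) [d] \<star> pad [c] (wsym A [d] [d]) []"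
    using wsym_append_left'[of "[c]" "[d]" "[d]"] by simp
  have "pad [d] (wev A c) [] \<star> (pad [] (wsym A [c] [d]) [d] \<star> wsym A [d] [c, d])
     = (pad [d] (wev A c) [] \<star> wsym A [c, d] [d]) \<star> pad [] (wsym A [d] [c]) [d]"
    by (simp add: hex hex' wcmp_assoc)
  also have "pad [d] (wev A c) [] \<star> wsym A [c, d] [d] = pad [] (wev A c) [d]"
    using wsym_nat_left[of "wev A c" "[d]"] by simp
  also have "pad [] (wev A c) [d] \<star> pad [] (wsym A [d] [c]) [d] = pad [] (wev A d) [d]"
    using pad_eq[OF wev_wsym[of c], of "[]" "[d]"] by simp
  finally show ?thesis by simp
qed

text \<open>Tracing out the second generator in \<open>[x y x\<^sup>-\<^sup>1 y\<^sup>-\<^sup>1, c]\<close>; the middle symmetry groups the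
  letters of \<open>x\<close> and of \<open>y\<close>.\<close>

lemma rel_closure_commutator:
  assumes c [simp]: "c \<in> Ob A" and d: "d = dua A c"
  shows "pad [c, d] (wev A c) [] \<star> (pad [c] (wsym A [c] [d]) [d] \<star>
      (rel_closure [(i, 1), (j, 1), (i, - 1), (j, - 1)] c \<star>
      (pad [c] (wsym A [d] [c]) [d] \<star> pad [c, d] (wcoev A d) []))) = wid A [c, d]"
proof -
  have [simp]: "d \<in> Ob A" "dua A d = c" "dua A c = d" by (simp_all add: d)
  let ?R = "[(i, 1), (j, 1), (i, - 1), (j, - 1)] :: relator"
  let ?p = "wcoev A c \<star> wev A c"
  have R: "\<forall>(i, l)\<in>set ?R. l \<noteq> 0" by simp
  have w: "rel_word A ?R c = [c, c, d, d]" by (simp add: rel_word_def opow_def)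
  define Op where "Op = rel_open A ?R c"
  \<comment> \<open>For exponent \<open>- 1\<close> the kept word \<open>W\<close> is empty, so the
    symmetries in \<open>pass_power\<close> are identities and a cup after a cap is left.\<close>
  have p: "pass_power A c (- 1) = ?p" "pass_power A c 1 = wid A [c, c]"
    by (simp_all add: pass_power_def opow_def wten_wid wcmp_assoc)
  have o: "Op = pad [c, c, d] ?p [] \<star> pad [c, c] ?p [d]"
    by (simp add: Op_def p opow_def rel_word_def wten_wid wten_wid_left wten_wid_right
        pad_cmp wcmp_assoc)
  let ?s = "pad [c] (wsym A [d] [c]) [d]" and ?t = "pad [c] (wsym A [c] [d]) [d]"
  let ?b = "?s \<star> pad [c, d] (wcoev A d) []"
  \<comment> \<open>\<open>?b\<close> inserts the two letters of y, joined by a strand, between and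
    after those of x. The incoming \<open>c\<close> is then straightened out by two zigzags, and the
    open relator merely creates a pair at the right end.\<close>
  have 1: "Op \<star> pad [c] ?b [] = pad [c, c, d] (wcoev A c) []"
  proof -
    have e: "pad [c, c] (wev A c) [d] \<star> pad [c, c] (wsym A [d] [c]) [d] = pad [c, c] (wev A d) [d]"
      using pad_eq[OF wev_wsym[of c], of "[c, c]" "[d]"] by simp
    have z: "pad [c, c] (wev A d) [d] \<star> pad [c, c, d] (wcoev A d) [] = wid A [c, c, d]"
      using pad_eq[OF wzigzag[of d], of "[c, c]" "[]"] by simp
    have z': "pad [c, c, d] (wev A c) [] \<star> pad [c, c] (wcoev A c) [d] = wid A [c, c, d]"
      using pad_eq[OF wzigzag_dual[of c], of "[c, c]" "[]"] by simp
    show ?thesis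
      unfolding o by (simp add: pad_cmp wcmp_assoc wcmp_rest[OF e] wcmp_rest[OF z'] z z')
  qed
  \<comment> \<open>The cup that starts the closure acts to the left of \<open>?b\<close>, so
    \<open>?b\<close> can be brought directly under the open relator.\<close>
  have x: "pad [] (wcoev A c) [c, c, d, d] \<star> ?b = pad [d, c] ?b [] \<star> pad [] (wcoev A c) [c, d]"
    using exchange[of "wcoev A c" ?b "[]" "[]" "[]"] by simp
  have a: "warr (Op)" "wsrc (Op) = [c, c, c, d, d]" "wtgt (Op) = [c, c, d, d, c]"
    using rel_open_word[OF R c] w unfolding Op_def by auto
  have "rel_closure ?R c \<star> ?b = pad [] (wev A d) [c, c, d, d] \<star>
      (pad [d] (wsym A [c, c, d, d] [c]) [] \<star> ((pad [d] (Op) [] \<star>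
       (pad [d, c] ?b [] \<star> pad [] (wcoev A c) [c, d]))))"
    using a unfolding rel_closure_pad[OF R c, folded Op_def] w x[symmetric]
    by (simp add: pad_cmp wcmp_assoc)
  also have "pad [d] (Op) [] \<star> (pad [d, c] ?b [] \<star> pad [] (wcoev A c) [c, d])
      = pad [d, c, c, d] (wcoev A c) [] \<star> pad [] (wcoev A c) [c, d]"
    using wcmp_rest[OF pad_eq[OF 1, of "[d]" "[]"], of "pad [] (wcoev A c) [c, d]"] a
    by simp
  also have "pad [] (wev A d) [c, c, d, d] \<star> (pad [d] (wsym A [c, c, d, d] [c]) [] \<star>
      (pad [d, c, c, d] (wcoev A c) [] \<star> pad [] (wcoev A c) [c, d]))
    = wsym A [d] [c, c, d] \<star> pad [] (wcoev A c) [c, d]"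
    using arg_cong[OF closure_slide[of c "[c, c, d]"], of "\<lambda>x. x \<star> pad [] (wcoev A c) [c, d]"]
    by (simp add: pad_cmp wcmp_assoc)
  also have "\<dots> = pad [c] (wsym A [d] [c, d]) [] \<star> (pad [] (wsym A [d] [c]) [c, d] \<star> pad [] (wcoev A c) [c, d])"
    using wsym_append_right'[of "[d]" "[c]" "[c, d]"] by (simp add: wcmp_assoc)
  also have "\<dots> = pad [c] (wsym A [d] [c, d]) [] \<star> pad [] (wcoev A d) [c, d]"
    using pad_eq[OF wsym_wcoev[of c], of "[]" "[c, d]"] by simp
  finally have 2: "rel_closure ?R c \<star> ?b = pad [c] (wsym A [d] [c, d]) [] \<star> pad [] (wcoev A d) [c, d]" .
  \<comment> \<open>The cap that closes the strand of y absorbs the remaining crossings; together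
    with the cup of the closure it forms a snake in the first letter.\<close>
  have "pad [c] (pad [d] (wev A c) [] \<star> (pad [] (wsym A [c] [d]) [d] \<star> wsym A [d] [c, d])) []
      = pad [c] (wev A d) [d]"
    using wsym_wev_slide[of c] by simp
  then have 3: "pad [c, d] (wev A c) [] \<star> (?t \<star> pad [c] (wsym A [d] [c, d]) []) = pad [c] (wev A d) [d]"
    by (simp add: pad_cmp)
  have "pad [c, d] (wev A c) [] \<star> (?t \<star> (rel_closure ?R c \<star> ?b))
      = (pad [c, d] (wev A c) [] \<star> (?t \<star> pad [c] (wsym A [d] [c, d]) [])) \<star> pad [] (wcoev A d) [c, d]"
    by (simp add: 2 wcmp_assoc)
  also have "\<dots> = pad [c] (wev A d) [d] \<star> pad [] (wcoev A d) [c, d]" by (simp only: 3)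
  also have "\<dots> = wid A [c, d]"
    using pad_eq[OF wzigzag_dual[of d], of "[]" "[d]"] by simp
  finally show ?thesis .
qed

end

subsection \<open>Grouping of blocks\<close>

context symmetric_monoidal_category
begin

definition wiso where "wiso f \<longleftrightarrow> warr f \<and> iso (wmor f)"

lemma winv_sel [simp]: "wsrc (winv A f) = wtgt f" "wtgt (winv A f) = wsrc f" "wmor (winv A f) = inv_arr A (wmor f)"
  by (cases f; simp)+

lemma wiso_warr: "wiso f \<Longrightarrow> warr f"
  by (simp add: wiso_def)

lemma wiso_winv [simp]:
  assumes "wiso f"
  shows "wiso (winv A f)" "warr (winv A f)" "winv A f \<star> f = wid A (wsrc f)" "f \<star> winv A f = wid A (wtgt f)"
  using assms unfolding wiso_def warr_def by (auto intro!: word_mor_eqI)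

lemma wisoI:
  assumes "warr f" "warr g" "wsrc g = wtgt f" "wtgt g = wsrc f"
    "g \<star> f = wid A (wsrc f)" "f \<star> g = wid A (wtgt f)"
  shows "wiso f" "winv A f = g"
proof -
  have e: "wmor g \<cdot> wmor f = idn A (src (wmor f))" "wmor f \<cdot> wmor g = idn A (tgt (wmor f))"
    using arg_cong[OF assms(5), of "\<lambda>x. wmor x"] arg_cong[OF assms(6), of "\<lambda>x. wmor x"]
      warrD[OF assms(1)] by auto
  have "inv_arr A (wmor f) = wmor g \<and> iso (wmor f)"
    using inv_arr_eqI[of "wmor f" "wmor g"] e assms(3,4) warrD[OF assms(1)] warrD[OF assms(2)] by simp
  then show "wiso f" "winv A f = g"
    using assms by (auto simp: wiso_def intro!: word_mor_eqI)
qed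

lemma wiso_wid [simp]: "wob xs \<Longrightarrow> wiso (wid A xs)" "wob xs \<Longrightarrow> winv A (wid A xs) = wid A xs"
  by - (rule wisoI[of _ "wid A xs"]; simp)+

lemma wiso_wsym [simp]:
  "wob xs \<Longrightarrow> wob ys \<Longrightarrow> wiso (wsym A xs ys)"
  "wob xs \<Longrightarrow> wob ys \<Longrightarrow> winv A (wsym A xs ys) = wsym A ys xs"
  by - (rule wisoI[of _ "wsym A ys xs"]; simp)+

lemma wiso_wcmp [simp]:
  assumes "wiso f" "wiso g" and c: "wsrc g = wtgt f"
  shows "wiso (g \<star> f)" "winv A (g \<star> f) = winv A f \<star> winv A g"
proof -
  have [simp]: "warr f" "warr g" "warr (winv A f)" "warr (winv A g)"
    using assms wiso_winv(2) wiso_warr by auto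
  have r: "winv A g \<star> (g \<star> f) = f" "f \<star> (winv A f \<star> winv A g) = winv A g"
    using wcmp_rest[OF wiso_winv(3)[OF assms(2)], of f] wcmp_rest[OF wiso_winv(4)[OF assms(1)], of "winv A g"]
    by (simp_all add: c)
  have 1: "(winv A f \<star> winv A g) \<star> (g \<star> f) = wid A (wsrc (g \<star> f))"
    using wiso_winv(3)[OF assms(1)] by (simp add: wcmp_assoc c r)
  have 2: "(g \<star> f) \<star> (winv A f \<star> winv A g) = wid A (wtgt (g \<star> f))"
    using wiso_winv(4)[OF assms(2)] by (simp add: wcmp_assoc c r)
  show "wiso (g \<star> f)" "winv A (g \<star> f) = winv A f \<star> winv A g"
    by - (rule wisoI[OF _ _ _ _ 1 2]; simp add: c)+
qed

lemma wiso_pad [simp]: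
  assumes "wiso f" "wob L" "wob R"
  shows "wiso (pad L f R)" "winv A (pad L f R) = pad L (winv A f) R"
proof -
  note [simp] = assms wiso_warr[OF assms(1)]
  have 1: "pad L (winv A f) R \<star> pad L f R = wid A (wsrc (pad L f R))"
    using pad_eq[OF wiso_winv(3)[OF assms(1)], of L R] by simp
  have 2: "pad L f R \<star> pad L (winv A f) R = wid A (wtgt (pad L f R))"
    using pad_eq[OF wiso_winv(4)[OF assms(1)], of L R] by simp
  show "wiso (pad L f R)" "winv A (pad L f R) = pad L (winv A f) R"
    by - (rule wisoI[OF _ _ _ _ 1 2]; simp)+
qed

definition block_word where "block_word B = concat (map snd B)"

definition other_word :: "nat \<Rightarrow> _" where
  "other_word k B = block_word (filter (\<lambda>(i, w). i \<noteq> k) B)"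

definition group_words :: "nat list \<Rightarrow> _" where
  "group_words ks B = concat (map (\<lambda>k. group_word k B) ks)"

text \<open>Letters whose labels are not listed in \<open>ks\<close> stay at the end. For the full
  list of generators this word is empty, but the induction over \<open>ks\<close> passes through
  partial lists.\<close>

definition rest_word :: "nat list \<Rightarrow> _" where
  "rest_word ks B = block_word (filter (\<lambda>(i, w). i \<notin> set ks) B)"

lemma block_word_simps [simp]:
  "block_word [] = []" "block_word ((i, w) # B) = w @ block_word B"
  "block_word (B @ C) = block_word B @ block_word C"
  by (simp_all add: block_word_def)

lemma other_word_simps [simp]:
  "other_word k [] = []" "other_word k ((i, w) # B) = (if i = k then [] else w) @ other_word k B"
  "other_word k (B @ C) = other_word k B @ other_word k C"
  by (simp_all add: other_word_def)

lemma group_word_simps [simp]: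
  "group_word k [] = []" "group_word k ((i, w) # B) = (if i = k then w else []) @ group_word k B"
  "group_word k (B @ C) = group_word k B @ group_word k C"
  by (simp_all add: group_word_def)

lemma group_word_filter [simp]:
  "group_word k (filter (\<lambda>(i, w). i \<noteq> j) B) = (if k = j then [] else group_word k B)"
  by (induction B) auto

lemma group_words_simps [simp]:
  "group_words [] B = []" "group_words (k # ks) B = group_word k B @ group_words ks B"
  "group_words (ks @ ls) B = group_words ks B @ group_words ls B"
  by (simp_all add: group_words_def)

lemma group_words_filter [simp]:
  "j \<notin> set ks \<Longrightarrow> group_words ks (filter (\<lambda>(i, w). i \<noteq> j) B) = group_words ks B"
  by (induction ks) auto

lemma rest_word_filter:
  "rest_word ks (filter (\<lambda>(i, w). i \<noteq> k) B) = rest_word (k # ks) B"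
proof -
  have "(\<lambda>x. (case x of (i, w) \<Rightarrow> i \<notin> set ks) \<and> (case x of (i, w) \<Rightarrow> i \<noteq> k))
      = (\<lambda>(i, w). i \<notin> set (k # ks))" by auto
  then show ?thesis by (simp add: rest_word_def case_prod_unfold conj_commute)
qed

definition bob where "bob B \<longleftrightarrow> (\<forall>x\<in>set B. wob (snd x))"

lemma bob_simps [simp]:
  "bob []" "bob ((i, w) # B) \<longleftrightarrow> wob w \<and> bob B" "bob (B @ C) \<longleftrightarrow> bob B \<and> bob C"
  "bob B \<Longrightarrow> bob (filter P B)"
  by (auto simp: bob_def)

lemma bob_block_word [simp]: "bob B \<Longrightarrow> wob (block_word B)"
  by (induction B) auto

lemma bob_words [simp]:
  assumes "bob B"
  shows "wob (other_word k B)" "wob (group_word k B)" "wob (rest_word ks B)" "wob (group_words ks B)"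
proof -
  show g: "wob (group_word k B)" for k
    using assms by (induction B) auto
  show "wob (other_word k B)" "wob (rest_word ks B)"
    using assms by (simp_all add: other_word_def rest_word_def)
  show "wob (group_words ks B)" using g by (induction ks) auto
qed

lemma pull_front_Cons:
  "pull_front A k ((i, w) # B) = (if i = k then wid A w \<diamondop> pull_front A k B
      else (wsym A w (group_word k B) \<diamondop> wid A (other_word k B)) \<star> (wid A w \<diamondop> pull_front A k B))"
  by (simp add: other_word_def block_word_def)

declare pull_front.simps(2) [simp del]

lemma pull_front_word [simp]:
  assumes "bob B"
  shows "wiso (pull_front A k B)" "warr (pull_front A k B)" "wsrc (pull_front A k B) = block_word B"
    "wtgt (pull_front A k B) = group_word k B @ other_word k B"
proof -
  have "wiso (pull_front A k B) \<and> wsrc (pull_front A k B) = block_word B \<and>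
    wtgt (pull_front A k B) = group_word k B @ other_word k B"
    using assms
  proof (induction B)
    case (Cons x B)
    then show ?case
      by (cases x) (auto simp: pull_front_Cons wten_wid_left wten_wid_right wiso_warr)
  qed simp
  then show "wiso (pull_front A k B)" "warr (pull_front A k B)" "wsrc (pull_front A k B) = block_word B"
    "wtgt (pull_front A k B) = group_word k B @ other_word k B"
    by (auto simp: wiso_warr)
qed

lemma pull_front_snoc_other:
  assumes "i \<noteq> k" "wob w" "bob B"
  shows "pull_front A k (B @ [(i, w)]) = pad [] (pull_front A k B) w"
  using \<open>bob B\<close>
proof (induction B)
  case Nil
  then show ?case using assms by (simp add: pull_front_Cons wten_wid)
next
  case (Cons x B)
  then show ?case using assms
    by (cases x) (auto simp: pull_front_Cons wten_wid_left wten_wid_right pad_cmp)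
qed

text \<open>The recursion of \<open>pull_front\<close> strips the first block, whereas a new relator
  is appended at the end. Seen from the end, a block labelled \<open>k\<close> travels left past
  exactly the letters of other labels; a front block \<open>v\<close> of another label crosses it as
  part of the group, and \<open>exchange\<close> reorders these crossings.\<close>

lemma pull_front_snoc_same:
  assumes w [simp]: "wob w" and "bob B"
  shows "pull_front A k (B @ [(k, w)])
    = pad (group_word k B) (wsym A (other_word k B) w) [] \<star> pad [] (pull_front A k B) w"
  using \<open>bob B\<close>
proof (induction B)
  case Nil
  then show ?case using assms by (simp add: pull_front_Cons wten_wid)
next
  case (Cons x B)
  obtain i v where x: "x = (i, v)" by force
  then have [simp]: "wob v" "bob B" using Cons.prems by auto
  let ?g = "group_word k B" and ?o = "other_word k B" and ?p = "pull_front A k B"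
  show ?case
  proof (cases "i = k")
    case True
    then show ?thesis using Cons.IH
      by (simp add: x pull_front_Cons wten_wid_left pad_cmp)
  next
    case False
    have "pull_front A k ((x # B) @ [(k, w)]) = pad [] (wsym A v (?g @ w)) ?o \<star>
        pad v (pad ?g (wsym A ?o w) [] \<star> pad [] ?p w) []"
      using False Cons.IH by (simp add: x pull_front_Cons wten_wid_left wten_wid_right)
    also have "\<dots> = pad ?g (wsym A v w) ?o \<star> (pad [] (wsym A v ?g) (w @ ?o) \<star>
        (pad (v @ ?g) (wsym A ?o w) [] \<star> pad v ?p w))"
      by (simp add: wsym_append_right' pad_cmp wcmp_assoc)
    also have "\<dots> = pad ?g (wsym A v w) ?o \<star> (pad (?g @ v) (wsym A ?o w) [] \<star>
        (pad [] (wsym A v ?g) (?o @ w) \<star> pad v ?p w))"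
      using exchange_rest[of "wsym A v ?g" "wsym A ?o w" "[]" "[]" "[]" "pad v ?p w"] by simp
    also have "\<dots> = pad (group_word k (x # B)) (wsym A (other_word k (x # B)) w) [] \<star>
        pad [] (pull_front A k (x # B)) w"
      using False by (simp add: x pull_front_Cons wten_wid_left wten_wid_right
          wsym_append_left' pad_cmp wcmp_assoc)
    finally show ?thesis .
  qed
qed

lemma grouping_Nil: "grouping A [] B = wid A (block_word B)"
  by (simp add: block_word_def)

declare grouping.simps(1) [simp del]

lemma grouping_word [simp]:
  assumes "bob B" "distinct ks"
  shows "wiso (grouping A ks B)" "warr (grouping A ks B)" "wsrc (grouping A ks B) = block_word B"
    "wtgt (grouping A ks B) = group_words ks B @ rest_word ks B"
proof -
  have "wiso (grouping A ks B) \<and> wsrc (grouping A ks B) = block_word B \<and>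
    wtgt (grouping A ks B) = group_words ks B @ rest_word ks B"
    using assms
  proof (induction ks arbitrary: B)
    case Nil
    then show ?case by (simp add: grouping_Nil rest_word_def case_prod_unfold)
  next
    case (Cons k ks)
    let ?B = "filter (\<lambda>(i, w). i \<noteq> k) B"
    have "block_word ?B = other_word k B" by (simp add: other_word_def)
    then show ?case using Cons.IH[of ?B] Cons.prems
      by (simp add: wten_wid_left wiso_warr rest_word_filter)
  qed
  then show "wiso (grouping A ks B)" "warr (grouping A ks B)" "wsrc (grouping A ks B) = block_word B"
    "wtgt (grouping A ks B) = group_words ks B @ rest_word ks B"
    by (auto simp: wiso_warr)
qed

text \<open>The old blocks can be grouped before the new block \<open>w\<close> moves: by naturality
  \<open>w\<close> crosses the finished groups of the later labels instead of the scattered blocks.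
  This separates the old permutation from the effect of the new relator.\<close>

lemma grouping_snoc:
  assumes "bob B" and w [simp]: "wob w" and "distinct (ks @ k # ls)"
  shows "grouping A (ks @ k # ls) (B @ [(k, w)])
    = pad (group_words (ks @ [k]) B) (wsym A (group_words ls B @ rest_word (ks @ k # ls) B) w) []
        \<star> pad [] (grouping A (ks @ k # ls) B) w"
  using assms(1,3)
proof (induction ks arbitrary: B)
  case Nil
  let ?B = "filter (\<lambda>(i, w). i \<noteq> k) B"
  have [simp]: "bob B" "distinct ls" "k \<notin> set ls" "bob ?B" using Nil by auto
  have [simp]: "block_word ?B = other_word k B" by (simp add: other_word_def)
  let ?g = "group_word k B" and ?q = "grouping A ls ?B"
  have t: "wtgt ?q = group_words ls B @ rest_word (k # ls) B" by (simp add: rest_word_filter)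
  have "grouping A (k # ls) (B @ [(k, w)]) = pad (?g @ w) ?q [] \<star>
      (pad ?g (wsym A (other_word k B) w) [] \<star> pad [] (pull_front A k B) w)"
    by (simp add: wten_wid_left pull_front_snoc_same)
  also have "\<dots> = pad ?g (pad w ?q [] \<star> wsym A (other_word k B) w) [] \<star> pad [] (pull_front A k B) w"
    by (simp add: pad_cmp wcmp_assoc)
  also have "\<dots> = pad ?g (wsym A (wtgt ?q) w \<star> pad [] ?q w) [] \<star> pad [] (pull_front A k B) w"
    using wsym_nat_left[of ?q w] by simp
  also have "\<dots> = pad ?g (wsym A (wtgt ?q) w) [] \<star> pad [] (grouping A (k # ls) B) w"
    by (simp add: pad_cmp wcmp_assoc wten_wid_left)
  finally show ?case by (simp add: rest_word_filter)
next
  case (Cons j ks)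
  let ?B = "filter (\<lambda>(i, w). i \<noteq> j) B"
  have [simp]: "bob B" "bob ?B" "j \<noteq> k" "k \<noteq> j" "j \<notin> set ks" "j \<notin> set ls"
    "distinct ks" "distinct ls" "k \<notin> set ks" "k \<notin> set ls" "set ks \<inter> set ls = {}"
    using Cons.prems by auto
  have d: "distinct (ks @ k # ls)" by simp
  have [simp]: "block_word ?B = other_word j B" by (simp add: other_word_def)
  have f: "filter (\<lambda>(i, w). i \<noteq> j) (B @ [(k, w)]) = ?B @ [(k, w)]" by simp
  show ?case
    using Cons.IH[OF \<open>bob ?B\<close> d] pull_front_snoc_other[of k j w B]
    by (simp add: f wten_wid_left rest_word_filter pad_cmp wcmp_assoc del: filter_append)
qed

lemma absent_words:
  assumes "k \<notin> fst ` set B"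
  shows "filter (\<lambda>(i, w). i \<noteq> k) B = B" "other_word k B = block_word B" "group_word k B = []"
proof -
  show 1: "filter (\<lambda>(i, w). i \<noteq> k) B = B" using assms by (force intro: filter_True)
  show "other_word k B = block_word B" unfolding other_word_def 1 ..
  show "group_word k B = []" using assms by (induction B) auto
qed

lemma pull_front_absent:
  assumes "bob B" "k \<notin> fst ` set B"
  shows "pull_front A k B = wid A (block_word B)"
  using assms
proof (induction B)
  case (Cons x B)
  then show ?case using absent_words[of k B] by (cases x) (auto simp: pull_front_Cons wten_wid)
qed simp

text \<open>For P' the list of labels is longer by that of y, which no old relator mentions; on the
  old blocks the permutation is unchanged.\<close>

lemma grouping_absent:
  assumes "bob B" "k \<notin> fst ` set B" "distinct ks"
  shows "grouping A (ks @ [k]) B = grouping A ks B"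
  using assms
proof (induction ks arbitrary: B)
  case Nil
  then show ?case by (simp add: absent_words grouping_Nil pull_front_absent)
next
  case (Cons j ks)
  have "k \<notin> fst ` set (filter (\<lambda>(i, w). i \<noteq> j) B)" using Cons.prems by auto
  then show ?case using Cons by simp
qed

end

subsection \<open>Linear algebra of hom-spaces\<close>

context linear_category
begin

lemma hsum_simps [simp]: "hsum A X Y [] = zer A X Y" "hsum A X Y (f # fs) = f \<oplus>\<^sub>h hsum A X Y fs"
  by (simp_all add: hsum_def)

lemma hsum_closed:
  "X \<in> Ob A \<Longrightarrow> Y \<in> Ob A \<Longrightarrow> set fs \<subseteq> Hm A X Y \<Longrightarrow> hsum A X Y fs \<in> Hm A X Y"
  by (induction fs) (auto intro: zer_closed plu_closed)

lemma zer_plu: "X \<in> Ob A \<Longrightarrow> Y \<in> Ob A \<Longrightarrow> f \<in> Hm A X Y \<Longrightarrow> zer A X Y \<oplus>\<^sub>h f = f"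
  using plu_comm plu_zer zer_closed by metis

lemma scl_zero: "X \<in> Ob A \<Longrightarrow> Y \<in> Ob A \<Longrightarrow> f \<in> Hm A X Y \<Longrightarrow> 0 \<odot>\<^sub>h f = zer A X Y"
  using plu_scl[of X Y f 1 "- 1"] plu_neg scl_one by simp

lemma scl_zer:
  assumes "X \<in> Ob A" "Y \<in> Ob A" shows "c \<odot>\<^sub>h zer A X Y = zer A X Y"
  using scl_scl[of X Y "zer A X Y" c 0] scl_zero zer_closed assms by simp

lemma cmp_zer:
  assumes "X \<in> Ob A" "Y \<in> Ob A" "Z \<in> Ob A"
  shows "g \<in> Hm A Y Z \<Longrightarrow> g \<cdot> zer A X Y = zer A X Z" "f \<in> Hm A X Y \<Longrightarrow> zer A Y Z \<cdot> f = zer A X Z"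
proof -
  assume g: "g \<in> Hm A Y Z"
  have "g \<cdot> (0 \<odot>\<^sub>h zer A X Y) = 0 \<odot>\<^sub>h (g \<cdot> zer A X Y)"
    using g assms by (intro cmp_scl_right[OF assms] zer_closed)
  then show "g \<cdot> zer A X Y = zer A X Z" using g assms
    by (simp add: scl_zero zer_closed cmp_closed[of X Y Z])
next
  assume f: "f \<in> Hm A X Y"
  have "(0 \<odot>\<^sub>h zer A Y Z) \<cdot> f = 0 \<odot>\<^sub>h (zer A Y Z \<cdot> f)"
    using f assms by (intro cmp_scl_left[OF assms] zer_closed)
  then show "zer A Y Z \<cdot> f = zer A X Z" using f assms
    by (simp add: scl_zero zer_closed cmp_closed[of X Y Z])
qed

lemma cmp_hsum_right:
  assumes "X \<in> Ob A" "Y \<in> Ob A" "Z \<in> Ob A" "g \<in> Hm A Y Z" "set fs \<subseteq> Hm A X Y"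
  shows "g \<cdot> hsum A X Y fs = hsum A X Z (map (\<lambda>f. g \<cdot> f) fs)"
  using assms(5) by (induction fs) (use assms in \<open>auto simp: cmp_zer cmp_plu_right hsum_closed\<close>)

lemma cmp_hsum_left:
  assumes "X \<in> Ob A" "Y \<in> Ob A" "Z \<in> Ob A" "f \<in> Hm A X Y" "set gs \<subseteq> Hm A Y Z"
  shows "hsum A Y Z gs \<cdot> f = hsum A X Z (map (\<lambda>g. g \<cdot> f) gs)"
  using assms(5) by (induction gs) (use assms in \<open>auto simp: cmp_zer cmp_plu_left hsum_closed\<close>)

lemma hsum_filter:
  assumes "X \<in> Ob A" "Y \<in> Ob A" "\<And>j. j \<in> set js \<Longrightarrow> F j \<in> Hm A X Y"
    and "\<And>j. j \<in> set js \<Longrightarrow> \<not> P j \<Longrightarrow> F j = zer A X Y"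
  shows "hsum A X Y (map F js) = hsum A X Y (map F (filter P js))"
  using assms(3,4)
proof (induction js)
  case (Cons j js)
  then have "hsum A X Y (map F (filter P js)) \<in> Hm A X Y"
    using assms by (intro hsum_closed) auto
  then show ?case using Cons assms(1,2) by (auto simp: zer_plu)
qed simp

lemma hsum_single:
  assumes "X \<in> Ob A" "Y \<in> Ob A" "j < n" "F j \<in> Hm A X Y" "\<And>i. i < n \<Longrightarrow> i \<noteq> j \<Longrightarrow> F i = zer A X Y"
  shows "hsum A X Y (map F [0..<n]) = F j"
proof -
  have "hsum A X Y (map F [0..<n]) = hsum A X Y (map F (filter (\<lambda>i. i = j) [0..<n]))"
  proof (rule hsum_filter)
    fix i assume "i \<in> set [0..<n]"
    then show "F i \<in> Hm A X Y" using assms zer_closed by (cases "i = j") auto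
  qed (use assms in auto)
  also have "filter (\<lambda>i. i = j) [0..<n] = [j]"
    using assms(3) by (induction n) (auto simp: less_Suc_eq filter_empty_conv)
  finally show ?thesis using assms by (simp add: plu_zer)
qed

end

lemma map2_index:
  "length xs = n \<Longrightarrow> length ys = n \<Longrightarrow> map2 f xs ys = map (\<lambda>i. f (xs ! i) (ys ! i)) [0..<n]"
  by (rule nth_equalityI) auto

subsection \<open>Dual bases\<close>

context semisimple_stable_category
begin

lemma S_obj [simp]: "a \<in> S \<Longrightarrow> a \<in> Ob A"
  using S_ob by auto

text \<open>A nonzero identity makes F(a, a) exactly one-dimensional, so that the definite
  description in \<open>scalar\<close> denotes.\<close>

lemma scl_inj:
  assumes "a \<in> S" "c \<odot>\<^sub>h idn A a = d \<odot>\<^sub>h idn A a"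
  shows "c = d"
proof (rule ccontr)
  assume "c \<noteq> d"
  have a: "a \<in> Ob A" "idn A a \<in> Hm A a a" using assms(1) idn_closed by auto
  have "(c - d) \<odot>\<^sub>h idn A a = (c \<odot>\<^sub>h idn A a) \<oplus>\<^sub>h ((- 1) \<odot>\<^sub>h (d \<odot>\<^sub>h idn A a))"
    using plu_scl[of a a "idn A a" c "- d"] scl_scl[of a a "idn A a" "- 1" d] a by simp
  also have "\<dots> = zer A a a"
    using assms(2) a plu_neg scl_closed by metis
  finally have "inverse (c - d) \<odot>\<^sub>h ((c - d) \<odot>\<^sub>h idn A a) = zer A a a"
    using scl_zer a by simp
  then show False using \<open>c \<noteq> d\<close> a S_nonzero[OF assms(1)] by (simp add: scl_scl scl_one)
qed

lemma scalar_scl [simp]: "a \<in> S \<Longrightarrow> scalar A a (c \<odot>\<^sub>h idn A a) = c"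
  unfolding scalar_def using scl_inj by blast

lemma scalar_eq: "a \<in> S \<Longrightarrow> f \<in> Hm A a a \<Longrightarrow> f = scalar A a f \<odot>\<^sub>h idn A a"
  using S_simple scalar_scl by fastforce

text \<open>Composition with a dual vector isolates one coefficient. This is the uniqueness half of
  the basis property, for both spaces.\<close>

lemma dual_coordinates:
  assumes a: "a \<in> S" and X: "X \<in> Ob A" and j: "j < n"
    and mem: "\<And>i. i < n \<Longrightarrow> es ! i \<in> Hm A a X" "\<And>i. i < n \<Longrightarrow> ds ! i \<in> Hm A X a"
    and dual: "\<And>i j. i < n \<Longrightarrow> j < n \<Longrightarrow> ds ! i \<cdot> es ! j = (if i = j then idn A a else zer A a a)"
  shows "scalar A a (ds ! j \<cdot> hsum A a X (map (\<lambda>i. c i \<odot>\<^sub>h es ! i) [0..<n])) = c j"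
    "scalar A a (hsum A X a (map (\<lambda>i. c i \<odot>\<^sub>h ds ! i) [0..<n]) \<cdot> es ! j) = c j"
proof -
  have aO [simp]: "a \<in> Ob A" "idn A a \<in> Hm A a a" using a idn_closed by auto
  have sub: "set (map (\<lambda>i. c i \<odot>\<^sub>h es ! i) [0..<n]) \<subseteq> Hm A a X"
    "set (map (\<lambda>i. c i \<odot>\<^sub>h ds ! i) [0..<n]) \<subseteq> Hm A X a"
    using mem X by (auto intro: scl_closed)
  have single: "hsum A a a (map (\<lambda>i. c i \<odot>\<^sub>h (if i = j then idn A a else zer A a a)) [0..<n]) = c j \<odot>\<^sub>h idn A a"
    using hsum_single[OF aO(1) aO(1) j, of "\<lambda>i. c i \<odot>\<^sub>h (if i = j then idn A a else zer A a a)"]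
    by (simp add: scl_zer scl_closed)
  have "ds ! j \<cdot> hsum A a X (map (\<lambda>i. c i \<odot>\<^sub>h es ! i) [0..<n])
      = hsum A a a (map (\<lambda>i. ds ! j \<cdot> (c i \<odot>\<^sub>h es ! i)) [0..<n])"
    using cmp_hsum_right[OF aO(1) X aO(1) mem(2)[OF j] sub(1)] by (simp add: comp_def)
  also have "\<dots> = hsum A a a (map (\<lambda>i. c i \<odot>\<^sub>h (if i = j then idn A a else zer A a a)) [0..<n])"
  proof (intro arg_cong[of _ _ "hsum A a a"] map_cong[OF refl])
    fix i assume "i \<in> set [0..<n]"
    then have i: "i < n" by simp
    have "ds ! j \<cdot> (c i \<odot>\<^sub>h es ! i) = c i \<odot>\<^sub>h (ds ! j \<cdot> es ! i)"
      by (rule cmp_scl_right[OF aO(1) X aO(1) mem(1)[OF i] mem(2)[OF j]])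
    then show "ds ! j \<cdot> (c i \<odot>\<^sub>h es ! i) = c i \<odot>\<^sub>h (if i = j then idn A a else zer A a a)"
      using dual[OF j i] by simp
  qed
  finally show "scalar A a (ds ! j \<cdot> hsum A a X (map (\<lambda>i. c i \<odot>\<^sub>h es ! i) [0..<n])) = c j"
    using a single by simp
  have "hsum A X a (map (\<lambda>i. c i \<odot>\<^sub>h ds ! i) [0..<n]) \<cdot> es ! j
      = hsum A a a (map (\<lambda>i. (c i \<odot>\<^sub>h ds ! i) \<cdot> es ! j) [0..<n])"
    using cmp_hsum_left[OF aO(1) X aO(1) mem(1)[OF j] sub(2)] by (simp add: comp_def)
  also have "\<dots> = hsum A a a (map (\<lambda>i. c i \<odot>\<^sub>h (if i = j then idn A a else zer A a a)) [0..<n])"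
  proof (intro arg_cong[of _ _ "hsum A a a"] map_cong[OF refl])
    fix i assume "i \<in> set [0..<n]"
    then have i: "i < n" by simp
    have "(c i \<odot>\<^sub>h ds ! i) \<cdot> es ! j = c i \<odot>\<^sub>h (ds ! i \<cdot> es ! j)"
      by (rule cmp_scl_left[OF aO(1) X aO(1) mem(1)[OF j] mem(2)[OF i]])
    then show "(c i \<odot>\<^sub>h ds ! i) \<cdot> es ! j = c i \<odot>\<^sub>h (if i = j then idn A a else zer A a a)"
      using dual[OF i j] by simp
  qed
  finally show "scalar A a (hsum A X a (map (\<lambda>i. c i \<odot>\<^sub>h ds ! i) [0..<n]) \<cdot> es ! j) = c j"
    using a single by simp
qed

lemma is_basisI:
  assumes "set es \<subseteq> Hm A X Y"
    and "\<And>f. f \<in> Hm A X Y \<Longrightarrow> f = hsum A X Y (map (\<lambda>i. c f i \<odot>\<^sub>h es ! i) [0..<length es])"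
    and "\<And>b j. j < length es \<Longrightarrow> c (hsum A X Y (map (\<lambda>i. b i \<odot>\<^sub>h es ! i) [0..<length es])) j = b j"
  shows "is_basis A X Y es"
  unfolding is_basis_def
proof (intro conjI ballI)
  fix f assume f: "f \<in> Hm A X Y"
  show "\<exists>!cs. length cs = length es \<and> f = hsum A X Y (map2 (scl A) cs es)"
  proof
    have "map2 (scl A) (map (c f) [0..<length es]) es = map (\<lambda>i. c f i \<odot>\<^sub>h es ! i) [0..<length es]"
      by (simp add: map2_index[of _ "length es"])
    then show "length (map (c f) [0..<length es]) = length es \<and>
        f = hsum A X Y (map2 (scl A) (map (c f) [0..<length es]) es)"
      using assms(2)[OF f] by (metis length_map length_upt diff_zero)
  next
    fix cs assume cs: "length cs = length es \<and> f = hsum A X Y (map2 (scl A) cs es)"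
    then have "f = hsum A X Y (map (\<lambda>i. cs ! i \<odot>\<^sub>h es ! i) [0..<length es])"
      by (simp add: map2_index[of _ "length es"])
    then show "cs = map (c f) [0..<length es]"
      using cs assms(3)[of _ "\<lambda>i. cs ! i"] by (intro nth_equalityI) auto
  qed
qed (use assms(1) in auto)

text \<open>Completeness is requested in the form in which a direct sum decomposition supplies it.
  Since \<open>ds ! i \<cdot> f\<close> and \<open>g \<cdot> es ! i\<close> lie in F(a, a) = K, such
  a resolution already is an expansion in the basis.\<close>

lemma dual_basesI:
  assumes a: "a \<in> S" and X: "X \<in> Ob A" and len: "length es = n" "length ds = n"
    and mem: "\<And>i. i < n \<Longrightarrow> es ! i \<in> Hm A a X" "\<And>i. i < n \<Longrightarrow> ds ! i \<in> Hm A X a"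
    and dual: "\<And>i j. i < n \<Longrightarrow> j < n \<Longrightarrow> ds ! i \<cdot> es ! j = (if i = j then idn A a else zer A a a)"
    and span: "\<And>f. f \<in> Hm A a X \<Longrightarrow> hsum A a X (map (\<lambda>i. es ! i \<cdot> (ds ! i \<cdot> f)) [0..<n]) = f"
      "\<And>g. g \<in> Hm A X a \<Longrightarrow> hsum A X a (map (\<lambda>i. (g \<cdot> es ! i) \<cdot> ds ! i) [0..<n]) = g"
  shows "dual_bases A a X es ds"
proof -
  have aO [simp]: "a \<in> Ob A" "idn A a \<in> Hm A a a" using a idn_closed by auto
  have "is_basis A a X es"
  proof (rule is_basisI[of _ _ _ "\<lambda>f i. scalar A a (ds ! i \<cdot> f)"])
    show "set es \<subseteq> Hm A a X" using mem(1) len by (auto simp: set_conv_nth)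
    fix f assume f: "f \<in> Hm A a X"
    have "es ! i \<cdot> (ds ! i \<cdot> f) = scalar A a (ds ! i \<cdot> f) \<odot>\<^sub>h es ! i" if i: "i < n" for i
    proof -
      have "ds ! i \<cdot> f \<in> Hm A a a" by (rule cmp_closed[OF aO(1) X aO(1) f mem(2)[OF i]])
      then have "es ! i \<cdot> (ds ! i \<cdot> f) = es ! i \<cdot> (scalar A a (ds ! i \<cdot> f) \<odot>\<^sub>h idn A a)"
        using scalar_eq[OF a] by simp
      also have "\<dots> = scalar A a (ds ! i \<cdot> f) \<odot>\<^sub>h (es ! i \<cdot> idn A a)"
        by (rule cmp_scl_right[OF aO(1) aO(1) X aO(2) mem(1)[OF i]])
      finally show ?thesis using idn_right[OF aO(1) X mem(1)[OF i]] by simp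
    qed
    then have m: "map (\<lambda>i. es ! i \<cdot> (ds ! i \<cdot> f)) [0..<n] = map (\<lambda>i. scalar A a (ds ! i \<cdot> f) \<odot>\<^sub>h es ! i) [0..<n]"
      by (intro map_cong) simp_all
    show "f = hsum A a X (map (\<lambda>i. scalar A a (ds ! i \<cdot> f) \<odot>\<^sub>h es ! i) [0..<length es])"
      unfolding len m[symmetric] by (rule span(1)[OF f, symmetric])
  qed (simp add: len dual_coordinates(1)[OF a X _ mem dual])
  moreover have "is_basis A X a ds"
  proof (rule is_basisI[of _ _ _ "\<lambda>g i. scalar A a (g \<cdot> es ! i)"])
    show "set ds \<subseteq> Hm A X a" using mem(2) len by (auto simp: set_conv_nth)
    fix g assume g: "g \<in> Hm A X a"
    have "(g \<cdot> es ! i) \<cdot> ds ! i = scalar A a (g \<cdot> es ! i) \<odot>\<^sub>h ds ! i" if i: "i < n" for i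
    proof -
      have "g \<cdot> es ! i \<in> Hm A a a" by (rule cmp_closed[OF aO(1) X aO(1) mem(1)[OF i] g])
      then have "(g \<cdot> es ! i) \<cdot> ds ! i = (scalar A a (g \<cdot> es ! i) \<odot>\<^sub>h idn A a) \<cdot> ds ! i"
        using scalar_eq[OF a] by simp
      also have "\<dots> = scalar A a (g \<cdot> es ! i) \<odot>\<^sub>h (idn A a \<cdot> ds ! i)"
        by (rule cmp_scl_left[OF X aO(1) aO(1) mem(2)[OF i] aO(2)])
      finally show ?thesis using idn_left[OF X aO(1) mem(2)[OF i]] by simp
    qed
    then have m: "map (\<lambda>i. (g \<cdot> es ! i) \<cdot> ds ! i) [0..<n] = map (\<lambda>i. scalar A a (g \<cdot> es ! i) \<odot>\<^sub>h ds ! i) [0..<n]"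
      by (intro map_cong) simp_all
    show "g = hsum A X a (map (\<lambda>i. scalar A a (g \<cdot> es ! i) \<odot>\<^sub>h ds ! i) [0..<length ds])"
      unfolding len m[symmetric] by (rule span(2)[OF g, symmetric])
  qed (simp add: len dual_coordinates(2)[OF a X _ mem dual])
  ultimately show ?thesis using dual len by (simp add: dual_bases_def)
qed

lemma dual_bases_expand:
  assumes a: "a \<in> S" and X: "X \<in> Ob A" and db: "dual_bases A a X es ds"
  shows "f \<in> Hm A a X \<Longrightarrow> f = hsum A a X (map (\<lambda>i. scalar A a (ds ! i \<cdot> f) \<odot>\<^sub>h es ! i) [0..<length es])"
    "g \<in> Hm A X a \<Longrightarrow> g = hsum A X a (map (\<lambda>i. scalar A a (g \<cdot> es ! i) \<odot>\<^sub>h ds ! i) [0..<length es])"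
proof -
  let ?n = "length es"
  have len: "length ds = ?n" and mem: "\<And>i. i < ?n \<Longrightarrow> es ! i \<in> Hm A a X" "\<And>i. i < ?n \<Longrightarrow> ds ! i \<in> Hm A X a"
    and dual: "\<And>i j. i < ?n \<Longrightarrow> j < ?n \<Longrightarrow> ds ! i \<cdot> es ! j = (if i = j then idn A a else zer A a a)"
    using db by (auto simp: dual_bases_def is_basis_def)
  note coord = dual_coordinates[OF a X _ mem dual]
  {
    assume "f \<in> Hm A a X"
    then obtain cs where cs: "length cs = ?n" "f = hsum A a X (map2 (scl A) cs es)"
      using db unfolding dual_bases_def is_basis_def by blast
    then have f: "f = hsum A a X (map (\<lambda>i. cs ! i \<odot>\<^sub>h es ! i) [0..<?n])"
      by (simp add: map2_index[of _ ?n])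
    have c: "scalar A a (ds ! i \<cdot> f) = cs ! i" if "i < ?n" for i
      by (subst f) (rule coord(1)[OF that])
    show "f = hsum A a X (map (\<lambda>i. scalar A a (ds ! i \<cdot> f) \<odot>\<^sub>h es ! i) [0..<?n])"
      by (subst f) (intro arg_cong[of _ _ "hsum A a X"] map_cong[OF refl], simp add: c)
  }
  {
    assume "g \<in> Hm A X a"
    then obtain cs where cs: "length cs = ?n" "g = hsum A X a (map2 (scl A) cs ds)"
      using db len unfolding dual_bases_def is_basis_def by metis
    then have g: "g = hsum A X a (map (\<lambda>i. cs ! i \<odot>\<^sub>h ds ! i) [0..<?n])"
      using len by (simp add: map2_index[of _ ?n])
    have c: "scalar A a (g \<cdot> es ! i) = cs ! i" if "i < ?n" for i
      by (subst g) (rule coord(2)[OF that])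
    show "g = hsum A X a (map (\<lambda>i. scalar A a (g \<cdot> es ! i) \<odot>\<^sub>h ds ! i) [0..<?n])"
      by (subst g) (intro arg_cong[of _ _ "hsum A X a"] map_cong[OF refl], simp add: c)
  }
qed

text \<open>Schur's lemma, in the form of \<open>S_distinct\<close>: in the resolution of the
  identity of \<open>X\<close> only the summands equal to \<open>a\<close> contribute to morphisms
  from or to \<open>a\<close>. Their number is therefore the length of a basis of F(a, X), which
  later turns multiplicities into dimensions.\<close>

lemma direct_sum_dual_bases:
  assumes a: "a \<in> S" and X: "X \<in> Ob A" and as: "set as \<subseteq> S"
    and mem: "\<And>i. i < length as \<Longrightarrow> \<iota> i \<in> Hm A (as ! i) X" "\<And>i. i < length as \<Longrightarrow> \<pi> i \<in> Hm A X (as ! i)"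
    and dual: "\<And>i j. i < length as \<Longrightarrow> j < length as \<Longrightarrow>
      \<pi> i \<cdot> \<iota> j = (if i = j then idn A (as ! i) else zer A (as ! j) (as ! i))"
    and sum: "hsum A X X (map (\<lambda>i. \<iota> i \<cdot> \<pi> i) [0..<length as]) = idn A X"
  defines "I \<equiv> filter (\<lambda>i. as ! i = a) [0..<length as]"
  shows "dual_bases A a X (map \<iota> I) (map \<pi> I)"
proof -
  have I: "I ! i < length as" "as ! (I ! i) = a" if "i < length I" for i
    using nth_mem[OF that] by (auto simp: I_def)
  have dI: "distinct I" by (simp add: I_def)
  have aO [simp]: "a \<in> Ob A" using a by simp
  have asS: "as ! i \<in> S" "as ! i \<in> Ob A" if "i < length as" for i
    using nth_mem[OF that] as S_ob by auto
  have sub: "set (map (\<lambda>i. \<iota> i \<cdot> \<pi> i) [0..<length as]) \<subseteq> Hm A X X"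
    using cmp_closed[OF X asS(2) X mem(2) mem(1)] by auto
  show ?thesis
  proof (rule dual_basesI[OF a X, of _ "length I"])
    show "i < length I \<Longrightarrow> map \<iota> I ! i \<in> Hm A a X" "i < length I \<Longrightarrow> map \<pi> I ! i \<in> Hm A X a" for i
      using mem[of "I ! i"] I[of i] by auto
    show "map \<pi> I ! i \<cdot> map \<iota> I ! j = (if i = j then idn A a else zer A a a)"
      if "i < length I" "j < length I" for i j
      using dual[of "I ! i" "I ! j"] I[of i] I[of j] that dI by (simp add: nth_eq_iff_index_eq)
    fix f assume f: "f \<in> Hm A a X"
    have "f = hsum A X X (map (\<lambda>i. \<iota> i \<cdot> \<pi> i) [0..<length as]) \<cdot> f"
      by (simp only: sum idn_left[OF aO X f])
    also have "\<dots> = hsum A a X (map (\<lambda>i. (\<iota> i \<cdot> \<pi> i) \<cdot> f) [0..<length as])"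
      using cmp_hsum_left[OF aO X X f sub] by (simp add: comp_def)
    also have "\<dots> = hsum A a X (map (\<lambda>i. \<iota> i \<cdot> (\<pi> i \<cdot> f)) [0..<length as])"
      using cmp_assoc[OF aO X asS(2) X f mem(2) mem(1)]
      by (intro arg_cong[of _ _ "hsum A a X"] map_cong[OF refl]) simp
    also have "\<dots> = hsum A a X (map (\<lambda>i. \<iota> i \<cdot> (\<pi> i \<cdot> f)) I)"
      unfolding I_def
    proof (rule hsum_filter[OF aO X])
      fix i assume "i \<in> set [0..<length as]"
      then have i: "i < length as" by simp
      note c = cmp_closed[OF aO X asS(2)[OF i] f mem(2)[OF i]]
      show "\<iota> i \<cdot> (\<pi> i \<cdot> f) \<in> Hm A a X"
        by (rule cmp_closed[OF aO asS(2)[OF i] X c mem(1)[OF i]])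
      show "\<iota> i \<cdot> (\<pi> i \<cdot> f) = zer A a X" if "as ! i \<noteq> a"
        using S_distinct[OF a asS(1)[OF i]] that c cmp_zer(1)[OF aO asS(2)[OF i] X mem(1)[OF i]] by auto
    qed
    also have "\<dots> = hsum A a X (map (\<lambda>i. map \<iota> I ! i \<cdot> (map \<pi> I ! i \<cdot> f)) [0..<length I])"
      by (intro arg_cong[of _ _ "hsum A a X"] nth_equalityI) simp_all
    finally show "hsum A a X (map (\<lambda>i. map \<iota> I ! i \<cdot> (map \<pi> I ! i \<cdot> f)) [0..<length I]) = f" by (rule sym)
  next
    fix g assume g: "g \<in> Hm A X a"
    have "g = g \<cdot> hsum A X X (map (\<lambda>i. \<iota> i \<cdot> \<pi> i) [0..<length as])"
      by (simp only: sum idn_right[OF X aO g])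
    also have "\<dots> = hsum A X a (map (\<lambda>i. g \<cdot> (\<iota> i \<cdot> \<pi> i)) [0..<length as])"
      using cmp_hsum_right[OF X X aO g sub] by (simp add: comp_def)
    also have "\<dots> = hsum A X a (map (\<lambda>i. (g \<cdot> \<iota> i) \<cdot> \<pi> i) [0..<length as])"
      using cmp_assoc[OF X asS(2) X aO mem(2) mem(1) g]
      by (intro arg_cong[of _ _ "hsum A X a"] map_cong[OF refl]) simp
    also have "\<dots> = hsum A X a (map (\<lambda>i. (g \<cdot> \<iota> i) \<cdot> \<pi> i) I)"
      unfolding I_def
    proof (rule hsum_filter[OF X aO])
      fix i assume "i \<in> set [0..<length as]"
      then have i: "i < length as" by simp
      note c = cmp_closed[OF asS(2)[OF i] X aO mem(1)[OF i] g]
      show "(g \<cdot> \<iota> i) \<cdot> \<pi> i \<in> Hm A X a"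
        by (rule cmp_closed[OF X asS(2)[OF i] aO mem(2)[OF i] c])
      show "(g \<cdot> \<iota> i) \<cdot> \<pi> i = zer A X a" if "as ! i \<noteq> a"
        using S_distinct[OF asS(1)[OF i] a] that c cmp_zer(2)[OF X asS(2)[OF i] aO mem(2)[OF i]] by auto
    qed
    also have "\<dots> = hsum A X a (map (\<lambda>i. (g \<cdot> map \<iota> I ! i) \<cdot> map \<pi> I ! i) [0..<length I])"
      by (intro arg_cong[of _ _ "hsum A X a"] nth_equalityI) simp_all
    finally show "hsum A X a (map (\<lambda>i. (g \<cdot> map \<iota> I ! i) \<cdot> map \<pi> I ! i) [0..<length I]) = g" by (rule sym)
  qed simp_all
qed

lemma dual_bases_exist:
  assumes "a \<in> S" "X \<in> Ob A"
  shows "\<exists>es ds. dual_bases A a X es ds"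
proof -
  obtain as where as: "set as \<subseteq> S" "is_direct_sum A X as" using S_generates assms by blast
  then obtain \<iota> \<pi> where "\<forall>i<length as. \<iota> i \<in> Hm A (as ! i) X \<and> \<pi> i \<in> Hm A X (as ! i)"
    "\<forall>i<length as. \<forall>j<length as. \<pi> i \<cdot> \<iota> j = (if i = j then idn A (as ! i) else zer A (as ! j) (as ! i))"
    "hsum A X X (map (\<lambda>i. \<iota> i \<cdot> \<pi> i) [0..<length as]) = idn A X"
    unfolding is_direct_sum_def by blast
  then show ?thesis using direct_sum_dual_bases[OF assms as(1), of \<iota> \<pi>] by blast
qed

subsection \<open>Linear functionals on word morphisms\<close>

lemma arr_plu [simp]:
  assumes "arr f" "arr g" "src g = src f" "tgt g = tgt f"
  shows "arr (f \<oplus>\<^sub>h g)" "src (f \<oplus>\<^sub>h g) = src f" "tgt (f \<oplus>\<^sub>h g) = tgt f"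
  using hom_arr[OF _ _ plu_closed[OF arr_hom(1)[OF assms(1)] arr_hom(2)[OF assms(1)] arr_hom(3)[OF assms(1)]], of g]
    arr_hom[OF assms(1)] arr_hom[OF assms(2)] assms by auto

lemma arr_scl [simp]:
  assumes "arr f" shows "arr (c \<odot>\<^sub>h f)" "src (c \<odot>\<^sub>h f) = src f" "tgt (c \<odot>\<^sub>h f) = tgt f"
  using hom_arr[OF _ _ scl_closed[OF arr_hom[OF assms]]] arr_hom[OF assms] by auto

lemma cmp_plu:
  "arr f \<Longrightarrow> arr g \<Longrightarrow> arr h \<Longrightarrow> src g = src f \<Longrightarrow> tgt g = tgt f \<Longrightarrow> src h = tgt f \<Longrightarrow>
    h \<cdot> (f \<oplus>\<^sub>h g) = (h \<cdot> f) \<oplus>\<^sub>h (h \<cdot> g)"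
  "arr f \<Longrightarrow> arr g \<Longrightarrow> arr h \<Longrightarrow> src g = src f \<Longrightarrow> tgt g = tgt f \<Longrightarrow> tgt h = src f \<Longrightarrow>
    (f \<oplus>\<^sub>h g) \<cdot> h = (f \<cdot> h) \<oplus>\<^sub>h (g \<cdot> h)"
  using cmp_plu_right[of "src f" "tgt f" "tgt h" f g h] cmp_plu_left[of "src h" "src f" "tgt f" h f g]
  by (simp_all add: hom_iff)

lemma cmp_scl:
  "arr f \<Longrightarrow> arr h \<Longrightarrow> src h = tgt f \<Longrightarrow> h \<cdot> (c \<odot>\<^sub>h f) = c \<odot>\<^sub>h (h \<cdot> f)"
  "arr f \<Longrightarrow> arr h \<Longrightarrow> tgt h = src f \<Longrightarrow> (c \<odot>\<^sub>h f) \<cdot> h = c \<odot>\<^sub>h (f \<cdot> h)"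
  using cmp_scl_right[of "src f" "tgt f" "tgt h" f h c] cmp_scl_left[of "src h" "src f" "tgt f" h f c]
  by (simp_all add: hom_iff)

lemma tar_plu:
  "arr f \<Longrightarrow> arr g \<Longrightarrow> arr h \<Longrightarrow> src g = src f \<Longrightarrow> tgt g = tgt f \<Longrightarrow>
    h \<boxtimes> (f \<oplus>\<^sub>h g) = (h \<boxtimes> f) \<oplus>\<^sub>h (h \<boxtimes> g)"
  "arr f \<Longrightarrow> arr g \<Longrightarrow> arr h \<Longrightarrow> src g = src f \<Longrightarrow> tgt g = tgt f \<Longrightarrow>
    (f \<oplus>\<^sub>h g) \<boxtimes> h = (f \<boxtimes> h) \<oplus>\<^sub>h (g \<boxtimes> h)"
  using tar_plu_right[of "src f" "tgt f" "src h" "tgt h" f g h] tar_plu_left[of "src f" "tgt f" "src h" "tgt h" f g h]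
  by (simp_all add: hom_iff)

lemma tar_scl:
  "arr f \<Longrightarrow> arr h \<Longrightarrow> h \<boxtimes> (c \<odot>\<^sub>h f) = c \<odot>\<^sub>h (h \<boxtimes> f)"
  "arr f \<Longrightarrow> arr h \<Longrightarrow> (c \<odot>\<^sub>h f) \<boxtimes> h = c \<odot>\<^sub>h (f \<boxtimes> h)"
  using tar_scl_right[of "src h" "tgt h" "src f" "tgt f" h f c] tar_scl_left[of "src f" "tgt f" "src h" "tgt h" f h c]
  by (simp_all add: hom_iff)

definition whom where "whom xs ys = {f. warr f \<and> wsrc f = xs \<and> wtgt f = ys}"

lemma whomD: "f \<in> whom xs ys \<Longrightarrow> warr f" "f \<in> whom xs ys \<Longrightarrow> wsrc f = xs" "f \<in> whom xs ys \<Longrightarrow> wtgt f = ys"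
  by (simp_all add: whom_def)

lemma whom_word: "wob xs \<Longrightarrow> wob ys \<Longrightarrow> f \<in> Hm A (wprod A xs) (wprod A ys) \<Longrightarrow> (xs, f, ys) \<in> whom xs ys"
  unfolding whom_def warr_def using hom_arr[OF wprod_ob wprod_ob, of xs ys f] by simp

lemma whom_cmp: "f \<in> whom xs ys \<Longrightarrow> g \<in> whom ys zs \<Longrightarrow> g \<star> f \<in> whom xs zs"
  by (simp add: whom_def)

lemma whom_pad: "f \<in> whom xs ys \<Longrightarrow> wob L \<Longrightarrow> wob R \<Longrightarrow> pad L f R \<in> whom (L @ xs @ R) (L @ ys @ R)"
  by (simp add: whom_def)

definition wadd where "wadd f g = (wsrc f, wmor f \<oplus>\<^sub>h wmor g, wtgt f)"

lemma wadd_sel [simp]: "wsrc (wadd f g) = wsrc f" "wtgt (wadd f g) = wtgt f" "wmor (wadd f g) = wmor f \<oplus>\<^sub>h wmor g"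
  by (simp_all add: wadd_def)

lemma wscl_sel [simp]: "wsrc (wscl A c f) = wsrc f" "wtgt (wscl A c f) = wtgt f" "wmor (wscl A c f) = c \<odot>\<^sub>h wmor f"
  by (cases f; simp)+

lemma warr_wadd [simp]:
  "warr f \<Longrightarrow> warr g \<Longrightarrow> wsrc g = wsrc f \<Longrightarrow> wtgt g = wtgt f \<Longrightarrow> warr (wadd f g)"
  unfolding warr_def by simp

lemma warr_wscl [simp]: "warr f \<Longrightarrow> warr (wscl A c f)"
  unfolding warr_def by simp

lemma wcmp_wadd:
  assumes "f \<in> whom xs ys" "g \<in> whom xs ys"
  shows "h \<in> whom ys zs \<Longrightarrow> h \<star> wadd f g = wadd (h \<star> f) (h \<star> g)"
    "k \<in> whom zs xs \<Longrightarrow> wadd f g \<star> k = wadd (f \<star> k) (g \<star> k)"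
  using assms unfolding whom_def warr_def by (auto intro!: word_mor_eqI simp: cmp_plu)

lemma wcmp_wscl:
  assumes "f \<in> whom xs ys"
  shows "h \<in> whom ys zs \<Longrightarrow> h \<star> wscl A c f = wscl A c (h \<star> f)"
    "k \<in> whom zs xs \<Longrightarrow> wscl A c f \<star> k = wscl A c (f \<star> k)"
  using assms unfolding whom_def warr_def by (auto intro!: word_mor_eqI simp: cmp_scl)

lemma pad_wadd:
  assumes "f \<in> whom xs ys" "g \<in> whom xs ys" "wob L" "wob R"
  shows "pad L (wadd f g) R = wadd (pad L f R) (pad L g R)"
  using assms unfolding whom_def warr_def
  by (intro word_mor_eqI) (auto simp: pad_def wten_sel cmp_plu tar_plu)

lemma pad_wscl:
  assumes "f \<in> whom xs ys" "wob L" "wob R"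
  shows "pad L (wscl A c f) R = wscl A c (pad L f R)"
  using assms unfolding whom_def warr_def
  by (intro word_mor_eqI) (auto simp: pad_def wten_sel cmp_scl tar_scl)

text \<open>Traces are compared only as numbers. Pushing finite sums of morphisms through such
  functionals into the field at once keeps sums out of the diagrams.\<close>

definition wlin where
  "wlin xs ys \<Lambda> \<longleftrightarrow> (\<forall>f\<in>whom xs ys. (\<forall>g\<in>whom xs ys. \<Lambda> (wadd f g) = \<Lambda> f + (\<Lambda> g :: 'k)) \<and>
     (\<forall>c. \<Lambda> (wscl A c f) = c * \<Lambda> f))"

lemma wlin_cmp:
  assumes "wlin xs zs \<Lambda>" "h \<in> whom ys zs"
  shows "wlin xs ys (\<lambda>f. \<Lambda> (h \<star> f))"
  using assms unfolding wlin_def by (simp add: wcmp_wadd wcmp_wscl whom_cmp)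

lemma wlin_cmp':
  assumes "wlin xs zs \<Lambda>" "h \<in> whom xs ys"
  shows "wlin ys zs (\<lambda>f. \<Lambda> (f \<star> h))"
  using assms unfolding wlin_def by (simp add: wcmp_wadd wcmp_wscl whom_cmp)

lemma wlin_pad:
  assumes "wlin (L @ xs @ R) (L @ ys @ R) \<Lambda>" "wob L" "wob R"
  shows "wlin xs ys (\<lambda>f. \<Lambda> (pad L f R))"
  using assms unfolding wlin_def by (simp add: pad_wadd pad_wscl whom_pad)

lemma wlin_sum:
  assumes "\<And>i. i \<in> I \<Longrightarrow> wlin xs ys (\<Lambda> i)"
  shows "wlin xs ys (\<lambda>f. \<Sum>i\<in>I. \<Lambda> i f)"
  using assms unfolding wlin_def by (simp add: sum.distrib sum_distrib_left)

lemma wlin_hsum: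
  assumes lin: "wlin xs ys \<Lambda>" and w: "wob xs" "wob ys"
    and mem: "\<And>i. i < n \<Longrightarrow> F i \<in> Hm A (wprod A xs) (wprod A ys)"
  shows "\<Lambda> (xs, hsum A (wprod A xs) (wprod A ys) (map F [0..<n]), ys) = (\<Sum>i<n. \<Lambda> (xs, F i, ys))"
proof -
  let ?X = "wprod A xs" and ?Y = "wprod A ys"
  have X: "?X \<in> Ob A" "?Y \<in> Ob A" using w by auto
  have z: "(xs, zer A ?X ?Y, ys) \<in> whom xs ys" using w zer_closed X by (intro whom_word) auto
  have "\<Lambda> (xs, hsum A ?X ?Y (map F is), ys) = (\<Sum>i\<leftarrow>is. \<Lambda> (xs, F i, ys))"
    if "set is \<subseteq> {..<n}" for "is"
    using that
  proof (induction "is")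
    case Nil
    have "wscl A 0 (xs, zer A ?X ?Y, ys) = (xs, zer A ?X ?Y, ys)"
      using scl_zero[OF X zer_closed[OF X]] by simp
    then have "\<Lambda> (xs, zer A ?X ?Y, ys) = 0"
      using lin z unfolding wlin_def by (metis mult_zero_left)
    then show ?case by simp
  next
    case (Cons i "is")
    have "(xs, F i, ys) \<in> whom xs ys" using mem[of i] Cons.prems w by (intro whom_word) auto
    moreover have "(xs, hsum A ?X ?Y (map F is), ys) \<in> whom xs ys"
      using mem Cons.prems w X by (intro whom_word hsum_closed) auto
    moreover have "(xs, hsum A ?X ?Y (map F (i # is)), ys)
        = wadd (xs, F i, ys) (xs, hsum A ?X ?Y (map F is), ys)"
      by (simp add: wadd_def)
    ultimately have "\<Lambda> (xs, hsum A ?X ?Y (map F (i # is)), ys)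
        = \<Lambda> (xs, F i, ys) + \<Lambda> (xs, hsum A ?X ?Y (map F is), ys)"
      using lin unfolding wlin_def by metis
    then show ?case using Cons by simp
  qed
  from this[of "[0..<n]"] show ?thesis
    by (simp add: sum_list_distinct_conv_sum_set atLeast0LessThan subset_iff)
qed

lemma wlin_expand:
  assumes lin: "wlin xs ys \<Lambda>" and w: "wob xs" "wob ys"
    and mem: "\<And>i. i < n \<Longrightarrow> e i \<in> Hm A (wprod A xs) (wprod A ys)"
    and f: "f = hsum A (wprod A xs) (wprod A ys) (map (\<lambda>i. c i \<odot>\<^sub>h e i) [0..<n])"
  shows "\<Lambda> (xs, f, ys) = (\<Sum>i<n. c i * \<Lambda> (xs, e i, ys))"
proof -
  have "\<Lambda> (xs, f, ys) = (\<Sum>i<n. \<Lambda> (xs, c i \<odot>\<^sub>h e i, ys))"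
    unfolding f by (rule wlin_hsum[OF lin w]) (use w mem in \<open>auto intro!: scl_closed\<close>)
  also have "\<dots> = (\<Sum>i<n. c i * \<Lambda> (xs, e i, ys))"
  proof (rule sum.cong[OF refl])
    fix i assume "i \<in> {..<n}"
    then have "(xs, e i, ys) \<in> whom xs ys" using w mem by (intro whom_word) auto
    then have "\<Lambda> (wscl A (c i) (xs, e i, ys)) = c i * \<Lambda> (xs, e i, ys)"
      using lin unfolding wlin_def by blast
    then show "\<Lambda> (xs, c i \<odot>\<^sub>h e i, ys) = c i * \<Lambda> (xs, e i, ys)" by simp
  qed
  finally show ?thesis .
qed

subsection \<open>Iterated traces\<close>

definition contract where
  "contract w e d U \<phi> = pad [] (w, d, []) U \<star> \<phi> \<star> pad [] ([], e, w) U"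

text \<open>The iterated trace to the unit with value in K. A traced factor disappears completely,
  because morphisms from \<open>\<one>\<^sub>c\<close> can be read as starting at the empty word.
  The bases come from the same \<open>SOME\<close> expression as in \<open>partial_trace\<close>, so
  that the two traces can be compared summand by summand.\<close>

fun itr where
  "itr [] \<phi> = scalar A \<one>\<^sub>c (wmor \<phi>)"
| "itr (w # ws) \<phi> = (let (es, ds) = (SOME (es, ds). dual_bases A \<one>\<^sub>c (wprod A w) es ds)
     in \<Sum>i<length es. itr ws (contract w (es ! i) (ds ! i) (concat ws) \<phi>))"

definition chosen_bases where
  "chosen_bases w = (SOME (es, ds). dual_bases A \<one>\<^sub>c (wprod A w) es ds)"

lemma chosen_bases:
  assumes "wob w" shows "dual_bases A \<one>\<^sub>c (wprod A w) (fst (chosen_bases w)) (snd (chosen_bases w))"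
proof -
  obtain es ds where "dual_bases A \<one>\<^sub>c (wprod A w) es ds"
    using dual_bases_exist unt_S assms by (meson wprod_ob)
  then have "case chosen_bases w of (es, ds) \<Rightarrow> dual_bases A \<one>\<^sub>c (wprod A w) es ds"
    unfolding chosen_bases_def by (intro someI_ex[of "\<lambda>(es, ds). dual_bases A \<one>\<^sub>c (wprod A w) es ds"]) auto
  then show ?thesis by (simp add: case_prod_unfold)
qed

lemma itr_chosen:
  "itr (w # ws) \<phi> = (\<Sum>i<length (fst (chosen_bases w)).
     itr ws (contract w (fst (chosen_bases w) ! i) (snd (chosen_bases w) ! i) (concat ws) \<phi>))"
  by (simp add: chosen_bases_def case_prod_unfold Let_def)

declare itr.simps(2) [simp del]

lemma dual_bases_mem:
  assumes "dual_bases A \<one>\<^sub>c (wprod A w) es ds" "wob w" "i < length es"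
  shows "([], es ! i, w) \<in> whom [] w" "(w, ds ! i, []) \<in> whom w []"
    "es ! i \<in> Hm A \<one>\<^sub>c (wprod A w)" "ds ! i \<in> Hm A (wprod A w) \<one>\<^sub>c"
proof -
  show 1: "es ! i \<in> Hm A \<one>\<^sub>c (wprod A w)" "ds ! i \<in> Hm A (wprod A w) \<one>\<^sub>c"
    using assms by (auto simp: dual_bases_def is_basis_def)
  show "([], es ! i, w) \<in> whom [] w" "(w, ds ! i, []) \<in> whom w []"
    by (rule whom_word; use 1 assms in simp)+
qed

lemma whom_contract:
  assumes "([], e, w) \<in> whom [] w" "(w, d, []) \<in> whom w []" "\<phi> \<in> whom (w @ U) (w @ U)" "wob U"
  shows "contract w e d U \<phi> \<in> whom U U"
  using whom_pad[OF assms(1), of "[]" U] whom_pad[OF assms(2), of "[]" U] assms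
  unfolding contract_def by (auto intro!: whom_cmp)

lemma wlin_scalar: "wlin [] [] (\<lambda>\<phi>. scalar A \<one>\<^sub>c (wmor \<phi>))"
proof -
  have s: "\<exists>c. wmor f = c \<odot>\<^sub>h idn A \<one>\<^sub>c" if "f \<in> whom [] []" for f
  proof -
    have "wmor f \<in> Hm A \<one>\<^sub>c \<one>\<^sub>c" using that unfolding whom_def warr_def by (auto simp: hom_iff)
    then show ?thesis using S_simple[OF unt_S] by auto
  qed
  have i: "idn A \<one>\<^sub>c \<in> Hm A \<one>\<^sub>c \<one>\<^sub>c" by (simp add: idn_closed)
  have "scalar A \<one>\<^sub>c (wmor (wadd f g)) = scalar A \<one>\<^sub>c (wmor f) + scalar A \<one>\<^sub>c (wmor g)"
    if fg: "f \<in> whom [] []" "g \<in> whom [] []" for f g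
  proof -
    obtain c d where "wmor f = c \<odot>\<^sub>h idn A \<one>\<^sub>c" "wmor g = d \<odot>\<^sub>h idn A \<one>\<^sub>c" using s fg by blast
    then show ?thesis using i unt_S by (simp flip: plu_scl[of "\<one>\<^sub>c" "\<one>\<^sub>c"])
  qed
  moreover have "scalar A \<one>\<^sub>c (wmor (wscl A c f)) = c * scalar A \<one>\<^sub>c (wmor f)"
    if f: "f \<in> whom [] []" for f c
  proof -
    obtain d where "wmor f = d \<odot>\<^sub>h idn A \<one>\<^sub>c" using s f by blast
    then show ?thesis using i unt_S scl_scl[of "\<one>\<^sub>c" "\<one>\<^sub>c" "idn A \<one>\<^sub>c" c d] by simp
  qed
  ultimately show ?thesis by (simp add: wlin_def)
qed

lemma wlin_contract:
  assumes "wlin U U \<Lambda>" "([], e, w) \<in> whom [] w" "(w, d, []) \<in> whom w []" "wob w" "wob U"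
  shows "wlin (w @ U) (w @ U) (\<lambda>\<phi>. \<Lambda> (contract w e d U \<phi>))"
proof -
  have d: "pad [] (w, d, []) U \<in> whom (w @ U) U" and e: "pad [] ([], e, w) U \<in> whom U (w @ U)"
    using whom_pad[OF assms(3), of "[]" U] whom_pad[OF assms(2), of "[]" U] assms by auto
  show ?thesis
    using wlin_cmp[OF wlin_cmp'[OF assms(1) e] d] by (simp add: contract_def)
qed

lemma wlin_itr: "wob (concat ws) \<Longrightarrow> wlin (concat ws) (concat ws) (itr ws)"
proof (induction ws)
  case Nil
  then show ?case using wlin_scalar by simp
next
  case (Cons w ws)
  then have w: "wob w" "wob (concat ws)" by auto
  show ?case
    unfolding itr_chosen concat.simps
    by (rule wlin_sum, rule wlin_contract)
      (use Cons w dual_bases_mem[OF chosen_bases[OF w(1)] w(1)] in auto)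
qed

text \<open>Both sides expand over the matrix entries \<open>d'\<^sub>j f e\<^sub>i\<close> of \<open>f\<close>.\<close>

lemma contract_cyclic:
  assumes b: "dual_bases A \<one>\<^sub>c (wprod A w) es ds" and b': "dual_bases A \<one>\<^sub>c (wprod A w') es' ds'"
    and f: "f \<in> whom w w'" and \<phi>: "\<phi> \<in> whom (w' @ U) (w @ U)" and lin: "wlin U U \<Lambda>"
    and w: "wob w" "wob w'" "wob U"
  shows "(\<Sum>i<length es. \<Lambda> (contract w (es ! i) (ds ! i) U (\<phi> \<star> pad [] f U)))
    = (\<Sum>j<length es'. \<Lambda> (contract w' (es' ! j) (ds' ! j) U (pad [] f U \<star> \<phi>)))"
proof -
  note wa = whomD(1)[OF f] whomD(1)[OF \<phi>] and st = whomD(2,3)[OF f] whomD(2,3)[OF \<phi>]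
  note m = dual_bases_mem[OF b w(1)] and m' = dual_bases_mem[OF b' w(2)]
  define c where "c i j = scalar A \<one>\<^sub>c (ds' ! j \<cdot> (wmor f \<cdot> es ! i))" for i j
  define t where "t i j = \<Lambda> (pad [] (w, ds ! i, []) U \<star> \<phi> \<star> pad [] ([], es' ! j, w') U)" for i j
  have fh: "wmor f \<in> Hm A (wprod A w) (wprod A w')" using warrD[OF wa(1)] st w by (simp add: hom_iff)
  have "\<Lambda> (contract w (es ! i) (ds ! i) U (\<phi> \<star> pad [] f U)) = (\<Sum>j<length es'. c i j * t i j)"
    if i: "i < length es" for i
  proof -
    have d: "pad [] (w, ds ! i, []) U \<in> whom (w @ U) U"
      using whom_pad[OF m(2)[OF i], of "[]" U] w by simp
    let ?\<Lambda> = "\<lambda>g. \<Lambda> ((pad [] (w, ds ! i, []) U \<star> \<phi>) \<star> pad [] g U)"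
    have l: "wlin [] w' ?\<Lambda>"
      using wlin_pad[of "[]" "[]" U w' "\<lambda>g. \<Lambda> ((pad [] (w, ds ! i, []) U \<star> \<phi>) \<star> g)"]
        wlin_cmp[OF lin whom_cmp[OF \<phi> d]] w by simp
    have fe: "wmor f \<cdot> es ! i \<in> Hm A \<one>\<^sub>c (wprod A w')"
      using cmp_closed[OF _ _ _ m(3)[OF i] fh] w by simp
    have "wmor f \<cdot> es ! i = hsum A \<one>\<^sub>c (wprod A w') (map (\<lambda>j. c i j \<odot>\<^sub>h es' ! j) [0..<length es'])"
      unfolding c_def by (rule dual_bases_expand(1)[OF unt_S wprod_ob[OF w(2)] b' fe])
    then have "?\<Lambda> ([], wmor f \<cdot> es ! i, w') = (\<Sum>j<length es'. c i j * ?\<Lambda> ([], es' ! j, w'))"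
      using m'(3) w by (intro wlin_expand[OF l]) auto
    moreover have "contract w (es ! i) (ds ! i) U (\<phi> \<star> pad [] f U)
        = (pad [] (w, ds ! i, []) U \<star> \<phi>) \<star> pad [] (f \<star> ([], es ! i, w)) U"
      using whomD[OF m(1)[OF i]] whomD[OF m(2)[OF i]] wa st w
      by (simp add: contract_def wcmp_assoc pad_cmp)
    moreover have "f \<star> ([], es ! i, w) = ([], wmor f \<cdot> es ! i, w')"
      using st by (intro word_mor_eqI) auto
    ultimately show ?thesis by (simp add: t_def)
  qed
  moreover have "\<Lambda> (contract w' (es' ! j) (ds' ! j) U (pad [] f U \<star> \<phi>)) = (\<Sum>i<length es. c i j * t i j)"
    if j: "j < length es'" for j
  proof -
    have e: "pad [] ([], es' ! j, w') U \<in> whom U (w' @ U)"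
      using whom_pad[OF m'(1)[OF j], of "[]" U] w by simp
    let ?\<Lambda> = "\<lambda>g. \<Lambda> (pad [] g U \<star> (\<phi> \<star> pad [] ([], es' ! j, w') U))"
    have l: "wlin w [] ?\<Lambda>"
      using wlin_pad[of "[]" w U "[]" "\<lambda>g. \<Lambda> (g \<star> (\<phi> \<star> pad [] ([], es' ! j, w') U))"]
        wlin_cmp'[OF lin whom_cmp[OF e \<phi>]] w by simp
    have df: "ds' ! j \<cdot> wmor f \<in> Hm A (wprod A w) \<one>\<^sub>c"
      using cmp_closed[OF _ _ _ fh m'(4)[OF j]] w by simp
    have "(ds' ! j \<cdot> wmor f) \<cdot> es ! i = ds' ! j \<cdot> (wmor f \<cdot> es ! i)" if "i < length es" for i
      using cmp_assoc[OF _ _ _ _ m(3)[OF that] fh m'(4)[OF j]] w by simp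
    then have eq: "map (\<lambda>i. scalar A \<one>\<^sub>c ((ds' ! j \<cdot> wmor f) \<cdot> es ! i) \<odot>\<^sub>h ds ! i) [0..<length es]
        = map (\<lambda>i. c i j \<odot>\<^sub>h ds ! i) [0..<length es]"
      by (intro map_cong[OF refl]) (simp add: c_def)
    have "ds' ! j \<cdot> wmor f = hsum A (wprod A w) \<one>\<^sub>c (map (\<lambda>i. c i j \<odot>\<^sub>h ds ! i) [0..<length es])"
      by (rule dual_bases_expand(2)[OF unt_S wprod_ob[OF w(1)] b df, unfolded eq])
    then have "?\<Lambda> (w, ds' ! j \<cdot> wmor f, []) = (\<Sum>i<length es. c i j * ?\<Lambda> (w, ds ! i, []))"
      using m(4) w by (intro wlin_expand[OF l]) auto
    moreover have "contract w' (es' ! j) (ds' ! j) U (pad [] f U \<star> \<phi>)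
        = pad [] ((w', ds' ! j, []) \<star> f) U \<star> (\<phi> \<star> pad [] ([], es' ! j, w') U)"
      using whomD[OF m'(1)[OF j]] whomD[OF m'(2)[OF j]] wa st w
      by (simp add: contract_def wcmp_assoc pad_cmp)
    moreover have "(w', ds' ! j, []) \<star> f = (w, ds' ! j \<cdot> wmor f, [])"
      using st by (intro word_mor_eqI) auto
    moreover have "?\<Lambda> (w, ds ! i, []) = t i j" if "i < length es" for i
      using whomD[OF m'(1)[OF j]] whomD[OF m(2)[OF that]] wa st w by (simp add: t_def wcmp_assoc)
    ultimately show ?thesis by simp
  qed
  ultimately show ?thesis by (simp add: sum.swap[of _ "{..<length es'}"])
qed

text \<open>Independence of the basis: \<open>contract_cyclic\<close> for the identity of
  \<open>w\<close>, with the chosen dual bases on one side and arbitrary ones on the other.\<close>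

lemma itr_Cons:
  assumes "dual_bases A \<one>\<^sub>c (wprod A w) es ds" "wob w" "wob (concat ws)"
    "\<phi> \<in> whom (w @ concat ws) (w @ concat ws)"
  shows "itr (w # ws) \<phi> = (\<Sum>i<length es. itr ws (contract w (es ! i) (ds ! i) (concat ws) \<phi>))"
proof -
  have i: "wid A w \<in> whom w w" using assms by (simp add: whom_def)
  show ?thesis
    using contract_cyclic[OF chosen_bases assms(1) i assms(4) wlin_itr] assms whomD[OF assms(4)]
    by (simp add: itr_chosen)
qed

text \<open>The factors before \<open>w\<close> are contracted first. These contractions act at
  other positions and commute with \<open>f\<close>, which leaves the case where the factor is the
  leading one.\<close>

lemma itr_cyclic:
  assumes "f \<in> whom w w'" "wob (concat ls)" "wob (concat ws)" "wob w" "wob w'"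
    "\<phi> \<in> whom (concat ls @ w' @ concat ws) (concat ls @ w @ concat ws)"
  shows "itr (ls @ w # ws) (\<phi> \<star> pad (concat ls) f (concat ws))
       = itr (ls @ w' # ws) (pad (concat ls) f (concat ws) \<star> \<phi>)"
  using assms(2,6)
proof (induction ls arbitrary: \<phi>)
  case Nil
  then show ?case
    using contract_cyclic[OF chosen_bases chosen_bases assms(1) _ wlin_itr] assms
    by (simp add: itr_chosen)
next
  case (Cons v ls)
  then have v: "wob v" "wob (concat ls)" by auto
  let ?L = "concat ls" and ?U = "concat ws"
  note wa = whomD(1)[OF assms(1)] whomD(1)[OF Cons.prems(2)]
    and st = whomD(2,3)[OF assms(1)] whomD(2,3)[OF Cons.prems(2)]
  have "itr (ls @ w # ws) (contract v e d (?L @ w @ ?U) (\<phi> \<star> pad (v @ ?L) f ?U))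
      = itr (ls @ w' # ws) (contract v e d (?L @ w' @ ?U) (pad (v @ ?L) f ?U \<star> \<phi>))"
    if e: "([], e, v) \<in> whom [] v" and d: "(v, d, []) \<in> whom v []" for e d
  proof -
    let ?d = "\<lambda>U. pad [] (v, d, []) U" and ?e = "\<lambda>U. pad [] ([], e, v) U"
    note wed = whomD[OF e] whomD[OF d]
    let ?\<psi> = "?d (?L @ w @ ?U) \<star> (\<phi> \<star> ?e (?L @ w' @ ?U))"
    have \<psi>: "?\<psi> \<in> whom (?L @ w' @ ?U) (?L @ w @ ?U)"
      using wed wa st v assms by (simp add: whom_def)
    have 1: "?e (?L @ w' @ ?U) \<star> pad ?L f ?U = pad (v @ ?L) f ?U \<star> ?e (?L @ w @ ?U)"
      using exchange[of "([], e, v)" f "[]" ?L ?U] wed wa st v assms by simp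
    have 2: "pad ?L f ?U \<star> ?d (?L @ w @ ?U) = ?d (?L @ w' @ ?U) \<star> pad (v @ ?L) f ?U"
      using exchange[of "(v, d, [])" f "[]" ?L ?U] wed wa st v assms by simp
    have "contract v e d (?L @ w @ ?U) (\<phi> \<star> pad (v @ ?L) f ?U) = ?\<psi> \<star> pad ?L f ?U"
      using wed wa st v assms by (simp add: contract_def wcmp_assoc 1)
    moreover have "contract v e d (?L @ w' @ ?U) (pad (v @ ?L) f ?U \<star> \<phi>) = pad ?L f ?U \<star> ?\<psi>"
      using wed wa st v assms wcmp_rest[OF 2, of "\<phi> \<star> ?e (?L @ w' @ ?U)"]
      by (simp add: contract_def wcmp_assoc)
    ultimately show ?thesis using Cons.IH[OF v(2) \<psi>] by simp
  qed
  then show ?case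
    using dual_bases_mem[OF chosen_bases[OF v(1)] v(1)] by (simp add: itr_chosen)
qed

text \<open>Traces over different factors commute. The group of the new generator y is the last
  factor, while \<open>itr\<close> contracts from the left; here it is traced first, in a basis of
  one's choice.\<close>

lemma itr_snoc:
  assumes b: "dual_bases A \<one>\<^sub>c (wprod A v) es ds" and v: "wob v" and "wob (concat ws)"
    "\<phi> \<in> whom (concat ws @ v) (concat ws @ v)"
  shows "itr (ws @ [v]) \<phi> = (\<Sum>j<length es. itr ws
    (pad (concat ws) (v, ds ! j, []) [] \<star> \<phi> \<star> pad (concat ws) ([], es ! j, v) []))"
  using assms(3,4)
proof (induction ws arbitrary: \<phi>)
  case Nil
  then show ?case using itr_Cons[OF b v, of "[]" \<phi>] by (simp add: contract_def)
next
  case (Cons w ws)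
  then have w: "wob w" "wob (concat ws)" by auto
  let ?U = "concat ws" and ?es = "fst (chosen_bases w)" and ?ds = "snd (chosen_bases w)"
  note wa = whomD(1)[OF Cons.prems(2)] and st = whomD(2,3)[OF Cons.prems(2)]
  note m = dual_bases_mem[OF chosen_bases[OF w(1)] w(1)] and m' = dual_bases_mem[OF b v]
  have "itr ws (pad ?U (v, ds ! j, []) [] \<star> contract w (?es ! i) (?ds ! i) (?U @ v) \<phi> \<star> pad ?U ([], es ! j, v) [])
    = itr ws (contract w (?es ! i) (?ds ! i) ?U (pad (w @ ?U) (v, ds ! j, []) [] \<star> \<phi> \<star> pad (w @ ?U) ([], es ! j, v) []))"
    if i: "i < length ?es" and j: "j < length es" for i j
  proof -
    note wed = whomD[OF m(1)[OF i]] whomD[OF m(2)[OF i]] whomD[OF m'(1)[OF j]] whomD[OF m'(2)[OF j]]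
    have 1: "pad [] ([], ?es ! i, w) (?U @ v) \<star> pad ?U ([], es ! j, v) []
        = pad (w @ ?U) ([], es ! j, v) [] \<star> pad [] ([], ?es ! i, w) ?U"
      using exchange[of "([], ?es ! i, w)" "([], es ! j, v)" "[]" ?U "[]"] wed w by simp
    have 2: "pad ?U (v, ds ! j, []) [] \<star> pad [] (w, ?ds ! i, []) (?U @ v)
        = pad [] (w, ?ds ! i, []) ?U \<star> pad (w @ ?U) (v, ds ! j, []) []"
      using exchange[of "(w, ?ds ! i, [])" "(v, ds ! j, [])" "[]" ?U "[]"] wed w by simp
    show ?thesis
      using wed wa st w v wcmp_rest[OF 2, of "\<phi> \<star> (pad (w @ ?U) ([], es ! j, v) [] \<star> pad [] ([], ?es ! i, w) ?U)"]
      by (simp add: contract_def wcmp_assoc 1)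
  qed
  moreover have "itr (ws @ [v]) (contract w (?es ! i) (?ds ! i) (?U @ v) \<phi>) = (\<Sum>j<length es. itr ws
    (pad ?U (v, ds ! j, []) [] \<star> contract w (?es ! i) (?ds ! i) (?U @ v) \<phi> \<star> pad ?U ([], es ! j, v) []))"
    if i: "i < length ?es" for i
    using Cons.IH[OF w(2) whom_contract[OF m(1)[OF i] m(2)[OF i]]] Cons.prems w v by simp
  ultimately show ?case
    by (simp add: itr_chosen sum.swap[of _ "{..<length es}"])
qed

text \<open>\<open>traces\<close> leaves a letter \<open>\<one>\<close> in place of each traced factor, \<open>itr\<close> does not;
  the two are compared along \<open>unit_word\<close>.\<close>

definition unit_letter where "unit_letter = ([], idn A \<one>\<^sub>c, [\<one>\<^sub>c])"

primrec unit_word where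
  "unit_word 0 = wid A []"
| "unit_word (Suc j) = pad (replicate j \<one>\<^sub>c) unit_letter [] \<star> unit_word j"

lemma unit_letter_sel [simp]:
  "wsrc unit_letter = []" "wtgt unit_letter = [\<one>\<^sub>c]" "wmor unit_letter = idn A \<one>\<^sub>c"
  by (simp_all add: unit_letter_def)

lemma wiso_unit_letter [simp]: "wiso unit_letter" "warr unit_letter"
  unfolding wiso_def warr_def by simp_all

lemma wob_replicate [simp]: "wob (replicate j \<one>\<^sub>c)"
  by (auto simp: wob_def)

lemma wiso_unit_word [simp]:
  "wiso (unit_word j)" "warr (unit_word j)" "wsrc (unit_word j) = []" "wtgt (unit_word j) = replicate j \<one>\<^sub>c"
proof -
  have "wiso (unit_word j) \<and> wsrc (unit_word j) = [] \<and> wtgt (unit_word j) = replicate j \<one>\<^sub>c"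
    by (induction j) (simp_all add: replicate_append_same)
  then show "wiso (unit_word j)" "warr (unit_word j)" "wsrc (unit_word j) = []" "wtgt (unit_word j) = replicate j \<one>\<^sub>c"
    by (auto simp: wiso_warr)
qed

text \<open>\<open>scalar\<close> is meaningful only where endomorphisms are unique multiples of the
  identity. For a word isomorphic to the empty one, both existence and uniqueness of the multiple
  are transported from F(1, 1).\<close>

lemma scalar_conjugate:
  assumes "u \<in> whom [] xs" "wiso u" "\<phi> \<in> whom xs xs"
  shows "scalar A (wprod A xs) (wmor \<phi>) = scalar A \<one>\<^sub>c (wmor (winv A u \<star> \<phi> \<star> u))"
proof -
  note a = whomD[OF assms(1)] whomD[OF assms(3)]
  have xs: "wob xs" using warrD(2)[OF a(1)] a by simp
  let ?v = "winv A u"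
  have v: "?v \<in> whom xs []" using a assms(2) by (simp add: whom_def)
  define c where "c = scalar A \<one>\<^sub>c (wmor (?v \<star> \<phi> \<star> u))"
  have conj: "?v \<star> wscl A e (wid A xs) \<star> u = wscl A e (wid A [])" for e
  proof -
    have i: "wid A xs \<in> whom xs xs" using xs by (simp add: whom_def)
    have "?v \<star> wscl A e (wid A xs) \<star> u = wscl A e (?v \<star> u)"
      using wcmp_wscl(1)[OF i v, of e] wcmp_wscl(2)[OF v assms(1), of e] a v[THEN whomD(1)] xs by simp
    then show ?thesis using assms(2) a by simp
  qed
  have "?v \<star> \<phi> \<star> u = wscl A c (wid A [])"
  proof (rule word_mor_eqI)
    have "?v \<star> \<phi> \<star> u \<in> whom [] []" using assms v by (auto intro: whom_cmp)
    then have "wmor (?v \<star> \<phi> \<star> u) \<in> Hm A \<one>\<^sub>c \<one>\<^sub>c"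
      unfolding whom_def warr_def by (auto simp: hom_iff)
    then show "wmor (?v \<star> \<phi> \<star> u) = wmor (wscl A c (wid A []))"
      unfolding c_def using scalar_eq[OF unt_S] by simp
  qed (use a in simp_all)
  moreover have "u \<star> (?v \<star> \<phi> \<star> u) \<star> ?v = \<phi>"
    using a v[THEN whomD(1)] assms(2) wcmp_rest[OF wiso_winv(4)[OF assms(2)], of "\<phi>"] by (simp add: wcmp_assoc)
  moreover have "u \<star> wscl A c (wid A []) \<star> ?v = wscl A c (wid A xs)"
    using wcmp_wscl(1)[of "wid A []" "[]" "[]" u xs c] wcmp_wscl(2)[OF assms(1) v, of c] a assms
    by (simp add: whom_def)
  ultimately have \<phi>: "\<phi> = wscl A c (wid A xs)" by simp
  have "scalar A (wprod A xs) (wmor \<phi>) = c"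
    unfolding scalar_def
  proof (rule the_equality)
    show "wmor \<phi> = c \<odot>\<^sub>h idn A (wprod A xs)" by (simp add: \<phi>)
    fix e assume "wmor \<phi> = e \<odot>\<^sub>h idn A (wprod A xs)"
    then have "wscl A c (wid A xs) = wscl A e (wid A xs)"
      using \<phi> by (intro word_mor_eqI) simp_all
    then have "wscl A c (wid A []) = wscl A e (wid A [])" using conj by metis
    then show "e = c" using scl_inj[OF unt_S, of c e] by (simp add: wid_def)
  qed
  then show ?thesis by (simp add: c_def)
qed

text \<open>Here the chosen bases are read as morphisms from and to the one-letter word
  \<open>[\<one>\<^sub>c]\<close>, in \<open>contract\<close> as morphisms from and to
  \<open>[]\<close>; the two words have the same product, so the underlying morphisms are
  identical.\<close>

lemma partial_trace_unit:
  assumes "wob us" "wob w" "wob vs" "\<phi> \<in> whom (us @ w @ vs) (us @ w @ vs)"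
  defines "es \<equiv> fst (chosen_bases w)" and "ds \<equiv> snd (chosen_bases w)"
    and "W \<equiv> us @ [\<one>\<^sub>c] @ vs"
  shows "partial_trace A us w \<one>\<^sub>c vs \<phi> = (W, hsum A (wprod A W) (wprod A W)
      (map (\<lambda>i. wmor (pad us (w, ds ! i, [\<one>\<^sub>c]) vs \<star> \<phi> \<star> pad us ([\<one>\<^sub>c], es ! i, w) vs)) [0..<length es]), W)"
proof -
  have b: "dual_bases A \<one>\<^sub>c (wprod A w) es ds" using chosen_bases assms by simp
  then have len: "length ds = length es" by (simp add: dual_bases_def)
  have z: "map F (zip es ds) = map (\<lambda>i. F (es ! i, ds ! i)) [0..<length es]" for F :: "_ \<Rightarrow> 'm"
    using len by (intro nth_equalityI) simp_all
  have m: "wid A us \<diamondop> (w, ds ! i, [\<one>\<^sub>c]) \<diamondop> wid A vs = pad us (w, ds ! i, [\<one>\<^sub>c]) vs"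
    "wid A us \<diamondop> ([\<one>\<^sub>c], es ! i, w) \<diamondop> wid A vs = pad us ([\<one>\<^sub>c], es ! i, w) vs"
    if "i < length es" for i
  proof -
    have "warr (w, ds ! i, [\<one>\<^sub>c])" "warr ([\<one>\<^sub>c], es ! i, w)"
      using dual_bases_mem(3,4)[OF b assms(2) that] assms(2) unfolding warr_def by (auto simp: hom_iff)
    then show "wid A us \<diamondop> (w, ds ! i, [\<one>\<^sub>c]) \<diamondop> wid A vs = pad us (w, ds ! i, [\<one>\<^sub>c]) vs"
      "wid A us \<diamondop> ([\<one>\<^sub>c], es ! i, w) \<diamondop> wid A vs = pad us ([\<one>\<^sub>c], es ! i, w) vs"
      using assms by (simp_all add: pad_def wten_assoc)
  qed
  have "(SOME (es, ds). dual_bases A \<one>\<^sub>c (wprod A w) es ds) = (es, ds)"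
    by (simp add: es_def ds_def chosen_bases_def)
  then show ?thesis
    unfolding partial_trace_def
    by (simp add: z Let_def W_def del: wcmp_sel)
      (intro arg_cong[of _ _ "hsum A (wprod A (us @ \<one>\<^sub>c # vs)) (wprod A (us @ \<one>\<^sub>c # vs))"]
        map_cong[OF refl], simp add: m del: wcmp_sel)
qed

text \<open>\<open>j\<close> counts the factors traced so far, each represented by a letter
  \<open>\<one>\<^sub>c\<close>. The statement is needed for all \<open>j\<close> because each trace
  turns \<open>j\<close> into \<open>Suc j\<close>.\<close>

lemma traces_itr:
  assumes "wob (concat ws)" "\<phi> \<in> whom (replicate j \<one>\<^sub>c @ concat ws) (replicate j \<one>\<^sub>c @ concat ws)"
  shows "scalar A (wprod A (replicate (j + length ws) \<one>\<^sub>c))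
      (wmor (traces A (replicate j \<one>\<^sub>c) (map (\<lambda>w. (w, \<one>\<^sub>c)) ws) \<phi>))
    = itr ws (pad [] (winv A (unit_word j)) (concat ws) \<star> \<phi> \<star> pad [] (unit_word j) (concat ws))"
  using assms
proof (induction ws arbitrary: j \<phi>)
  case Nil
  have "unit_word j \<in> whom [] (replicate j \<one>\<^sub>c)" by (simp add: whom_def)
  from scalar_conjugate[OF this] Nil show ?case by simp
next
  case (Cons w ws)
  then have w: "wob w" "wob (concat ws)" by auto
  let ?u = "replicate j \<one>\<^sub>c" and ?U = "concat ws" and ?W = "replicate j \<one>\<^sub>c @ [\<one>\<^sub>c] @ concat ws"
  let ?es = "fst (chosen_bases w)" and ?ds = "snd (chosen_bases w)"
  let ?t = "unit_word j" and ?t' = "unit_word (Suc j)"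
  note m = dual_bases_mem[OF chosen_bases[OF w(1)] w(1)]
  note wa = whomD(1)[OF Cons.prems(2)] and st = whomD(2,3)[OF Cons.prems(2)]
  define \<Phi> where "\<Phi> i = pad ?u (w, ?ds ! i, [\<one>\<^sub>c]) ?U \<star> \<phi> \<star> pad ?u ([\<one>\<^sub>c], ?es ! i, w) ?U" for i
  have l: "warr (w, ?ds ! i, [\<one>\<^sub>c])" "warr ([\<one>\<^sub>c], ?es ! i, w)" if "i < length ?es" for i
    using m(3,4)[OF that] w unfolding warr_def by (auto simp: hom_iff)
  have \<Phi>: "\<Phi> i \<in> whom ?W ?W" if "i < length ?es" for i
    using l[OF that] wa st w by (simp add: \<Phi>_def whom_def)
  have \<Phi>h: "wmor (\<Phi> i) \<in> Hm A (wprod A ?W) (wprod A ?W)" if "i < length ?es" for i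
    using \<Phi>[OF that] unfolding whom_def warr_def by (auto simp: hom_iff)
  have pt: "partial_trace A ?u w \<one>\<^sub>c ?U \<phi> = (?W, hsum A (wprod A ?W) (wprod A ?W) (map (\<lambda>i. wmor (\<Phi> i)) [0..<length ?es]), ?W)"
    unfolding \<Phi>_def by (rule partial_trace_unit) (use w Cons.prems in auto)
  have W: "?W = replicate (Suc j) \<one>\<^sub>c @ ?U" by (simp add: replicate_append_same flip: append_assoc)
  have ptw: "partial_trace A ?u w \<one>\<^sub>c ?U \<phi> \<in> whom (replicate (Suc j) \<one>\<^sub>c @ ?U) (replicate (Suc j) \<one>\<^sub>c @ ?U)"
    unfolding pt W[symmetric] using w \<Phi>h by (intro whom_word hsum_closed) auto
  have tt: "pad [] ?t' ?U \<in> whom ?U ?W" "pad [] (winv A ?t') ?U \<in> whom ?W ?U"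
    using w wiso_unit_word[of "Suc j"] unfolding W by (auto simp: whom_def simp del: unit_word.simps)
  have lin: "wlin ?W ?W (\<lambda>f. itr ws (pad [] (winv A ?t') ?U \<star> f \<star> pad [] ?t' ?U))"
    by (rule wlin_cmp[OF wlin_cmp'[OF wlin_itr[OF w(2)] tt(1)] tt(2)])
  \<comment> \<open>Stripping the newest unit letter turns the basis morphisms of
    \<open>partial_trace\<close> into those of \<open>contract\<close>; the older unit letters
    commute with them by \<open>exchange\<close>.\<close>
  have sl: "itr ws (pad [] (winv A ?t') ?U \<star> \<Phi> i \<star> pad [] ?t' ?U)
    = itr ws (contract w (?es ! i) (?ds ! i) ?U
        (pad [] (winv A ?t) (w @ ?U) \<star> \<phi> \<star> pad [] ?t (w @ ?U)))"
    if i: "i < length ?es" for i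
  proof -
    note l' = l[OF i] whomD[OF m(1)[OF i]] whomD[OF m(2)[OF i]]
    have d0: "winv A unit_letter \<star> (w, ?ds ! i, [\<one>\<^sub>c]) = (w, ?ds ! i, [])"
      using m(4)[OF i] w by (intro word_mor_eqI) (simp_all add: hom_iff)
    have e0: "([\<one>\<^sub>c], ?es ! i, w) \<star> unit_letter = ([], ?es ! i, w)"
      using m(3)[OF i] w by (intro word_mor_eqI) (simp_all add: hom_iff)
    have d1: "pad ?u (winv A unit_letter) ?U \<star> pad ?u (w, ?ds ! i, [\<one>\<^sub>c]) ?U = pad ?u (w, ?ds ! i, []) ?U"
      using pad_eq[OF d0, of ?u ?U] l' w by simp
    have e1: "pad ?u ([\<one>\<^sub>c], ?es ! i, w) ?U \<star> pad ?u unit_letter ?U = pad ?u ([], ?es ! i, w) ?U"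
      using pad_eq[OF e0, of ?u ?U] l' w by simp
    have d2: "pad [] (winv A ?t) ?U \<star> pad ?u (w, ?ds ! i, []) ?U
        = pad [] (w, ?ds ! i, []) ?U \<star> pad [] (winv A ?t) (w @ ?U)"
      using exchange[of "winv A ?t" "(w, ?ds ! i, [])" "[]" "[]" ?U] l' w by simp
    have e2: "pad ?u ([], ?es ! i, w) ?U \<star> pad [] ?t ?U
        = pad [] ?t (w @ ?U) \<star> pad [] ([], ?es ! i, w) ?U"
      using exchange[of ?t "([], ?es ! i, w)" "[]" "[]" ?U] l' w by simp
    have s: "pad [] ?t' ?U = pad ?u unit_letter ?U \<star> pad [] ?t ?U"
      "pad [] (winv A ?t') ?U = pad [] (winv A ?t) ?U \<star> pad ?u (winv A unit_letter) ?U"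
      using w by (simp_all add: pad_cmp)
    show ?thesis
      unfolding s \<Phi>_def contract_def using l' w wa st
      by (simp add: wcmp_assoc wcmp_rest[OF d1] wcmp_rest[OF e1] wcmp_rest[OF d2] e2)
  qed
  have "scalar A (wprod A (replicate (j + length (w # ws)) \<one>\<^sub>c))
      (wmor (traces A ?u (map (\<lambda>w. (w, \<one>\<^sub>c)) (w # ws)) \<phi>))
    = scalar A (wprod A (replicate (Suc j + length ws) \<one>\<^sub>c))
      (wmor (traces A (replicate (Suc j) \<one>\<^sub>c) (map (\<lambda>w. (w, \<one>\<^sub>c)) ws) (partial_trace A ?u w \<one>\<^sub>c ?U \<phi>)))"
    by (simp add: replicate_append_same comp_def)
  also have "\<dots> = itr ws (pad [] (winv A ?t') ?U \<star> partial_trace A ?u w \<one>\<^sub>c ?U \<phi> \<star> pad [] ?t' ?U)"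
    by (rule Cons.IH[OF w(2) ptw])
  also have "\<dots> = (\<Sum>i<length ?es. itr ws (pad [] (winv A ?t') ?U \<star> \<Phi> i \<star> pad [] ?t' ?U))"
  proof -
    have "(?W, wmor (\<Phi> i), ?W) = \<Phi> i" if "i < length ?es" for i
      using \<Phi>[OF that, THEN whomD(2)] \<Phi>[OF that, THEN whomD(3)] by (intro word_mor_eqI) simp_all
    then show ?thesis unfolding pt using wlin_hsum[OF lin _ _ \<Phi>h] w by simp
  qed
  also have "\<dots> = itr (w # ws) (pad [] (winv A ?t) (w @ ?U) \<star> \<phi> \<star> pad [] ?t (w @ ?U))"
    unfolding itr_chosen by (rule sum.cong) (use sl in auto)
  finally show ?case by simp
qed

subsection \<open>The rank and the dual bases of \<open>c \<diamond> c*\<close>\<close>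

lemma wscl_wscl: "warr f \<Longrightarrow> wscl A c (wscl A e f) = wscl A (c * e) f"
  using scl_scl[OF arr_hom, of "wmor f" c e] warrD(3)[of f] by (intro word_mor_eqI) simp_all

lemma wscl_one: "warr f \<Longrightarrow> wscl A 1 f = f"
  using scl_one[OF arr_hom, of "wmor f"] warrD(3)[of f] by (intro word_mor_eqI) simp_all

lemma wcoev_whom: "b \<in> Ob A \<Longrightarrow> wcoev A b \<in> whom [] [dua A b, b]"
  by (simp add: whom_def)

lemma wev_whom: "b \<in> Ob A \<Longrightarrow> wev A b \<in> whom [b, dua A b] []"
  by (simp add: whom_def)

lemma endo_simple:
  assumes "b \<in> S" "f \<in> whom [b] [b]"
  shows "\<exists>t. f = wscl A t (wid A [b])"
proof -
  have "wmor f \<in> Hm A b b" using assms unfolding whom_def warr_def by (auto simp: hom_iff)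
  then obtain t where "wmor f = t \<odot>\<^sub>h idn A b" using S_simple[OF assms(1)] by auto
  then show ?thesis using assms(2) by (intro exI word_mor_eqI) (auto simp: whom_def)
qed

lemma wid_whom: "wob xs \<Longrightarrow> wid A xs \<in> whom xs xs"
  by (simp add: whom_def)

text \<open>Bending the dual letter identifies F(1, b* b) with F(b, b) = K. The coefficient is the
  scalar of the endomorphism obtained by closing \<open>e\<close> against the counit.\<close>

lemma hom_unit_coev:
  assumes b: "b \<in> S" and e: "e \<in> whom [] [dua A b, b]"
  shows "\<exists>t. e = wscl A t (wcoev A b)"
proof -
  define d where "d = dua A b"
  have [simp]: "b \<in> Ob A" "d \<in> Ob A" "dua A b = d" using b by (simp_all add: d_def)
  have we [simp]: "warr e" "wsrc e = []" "wtgt e = [d, b]" using e by (simp_all add: whom_def)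
  let ?f = "pad [] (wev A b) [b] \<star> pad [b] e []"
  have "?f \<in> whom [b] [b]" by (simp add: whom_def)
  then obtain t where t: "?f = wscl A t (wid A [b])" using endo_simple[OF b] by blast
  have z: "pad [d] (wev A b) [b] \<star> pad [] (wcoev A b) [d, b] = wid A [d, b]"
    using pad_eq[OF wzigzag_dual[of b], of "[]" "[b]"] by simp
  have "e = pad [d] (wev A b) [b] \<star> (pad [] (wcoev A b) [d, b] \<star> e)"
    by (simp add: wcmp_rest[OF z])
  also have "\<dots> = pad [d] (wev A b) [b] \<star> (pad [d, b] e [] \<star> wcoev A b)"
    using exchange[of "wcoev A b" e "[]" "[]" "[]"] by simp
  also have "\<dots> = pad [d] ?f [] \<star> wcoev A b"
    by (simp add: pad_cmp wcmp_assoc)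
  also have "\<dots> = wscl A t (wid A [d, b]) \<star> wcoev A b"
    unfolding t using pad_wscl[OF wid_whom[of "[b]"], of "[d]" "[]" t] by simp
  also have "\<dots> = wscl A t (wcoev A b)"
    using wcmp_wscl(2)[OF wid_whom[of "[d, b]"], of "wcoev A b" "[]" t] by (simp add: whom_def)
  finally show ?thesis by blast
qed

lemma hom_ev_unit:
  assumes b: "b \<in> S" and g: "g \<in> whom [dua A b, b] []"
  shows "\<exists>s. g = wscl A s (wev A (dua A b))"
proof -
  define d where "d = dua A b"
  have [simp]: "b \<in> Ob A" "d \<in> Ob A" "dua A b = d" "dua A d = b" using b by (simp_all add: d_def)
  have wg [simp]: "warr g" "wtgt g = []" "wsrc g = [d, b]" using g by (simp_all add: whom_def)
  let ?f = "pad [b] g [] \<star> pad [] (wcoev A d) [b]"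
  have "?f \<in> whom [b] [b]" by (simp add: whom_def)
  then obtain s where s: "?f = wscl A s (wid A [b])" using endo_simple[OF b] by blast
  have z: "pad [] (wev A d) [d, b] \<star> pad [d] (wcoev A d) [b] = wid A [d, b]"
    using pad_eq[OF wzigzag[of d], of "[]" "[b]"] by simp
  have "g = g \<star> (pad [] (wev A d) [d, b] \<star> pad [d] (wcoev A d) [b])"
    by (simp add: z)
  also have "\<dots> = wev A d \<star> (pad [d, b] g [] \<star> pad [d] (wcoev A d) [b])"
    using exchange_rest[of "wev A d" g "[]" "[]" "[]" "pad [d] (wcoev A d) [b]"] by simp
  also have "\<dots> = wev A d \<star> pad [d] ?f []"
    by (simp add: pad_cmp wcmp_assoc)
  also have "\<dots> = wev A d \<star> wscl A s (wid A [d, b])"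
    unfolding s using pad_wscl[OF wid_whom[of "[b]"], of "[d]" "[]" s] by simp
  also have "\<dots> = wscl A s (wev A d)"
    using wcmp_wscl(1)[OF wid_whom[of "[d, b]"], of "wev A d" "[]" s] by (simp add: whom_def)
  finally show ?thesis by auto
qed

lemma ev_coev_rank: "b \<in> S \<Longrightarrow> wev A (dua A b) \<star> wcoev A b = wscl A (rank A b) (wid A [])"
proof -
  assume b: "b \<in> S"
  have "wev A (dua A b) \<star> wcoev A b \<in> whom [] []"
    using b by (simp add: whom_def)
  then have "ev A (dua A b) \<cdot> coev A b \<in> Hm A \<one>\<^sub>c \<one>\<^sub>c"
    unfolding whom_def warr_def by (auto simp: hom_iff)
  then show ?thesis
    unfolding rank_def using scalar_eq[OF unt_S] b by (intro word_mor_eqI) simp_all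
qed

text \<open>Stability makes the two loops of \<open>c\<close> agree: a crossing inserted between cup
  and cap turns one into the other.\<close>

lemma ev_coev_rank': "c \<in> S \<Longrightarrow> wev A c \<star> wcoev A (dua A c) = wscl A (rank A c) (wid A [])"
proof -
  assume c: "c \<in> S"
  have "wev A c \<star> wcoev A (dua A c) = (wev A c \<star> wsym A [dua A c] [c]) \<star> wcoev A c"
    using c by (simp add: wcmp_assoc wsym_wcoev)
  then show ?thesis using c ev_coev_rank by (simp add: wev_wsym)
qed

text \<open>Nondegeneracy of dual bases: F(1, b* b) is spanned by the unit and the opposite space by
  the counit. A basis vector pairs with its dual vector to 1, while the pairing is a multiple of
  counit after unit, which is r(b).\<close>

lemma rank_nonzero:
  assumes b: "b \<in> S" shows "rank A b \<noteq> 0"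
proof
  assume r: "rank A b = 0"
  define d where "d = dua A b"
  have [simp]: "b \<in> Ob A" "d \<in> Ob A" "dua A b = d" "dua A d = b" using b by (simp_all add: d_def)
  obtain es ds where db: "dual_bases A \<one>\<^sub>c (wprod A [d, b]) es ds"
    using dual_bases_exist[OF unt_S, of "wprod A [d, b]"] by auto
  \<comment> \<open>With an empty basis the unit would vanish, and by the zigzag so would the
    identity of \<open>b\<close>.\<close>
  have "es \<noteq> []"
  proof
    assume "es = []"
    then have z: "f = zer A \<one>\<^sub>c (wprod A [d, b])" if "f \<in> Hm A \<one>\<^sub>c (wprod A [d, b])" for f
      using dual_bases_expand(1)[OF unt_S _ db that] by simp
    have "coev A b \<in> Hm A \<one>\<^sub>c (wprod A [d, b])" "0 \<odot>\<^sub>h coev A b \<in> Hm A \<one>\<^sub>c (wprod A [d, b])"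
      by (simp_all add: hom_iff)
    from this[THEN z] have "0 \<odot>\<^sub>h coev A b = coev A b" by (simp only:)
    then have c: "wscl A 0 (wcoev A b) = wcoev A b" by (intro word_mor_eqI) simp_all
    have "wid A [b] = pad [] (wev A b) [b] \<star> pad [b] (wscl A 0 (wcoev A b)) []"
      using wzigzag[of b] by (simp add: c)
    also have "\<dots> = wscl A 0 (pad [] (wev A b) [b] \<star> pad [b] (wcoev A b) [])"
      using pad_wscl[OF wcoev_whom[of b], of "[b]" "[]" 0]
        wcmp_wscl(1)[OF whom_pad[OF wcoev_whom[of b], of "[b]" "[]"], of "pad [] (wev A b) [b]" "[b]" 0]
      by (simp add: whom_def)
    also have "\<dots> = wscl A 0 (wid A [b])" using wzigzag[of b] by simp
    finally have "wscl A 1 (wid A [b]) = wscl A 0 (wid A [b])"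
      by (simp add: wscl_one)
    then show False using scl_inj[OF b, of 1 0] by (simp add: wid_def)
  qed
  then have n: "0 < length es" by simp
  note m = dual_bases_mem[OF db _ n]
  obtain s t where st: "([], es ! 0, [d, b]) = wscl A t (wcoev A b)" "([d, b], ds ! 0, []) = wscl A s (wev A d)"
    using hom_unit_coev[OF b, of "([], es ! 0, [d, b])"] hom_ev_unit[OF b, of "([d, b], ds ! 0, [])"] m(1,2)
    by auto
  have "wid A [] = ([d, b], ds ! 0, []) \<star> ([], es ! 0, [d, b])"
    using db n by (intro word_mor_eqI) (simp_all add: dual_bases_def)
  also have "\<dots> = wscl A (t * (s * rank A b)) (wid A [])"
    unfolding st using wcmp_wscl(1)[OF wcoev_whom, of b "wscl A s (wev A d)" "[]" t]
      wcmp_wscl(2)[OF wev_whom, of d "wcoev A b" "[]" s] ev_coev_rank[OF b]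
    by (simp add: whom_def wscl_wscl mult.assoc)
  finally have "wscl A 1 (wid A []) = wscl A 0 (wid A [])" using r by (simp add: wscl_one)
  then show False using scl_inj[OF unt_S, of 1 0] by (simp add: wid_def)
qed

text \<open>Both spaces are one-dimensional, and counit after unit is r(c), which dictates the
  normalisation. The factor \<open>inverse (rank A c)\<close> is going to cancel the r(c) built into
  [R, c].\<close>

lemma coev_ev_dual_bases:
  assumes c: "c \<in> S"
  shows "dual_bases A \<one>\<^sub>c (wprod A [c, dua A c]) [coev A (dua A c)] [inverse (rank A c) \<odot>\<^sub>h ev A c]"
proof (rule dual_basesI[OF unt_S, of _ _ 1])
  define d where "d = dua A c"
  have S: "d \<in> S" "dua A d = c" using c dua_S by (simp_all add: d_def)
  have [simp]: "c \<in> Ob A" "d \<in> Ob A" "dua A c = d" "dua A d = c" using c by (simp_all add: d_def)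
  let ?r = "rank A c"
  have r: "?r \<noteq> 0" by (rule rank_nonzero[OF c])
  have mor: "ev A c \<cdot> coev A d = ?r \<odot>\<^sub>h idn A \<one>\<^sub>c"
    using arg_cong[OF ev_coev_rank'[OF c], of "\<lambda>x. wmor x"] by simp
  show "wprod A [c, dua A c] \<in> Ob A" by simp
  show "i < 1 \<Longrightarrow> [coev A (dua A c)] ! i \<in> Hm A \<one>\<^sub>c (wprod A [c, dua A c])"
    "i < 1 \<Longrightarrow> [inverse ?r \<odot>\<^sub>h ev A c] ! i \<in> Hm A (wprod A [c, dua A c]) \<one>\<^sub>c" for i
    by (simp_all add: hom_iff)
  have one: "(inverse ?r \<odot>\<^sub>h ev A c) \<cdot> coev A d = idn A \<one>\<^sub>c"
    using r by (simp add: cmp_scl mor scl_scl[of "\<one>\<^sub>c" "\<one>\<^sub>c"] scl_one[of "\<one>\<^sub>c" "\<one>\<^sub>c"] idn_closed)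
  then show "i < 1 \<Longrightarrow> j < 1 \<Longrightarrow> [inverse ?r \<odot>\<^sub>h ev A c] ! i \<cdot> [coev A (dua A c)] ! j
      = (if i = j then idn A \<one>\<^sub>c else zer A \<one>\<^sub>c \<one>\<^sub>c)" for i j by simp
  {
    fix f assume f: "f \<in> Hm A \<one>\<^sub>c (wprod A [c, dua A c])"
    then have "([], f, [c, d]) \<in> whom [] [dua A d, d]" using whom_word[of "[]" "[c, d]" f] by simp
    then obtain t where t: "([], f, [c, d]) = wscl A t (wcoev A d)" using hom_unit_coev[OF S(1)] by blast
    have f': "f = t \<odot>\<^sub>h coev A d" using arg_cong[OF t, of "\<lambda>x. wmor x"] by simp
    have "coev A d \<cdot> ((inverse ?r \<odot>\<^sub>h ev A c) \<cdot> f) = coev A d \<cdot> (t \<odot>\<^sub>h idn A \<one>\<^sub>c)"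
      unfolding f' using cmp_scl(1)[of "coev A d" "inverse ?r \<odot>\<^sub>h ev A c" t] one by simp
    also have "\<dots> = f" unfolding f' by (simp add: cmp_scl)
    finally show "hsum A \<one>\<^sub>c (wprod A [c, dua A c]) (map (\<lambda>i. [coev A (dua A c)] ! i \<cdot>
        ([inverse ?r \<odot>\<^sub>h ev A c] ! i \<cdot> f)) [0..<1]) = f"
      using f by (simp add: plu_zer)
  }
  {
    fix g assume g: "g \<in> Hm A (wprod A [c, dua A c]) \<one>\<^sub>c"
    then have "([c, d], g, []) \<in> whom [dua A d, d] []" using whom_word[of "[c, d]" "[]" g] by simp
    then obtain s where s: "([c, d], g, []) = wscl A s (wev A (dua A d))" using hom_ev_unit[OF S(1)] by blast
    have g': "g = s \<odot>\<^sub>h ev A c" using arg_cong[OF s, of "\<lambda>x. wmor x"] by simp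
    have "(g \<cdot> coev A d) \<cdot> (inverse ?r \<odot>\<^sub>h ev A c) = (s * ?r) \<odot>\<^sub>h (inverse ?r \<odot>\<^sub>h ev A c)"
      unfolding g' by (simp add: cmp_scl mor scl_scl[of "\<one>\<^sub>c" "\<one>\<^sub>c"]
          scl_scl[of "c \<diamond> d" "\<one>\<^sub>c"] idn_closed hom_iff mult_ac)
    also have "\<dots> = g"
      unfolding g' using r scl_scl[of "c \<diamond> d" "\<one>\<^sub>c" "ev A c" "s * ?r" "inverse ?r"]
      by (simp add: hom_iff mult.assoc)
    finally show "hsum A (wprod A [c, dua A c]) \<one>\<^sub>c (map (\<lambda>i. (g \<cdot> [coev A (dua A c)] ! i) \<cdot>
        [inverse ?r \<odot>\<^sub>h ev A c] ! i) [0..<1]) = g"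
      using g by (simp add: plu_zer)
  }
qed simp_all

end

text \<open>Over a finite field the length of a basis is determined by the cardinality of the hom-space.\<close>

lemma hom_dim_eq_length:
  fixes A :: "('o, 'm, 'k::{field,finite}) tensor_cat"
  assumes "linear_category A" and X: "X \<in> Ob A" and Y: "Y \<in> Ob A" and "is_basis A X Y es"
  shows "hom_dim A X Y = length es"
proof -
  interpret linear_category A by fact
  have card: "card (Hm A X Y) = CARD('k) ^ length es" if b: "is_basis A X Y es" for es
  proof -
    let ?L = "{cs :: 'k list. set cs \<subseteq> UNIV \<and> length cs = length es}"
    let ?f = "\<lambda>cs. hsum A X Y (map2 (scl A) cs es)"
    have es: "set es \<subseteq> Hm A X Y" and ex: "\<And>f. f \<in> Hm A X Y \<Longrightarrow> \<exists>!cs. length cs = length es \<and> f = ?f cs"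
      using b by (auto simp: is_basis_def)
    have mem: "?f cs \<in> Hm A X Y" for cs
      using es X Y by (intro hsum_closed) (auto intro!: scl_closed dest: set_zip_rightD)
    have "bij_betw ?f ?L (Hm A X Y)"
      unfolding bij_betw_def
    proof
      show "inj_on ?f ?L" using ex mem by (intro inj_onI) blast
      show "?f ` ?L = Hm A X Y" using ex mem by blast
    qed
    then have "card (Hm A X Y) = card ?L" by (simp add: bij_betw_same_card)
    then show ?thesis using card_lists_length_eq[of "UNIV :: 'k set" "length es"] by simp
  qed
  have "CARD('k) > 1"
    using card_mono[of UNIV "{0, 1 :: 'k}"] by simp
  then show ?thesis
    unfolding hom_dim_def using assms(4) card
    by (intro the_equality) (blast, metis power_inject_exp)
qed

subsection \<open>Sliding an extra factor into a presentation\<close>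

context symmetric_monoidal_category
begin

lemma wiso_wten [simp]:
  assumes "wiso f" "wiso g"
  shows "wiso (f \<diamondop> g)" "winv A (f \<diamondop> g) = winv A f \<diamondop> winv A g"
proof -
  note [simp] = assms wiso_warr[OF assms(1)] wiso_warr[OF assms(2)]
  have 1: "(winv A f \<diamondop> winv A g) \<star> (f \<diamondop> g) = wid A (wsrc (f \<diamondop> g))"
    by (simp add: winterchange wten_wid)
  have 2: "(f \<diamondop> g) \<star> (winv A f \<diamondop> winv A g) = wid A (wtgt (f \<diamondop> g))"
    by (simp add: winterchange wten_wid)
  show "wiso (f \<diamondop> g)" "winv A (f \<diamondop> g) = winv A f \<diamondop> winv A g"
    by - (rule wisoI[OF _ _ _ _ 1 2]; simp)+
qed

lemma foldr_wten_snoc: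
  assumes "\<forall>f\<in>set fs. warr f" "warr g"
  shows "foldr (\<diamondop>) fs g = foldr (\<diamondop>) fs (wid A []) \<diamondop> g \<and> warr (foldr (\<diamondop>) fs (wid A []))"
  using assms by (induction fs) (auto simp: wten_assoc)

end

section \<open>Appending a relator and sliding its letters into the group of one generator\<close>

context semisimple_stable_category
begin

lemma S_wob [simp]: "set bs \<subseteq> S \<Longrightarrow> wob bs"
  using S_ob by (auto simp: wob_def)

lemma rel_mor_whom:
  assumes "\<forall>(i, l)\<in>set R. l \<noteq> 0" "b \<in> Ob A"
  shows "rel_mor A R b \<in> whom (rel_word A R b) (rel_word A R b)"
  using assms by (simp add: whom_def rel_mor_closure)

lemma block_word_relator: "block_word (map (\<lambda>(i, l). (i, opow A b l)) R) = rel_word A R b"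
  by (simp add: block_word_def rel_word_def comp_def case_prod_unfold)

lemma bob_relator: "b \<in> Ob A \<Longrightarrow> bob (map (\<lambda>(i, l). (i, opow A b l)) R)"
  by (auto simp: bob_def opow_def wob_def)

lemma blocks_snoc:
  "length bs = length Rs \<Longrightarrow>
    blocks A (Rs @ [R]) (bs @ [b]) = blocks A Rs bs @ map (\<lambda>(i, l). (i, opow A b l)) R"
  by (simp add: blocks_def)

lemma blocks_props:
  assumes "length Rs = length bs" "set bs \<subseteq> S" "\<forall>R\<in>set Rs. \<forall>(i, l)\<in>set R. i < n \<and> l \<noteq> 0"
  shows "bob (blocks A Rs bs) \<and> fst ` set (blocks A Rs bs) \<subseteq> {..<n} \<and>
    pres_mor A Rs bs \<in> whom (block_word (blocks A Rs bs)) (block_word (blocks A Rs bs))"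
  using assms
proof (induction Rs bs rule: list_induct2)
  case Nil
  then show ?case by (simp add: blocks_def pres_mor_def wid_whom)
next
  case (Cons R Rs b bs)
  let ?B = "map (\<lambda>(i, l). (i, opow A b l)) R"
  have b: "b \<in> Ob A" using Cons.prems by auto
  have R: "\<forall>(i, l)\<in>set R. l \<noteq> 0" "fst ` set ?B \<subseteq> {..<n}" using Cons.prems by force+
  have "blocks A (R # Rs) (b # bs) = ?B @ blocks A Rs bs" by (simp add: blocks_def)
  moreover have "pres_mor A (R # Rs) (b # bs) = rel_mor A R b \<diamondop> pres_mor A Rs bs"
    by (simp add: pres_mor_def)
  moreover note bob_relator[OF b, of R] block_word_relator[of b R] rel_mor_whom[OF R(1) b]
  ultimately show ?case using Cons R(2) by (auto simp: whom_def image_Un)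
qed

lemma pres_mor_snoc:
  assumes "length Rs = length bs" "set bs \<subseteq> S" "\<forall>R\<in>set Rs. \<forall>(i, l)\<in>set R. l \<noteq> 0"
    "\<forall>(i, l)\<in>set R. l \<noteq> 0" "b \<in> S"
  shows "pres_mor A (Rs @ [R]) (bs @ [b]) = pres_mor A Rs bs \<diamondop> rel_mor A R b"
proof -
  have "\<forall>f\<in>set (map2 (rel_mor A) Rs bs). warr f"
  proof
    fix f assume "f \<in> set (map2 (rel_mor A) Rs bs)"
    then obtain R' b' where "f = rel_mor A R' b'" "R' \<in> set Rs" "b' \<in> set bs"
      by (auto dest: set_zip_leftD set_zip_rightD)
    then show "warr f" using rel_mor_whom[of R' b'] assms by (auto simp: whom_def)
  qed
  moreover have "warr (rel_mor A R b)" using rel_mor_whom[of R b] assms by (auto simp: whom_def)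
  ultimately have "foldr (\<diamondop>) (map2 (rel_mor A) Rs bs) (rel_mor A R b) = pres_mor A Rs bs \<diamondop> rel_mor A R b"
    using foldr_wten_snoc unfolding pres_mor_def by blast
  then show ?thesis using \<open>warr (rel_mor A R b)\<close> assms(1) by (simp add: pres_mor_def)
qed

text \<open>The appended word \<open>w\<close> stands last but belongs between \<open>L\<close>,
  which ends with the group of x_k, and the later groups \<open>U\<close>. Conjugation by the
  symmetry puts it there; \<open>\<psi>\<close> acts on the old letters only.\<close>

definition slide where
  "slide L U \<psi> w = pad L (wsym A U w) [] \<star> (pad [] \<psi> w \<star> pad L (wsym A w U) [])"

lemma slide_whom:
  "\<psi> \<in> whom (L @ U) (L @ U) \<Longrightarrow> wob L \<Longrightarrow> wob U \<Longrightarrow> wob w \<Longrightarrow> slide L U \<psi> w \<in> whom (L @ w @ U) (L @ w @ U)"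
  by (simp add: slide_def whom_def)

text \<open>\<open>f\<close> lives on a strand that \<open>\<psi>\<close> does not touch: it passes
  the two symmetries by naturality and \<open>\<psi>\<close> by interchange.\<close>

lemma slide_nat:
  assumes f: "f \<in> whom w w'" and \<psi>: "\<psi> \<in> whom (L @ U) (L @ U)" and [simp]: "wob L" "wob U" "wob w" "wob w'"
  shows "slide L U \<psi> w' \<star> pad L f U = pad L f U \<star> slide L U \<psi> w"
proof -
  note [simp] = whomD[OF f] whomD[OF \<psi>]
  have 1: "pad L (wsym A w' U) [] \<star> pad L f U = pad (L @ U) f [] \<star> pad L (wsym A w U) []"
    using arg_cong[OF wsym_nat_left[of f U], of "\<lambda>x. pad L x []"] by (simp add: pad_cmp)
  have 2: "pad [] \<psi> w' \<star> pad (L @ U) f [] = pad (L @ U) f [] \<star> pad [] \<psi> w"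
    using exchange[of \<psi> f "[]" "[]" "[]"] by simp
  have 3: "pad L (wsym A U w') [] \<star> pad (L @ U) f [] = pad L f U \<star> pad L (wsym A U w) []"
    using arg_cong[OF wsym_nat_right[of f U], of "\<lambda>x. pad L x []"] by (simp add: pad_cmp)
  show ?thesis
    by (simp add: slide_def wcmp_assoc 1 wcmp_rest[OF 2] wcmp_rest[OF 3])
qed

text \<open>The functional \<tau> of the overview, on words: \<open>g\<close> is the group of x_k,
  and \<open>w\<close> is traced together with it as a single factor.\<close>

definition slide_trace where
  "slide_trace xs g ys \<psi> w = itr (xs @ (g @ w) # ys) (slide (concat xs @ g) (concat ys) \<psi> w)"

text \<open>The identity of \<open>w\<close> is resolved as the sum of the
  \<open>\<iota> i \<cdot> \<pi> i\<close>. Cyclicity carries \<open>\<pi> i\<close> round the trace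
  over \<open>g @ w\<close>, \<open>\<iota> i\<close> passes \<open>slide\<close> by naturality, and
  the two meet in the identity of a simple summand.\<close>

lemma slide_trace_direct_sum:
  assumes w: "wob w" and xs: "wob (concat xs)" and g: "wob g" and ys: "wob (concat ys)"
    and \<psi>: "\<psi> \<in> whom ((concat xs @ g) @ concat ys) ((concat xs @ g) @ concat ys)"
    and as: "set as \<subseteq> S"
    and mem: "\<And>i. i < length as \<Longrightarrow> \<iota> i \<in> Hm A (as ! i) (wprod A w)"
      "\<And>i. i < length as \<Longrightarrow> \<pi> i \<in> Hm A (wprod A w) (as ! i)"
    and dual: "\<And>i. i < length as \<Longrightarrow> \<pi> i \<cdot> \<iota> i = idn A (as ! i)"
    and sum: "hsum A (wprod A w) (wprod A w) (map (\<lambda>i. \<iota> i \<cdot> \<pi> i) [0..<length as]) = idn A (wprod A w)"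
  shows "slide_trace xs g ys \<psi> w = (\<Sum>i<length as. slide_trace xs g ys \<psi> [as ! i])"
proof -
  let ?L = "concat xs @ g" and ?U = "concat ys"
  let ?F = "\<lambda>f. itr (xs @ (g @ w) # ys) (slide ?L ?U \<psi> w \<star> pad ?L f ?U)"
  have L [simp]: "wob ?L" using xs g by simp
  have asO: "as ! i \<in> Ob A" if "i < length as" for i using nth_mem[OF that] as S_ob by auto
  have c: "concat (xs @ (g @ w) # ys) = ?L @ w @ ?U" by simp
  have lin: "wlin w w ?F"
  proof (rule wlin_pad[of ?L w ?U w "\<lambda>f. itr (xs @ (g @ w) # ys) (slide ?L ?U \<psi> w \<star> f)"])
    have "wlin (?L @ w @ ?U) (?L @ w @ ?U) (itr (xs @ (g @ w) # ys))"
      using wlin_itr[of "xs @ (g @ w) # ys"] w xs g ys unfolding c by simp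
    then show "wlin (?L @ w @ ?U) (?L @ w @ ?U) (\<lambda>f. itr (xs @ (g @ w) # ys) (slide ?L ?U \<psi> w \<star> f))"
      by (rule wlin_cmp) (rule slide_whom[OF \<psi> L ys w])
  qed (use ys L in simp_all)
  have "slide_trace xs g ys \<psi> w = ?F (wid A w)"
    using whomD[OF slide_whom[OF \<psi> L ys w]] w ys xs g by (simp add: slide_trace_def)
  also have "wid A w = (w, hsum A (wprod A w) (wprod A w) (map (\<lambda>i. \<iota> i \<cdot> \<pi> i) [0..<length as]), w)"
    by (simp add: wid_def sum)
  also have "?F \<dots> = (\<Sum>i<length as. ?F (w, \<iota> i \<cdot> \<pi> i, w))"
    by (rule wlin_hsum[OF lin w w]) (rule cmp_closed[OF wprod_ob[OF w] asO wprod_ob[OF w] mem(2) mem(1)])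
  also have "\<dots> = (\<Sum>i<length as. slide_trace xs g ys \<psi> [as ! i])"
  proof (rule sum.cong[OF refl])
    fix i assume "i \<in> {..<length as}"
    then have i: "i < length as" by simp
    let ?a = "[as ! i]" and ?\<iota> = "([as ! i], \<iota> i, w)" and ?\<pi> = "(w, \<pi> i, [as ! i])"
    have a [simp]: "wob ?a" using asO[OF i] by simp
    have \<iota>: "?\<iota> \<in> whom ?a w" and \<pi>: "?\<pi> \<in> whom w ?a"
      using whom_word[OF a w, of "\<iota> i"] whom_word[OF w a, of "\<pi> i"] mem[OF i] by simp_all
    note [simp] = whomD(1)[OF \<iota>] whomD(1)[OF \<pi>] w ys xs g
    have \<pi>\<iota>: "?\<pi> \<star> ?\<iota> = wid A ?a" using dual[OF i] by (simp add: wid_def)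
    note s = slide_whom[OF \<psi> L ys w] and sa = slide_whom[OF \<psi> L ys a]
    have gp: "pad g ?\<pi> [] \<in> whom (g @ w) (g @ ?a)"
      using whom_pad[OF \<pi>, of g "[]"] by simp
    have l\<iota>: "pad ?L ?\<iota> ?U \<in> whom (?L @ ?a @ ?U) (?L @ w @ ?U)"
      using whom_pad[OF \<iota>, of ?L ?U] by simp
    have "?F (w, \<iota> i \<cdot> \<pi> i, w) = itr (xs @ (g @ w) # ys)
        ((slide ?L ?U \<psi> w \<star> pad ?L ?\<iota> ?U) \<star> pad ?L ?\<pi> ?U)"
      using pad_cmp[of ?\<pi> ?\<iota> ?L ?U] whomD[OF s] by (simp add: wcmp_assoc)
    \<comment> \<open>The projection is regarded as acting on the whole factor \<open>g @ w\<close>,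
      since cyclicity applies to morphisms between entire traced factors.\<close>
    also have "\<dots> = itr (xs @ (g @ w) # ys)
        ((slide ?L ?U \<psi> w \<star> pad ?L ?\<iota> ?U) \<star> pad (concat xs) (pad g ?\<pi> []) ?U)"
      by simp
    also have "\<dots> = itr (xs @ (g @ ?a) # ys)
        (pad (concat xs) (pad g ?\<pi> []) ?U \<star> (slide ?L ?U \<psi> w \<star> pad ?L ?\<iota> ?U))"
      by (rule itr_cyclic[OF gp]) (use whom_cmp[OF l\<iota> s] a in simp_all)
    also have "pad (concat xs) (pad g ?\<pi> []) ?U \<star> (slide ?L ?U \<psi> w \<star> pad ?L ?\<iota> ?U)
        = pad ?L ?\<pi> ?U \<star> (pad ?L ?\<iota> ?U \<star> slide ?L ?U \<psi> ?a)"
      using slide_nat[OF \<iota> \<psi> L ys a w] by simp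
    also have "\<dots> = slide ?L ?U \<psi> ?a"
      using wcmp_rest[OF pad_eq[OF \<pi>\<iota>, of ?L ?U], of "slide ?L ?U \<psi> ?a"] whomD[OF sa] a by simp
    finally show "?F (w, \<iota> i \<cdot> \<pi> i, w) = slide_trace xs g ys \<psi> ?a" by (simp add: slide_trace_def)
  qed
  finally show ?thesis .
qed

text \<open>All labels are below \<open>n\<close>, so nothing is left over after grouping and the
  words to be traced are exactly the groups.\<close>

lemma Q_term_itr:
  fixes bs
  assumes "length Rs = length bs" "set bs \<subseteq> S" "is_presentation (n, Rs)"
  defines "B \<equiv> blocks A Rs bs"
  shows "Q_term A (n, Rs) bs = itr (map (\<lambda>k. group_word k B) [0..<n])
    (grouping A [0..<n] B \<star> pres_mor A Rs bs \<star> winv A (grouping A [0..<n] B))"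
proof -
  have R: "\<forall>R\<in>set Rs. \<forall>(i, l)\<in>set R. i < n \<and> l \<noteq> 0" using assms(3) by (simp add: is_presentation_def)
  have B: "bob B" "fst ` set B \<subseteq> {..<n}" "pres_mor A Rs bs \<in> whom (block_word B) (block_word B)"
    using blocks_props[OF assms(1,2) R] by (simp_all add: B_def)
  have "filter (\<lambda>(i, w). i \<notin> set [0..<n]) B = []"
    using B(2) by (auto simp: filter_empty_conv)
  then have "rest_word [0..<n] B = []" unfolding rest_word_def by simp
  then have t: "wtgt (grouping A [0..<n] B) = group_words [0..<n] B" using B(1) by simp
  let ?ws = "map (\<lambda>k. group_word k B) [0..<n]"
  let ?\<phi> = "grouping A [0..<n] B \<star> pres_mor A Rs bs \<star> winv A (grouping A [0..<n] B)"
  have c: "concat ?ws = group_words [0..<n] B" by (simp add: group_words_def)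
  have \<phi>: "?\<phi> \<in> whom (concat ?ws) (concat ?ws)"
    unfolding c using B t whomD[OF B(3)] by (simp add: whom_def)
  have wc: "wob (concat ?ws)" unfolding c using B(1) by simp
  have "Q_term A (n, Rs) bs = scalar A (wprod A (replicate n \<one>\<^sub>c))
      (wmor (traces A [] (map (\<lambda>k. (group_word k B, \<one>\<^sub>c)) [0..<n]) ?\<phi>))"
    by (simp add: Q_term_def B_def Let_def del: wcmp_sel)
  also have "\<dots> = itr ?ws (pad [] (winv A (unit_word 0)) (concat ?ws) \<star> ?\<phi> \<star> pad [] (unit_word 0) (concat ?ws))"
    using traces_itr[OF wc, of ?\<phi> 0] \<phi> by (simp add: comp_def del: wcmp_sel)
  also have "\<dots> = itr ?ws ?\<phi>"
    using wc whomD[OF \<phi>] by (simp del: wcmp_sel)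
  finally show ?thesis .
qed

end

section \<open>Grouping permutations of the two enlarged presentations\<close>

context symmetric_monoidal_category
begin

lemma rest_word_covered: "fst ` set B \<subseteq> set ks \<Longrightarrow> rest_word ks B = []"
  unfolding rest_word_def by (subst filter_False) auto

lemma group_words_absent: "j \<notin> set ks \<Longrightarrow> group_words ks (B @ [(j, w)]) = group_words ks B"
  by (induction ks) auto

lemma grouping_generator:
  assumes "bob B" "wob w" "fst ` set B \<subseteq> set (ks @ k # ls)" "distinct (ks @ k # ls)"
  shows "grouping A (ks @ k # ls) (B @ [(k, w)])
    = pad (group_words (ks @ [k]) B) (wsym A (group_words ls B) w) []
        \<star> pad [] (grouping A (ks @ k # ls) B) w"
  using grouping_snoc[OF assms(1,2,4)] rest_word_covered[OF assms(3)] by simp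

text \<open>The blocks of \<open>x\<^sub>k y x\<^sub>k\<^sup>-\<^sup>1 y\<^sup>-\<^sup>1\<close>: the inner symmetry puts the two letters of \<open>x\<^sub>k\<close> next
  to each other, and these are then moved together.\<close>

lemma grouping_commutator:
  assumes B: "bob B" and [simp]: "c \<in> Ob A" "d \<in> Ob A"
    and cov: "fst ` set B \<subseteq> set (ks @ k # ls)" and dist: "distinct (ks @ k # ls @ [n])"
  shows "grouping A (ks @ k # ls @ [n]) (B @ [(k, [c]), (n, [c]), (k, [d]), (n, [d])])
    = pad (group_words (ks @ [k]) B) (wsym A (group_words ls B) [c, d]) [c, d]
        \<star> (grouping A (ks @ k # ls) B \<diamondop> pad [c] (wsym A [c] [d]) [d])"
proof -
  define L where "L = group_words (ks @ [k]) B"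
  define U where "U = group_words ls B"
  define N where "N = ks @ k # ls @ [n]"
  define \<xi> where "\<xi> = grouping A (ks @ k # ls) B"
  have N: "N = ks @ k # (ls @ [n])" "N = (ks @ k # ls) @ n # []" by (simp_all add: N_def)
  have dN: "distinct N" using dist by (simp add: N_def)
  have nB: "n \<notin> fst ` set B" using cov dist by auto
  have kn [simp]: "k \<noteq> n" "n \<noteq> k" "n \<notin> set ks" "n \<notin> set ls" "k \<notin> set ks" "k \<notin> set ls" using dist by auto
  have dist': "distinct (ks @ k # ls)" using dist by simp
  have gn: "group_word n B = []" using absent_words(3)[OF nB] .
  have L [simp]: "wob L" "wob U" using B by (simp_all add: L_def U_def)
  have \<xi> [simp]: "warr \<xi>" "wsrc \<xi> = block_word B" "wtgt \<xi> = L @ U"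
    using grouping_word[OF B dist'] rest_word_covered[OF cov] by (simp_all add: \<xi>_def L_def U_def)
  let ?B1 = "B @ [(k, [c])]"
  let ?B2 = "?B1 @ [(n, [c])]"
  let ?B3 = "?B2 @ [(k, [d])]"
  let ?B4 = "?B3 @ [(n, [d])]"
  have bob: "bob ?B1" "bob ?B2" "bob ?B3" using B by simp_all
  have cov': "fst ` set B \<subseteq> set N" "fst ` set ?B1 \<subseteq> set N" "fst ` set ?B2 \<subseteq> set N" "fst ` set ?B3 \<subseteq> set N"
    using cov by (auto simp: N_def)
  have wc: "wob [c]" "wob [d]" by simp_all
  note gk = grouping_generator[where ks = ks and k = k and ls = "ls @ [n]", folded N(1)]
    and gN = grouping_generator[where ks = "ks @ k # ls" and k = n and ls = "[]", folded N(2)]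
  \<comment> \<open>The blocks of the commutator are appended one by one. As \<open>n\<close> is the
    last label, its blocks are already in place; only those labelled \<open>k\<close> have to cross
    later groups.\<close>
  have 0: "grouping A N B = \<xi>"
    using grouping_absent[OF B nB dist'] by (simp add: \<xi>_def N_def)
  have 1: "grouping A N ?B1 = pad L (wsym A U [c]) [] \<star> pad [] \<xi> [c]"
    using gk[OF B wc(1) cov'(1) dN] by (simp add: 0 gn L_def U_def)
  have wob_all: "wob (group_words ls' ?B1)" "wob (group_words ls' ?B2)" "wob (group_words ls' ?B3)" for ls'
    using bob by simp_all
  have w1: "warr (grouping A N ?B1)" "warr (grouping A N ?B2)" "warr (grouping A N ?B3)"
    using grouping_word(2)[OF bob(1) dN] grouping_word(2)[OF bob(2) dN] grouping_word(2)[OF bob(3) dN] by simp_all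
  have 2: "grouping A N ?B2 = pad [] (grouping A N ?B1) [c]"
    using gN[OF bob(1) wc(1) cov'(2) dN] w1(1) grouping_word(4)[OF bob(1) dN] rest_word_covered[OF cov'(2)]
      wob_all(1)[of N]
    by (simp del: grouping.simps add: N_def)
  have l2: "group_words (ks @ [k]) ?B2 = L @ [c]" "group_words (ls @ [n]) ?B2 = U @ [c]"
    using gn by (simp_all add: L_def U_def group_words_absent del: append_assoc)
  have 3: "grouping A N ?B3 = pad (L @ [c]) (wsym A (U @ [c]) [d]) [] \<star> pad [] (grouping A N ?B2) [d]"
    using gk[OF bob(2) wc(2) cov'(3) dN] unfolding l2 .
  have 4: "grouping A N ?B4 = pad [] (grouping A N ?B3) [d]"
    using gN[OF bob(3) wc(2) cov'(4) dN] w1(3) grouping_word(4)[OF bob(3) dN] rest_word_covered[OF cov'(4)]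
      wob_all(3)[of N]
    by (simp del: grouping.simps add: N_def)
  let ?cd = "wsym A [c] [d]"
  have e: "pad (L @ c # U) ?cd [d] \<star> (pad L (wsym A U [c]) [c, d, d] \<star> pad [] \<xi> [c, c, d, d])
      = pad L (wsym A U [c]) [d, c, d] \<star> (pad (L @ U @ [c]) ?cd [d] \<star> pad [] \<xi> [c, c, d, d])"
    using exchange_rest[of "wsym A U [c]" ?cd L "[]" "[d]" "pad [] \<xi> [c, c, d, d]"] by simp
  have "grouping A N ?B4 = pad (L @ [c]) (wsym A (U @ [c]) [d]) [d] \<star>
      (pad L (wsym A U [c]) [c, d, d] \<star> pad [] \<xi> [c, c, d, d])"
    by (simp only: 4 3 2 1) (simp add: pad_cmp wcmp_assoc)
  also have "\<dots> = pad (L @ [c]) (wsym A U [d]) [c, d] \<star> (pad (L @ c # U) ?cd [d] \<star>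
      (pad L (wsym A U [c]) [c, d, d] \<star> pad [] \<xi> [c, c, d, d]))"
    by (simp add: wsym_append_left' pad_cmp wcmp_assoc)
  also have "\<dots> = pad L (wsym A U ([c] @ [d])) [c, d] \<star>
      (pad (L @ U @ [c]) ?cd [d] \<star> pad [] \<xi> [c, c, d, d])"
    unfolding e wsym_append_right'[OF L(2) wc] by (simp add: pad_cmp wcmp_assoc)
  also have "pad (L @ U @ [c]) ?cd [d] \<star> pad [] \<xi> [c, c, d, d] = \<xi> \<diamondop> pad [c] ?cd [d]"
    by (simp add: wten_pad(2))
  finally show ?thesis by (simp add: N_def L_def U_def \<xi>_def)
qed

end

section \<open>The summands of Q for the two presentations\<close>

context semisimple_stable_category
begin

lemma itr_wscl:
  assumes "f \<in> whom (concat ws) (concat ws)"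
  shows "itr ws (wscl A r f) = r * itr ws f"
proof -
  have "wob (concat ws)" using whomD[OF assms] warr_wob(1)[of f] by simp
  then show ?thesis using wlin_itr assms unfolding wlin_def by blast
qed

lemma Q_term_snoc:
  fixes bs
  assumes len: "length Rs = length bs" and bs: "set bs \<subseteq> S" and pres: "is_presentation (n, Rs)"
    and p: "is_presentation (m, Rs @ [R])" and b: "b \<in> S"
  defines "B \<equiv> blocks A Rs bs" and "C \<equiv> map (\<lambda>(i, l). (i, opow A b l)) R"
  shows "Q_term A (m, Rs @ [R]) (bs @ [b]) = itr (map (\<lambda>j. group_word j (B @ C)) [0..<m])
      (grouping A [0..<m] (B @ C) \<star> (pres_mor A Rs bs \<diamondop> rel_mor A R b) \<star> winv A (grouping A [0..<m] (B @ C)))"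
proof -
  have "\<forall>R\<in>set Rs. \<forall>(i, l)\<in>set R. l \<noteq> 0" "\<forall>(i, l)\<in>set R. l \<noteq> 0"
    using p by (auto simp: is_presentation_def)
  from pres_mor_snoc[OF len bs this b] show ?thesis
    using Q_term_itr[of "Rs @ [R]" "bs @ [b]" m] len bs b p by (simp add: blocks_snoc B_def C_def)
qed

text \<open>By \<open>rel_closure_generator\<close> the new relator contributes r(b) times an
  identity strand. Conjugation by the grouping turns this strand into \<open>slide\<close>, and r(b)
  leaves the trace by linearity.\<close>

lemma Q_term_generator:
  fixes bs
  assumes len: "length Rs = length bs" and bs: "set bs \<subseteq> S" and pres: "is_presentation (n, Rs)" and b: "b \<in> S"
    and N: "[0..<n] = ks @ k # ls"
  defines "B \<equiv> blocks A Rs bs"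
  defines "\<xi> \<equiv> grouping A (ks @ k # ls) B"
  shows "Q_term A (n, Rs @ [[(k, 1)]]) (bs @ [b])
    = rank A b * slide_trace (map (\<lambda>j. group_word j B) ks) (group_word k B) (map (\<lambda>j. group_word j B) ls)
        (\<xi> \<star> pres_mor A Rs bs \<star> winv A \<xi>) [b]"
proof -
  define \<phi> where "\<phi> = pres_mor A Rs bs"
  define L where "L = group_words (ks @ [k]) B"
  define U where "U = group_words ls B"
  have R: "\<forall>R\<in>set Rs. \<forall>(i, l)\<in>set R. i < n \<and> l \<noteq> 0" using pres by (simp add: is_presentation_def)
  have k: "k < n" using arg_cong[OF N, of set] by auto
  have dist: "distinct (ks @ k # ls)" unfolding N[symmetric] by simp
  have B [simp]: "bob B" "warr \<phi>" "wsrc \<phi> = block_word B" "wtgt \<phi> = block_word B"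
    and cov: "fst ` set B \<subseteq> set (ks @ k # ls)"
    using blocks_props[OF len bs R] unfolding N[symmetric] by (auto simp: whom_def B_def \<phi>_def)
  have [simp]: "b \<in> Ob A" using b by simp
  have [simp]: "wob L" "wob U" using B by (simp_all add: L_def U_def)
  have \<xi> [simp]: "wiso \<xi>" "warr \<xi>" "wsrc \<xi> = block_word B" "wtgt \<xi> = L @ U"
    using grouping_word[OF B(1) dist] rest_word_covered[OF cov] by (simp_all add: \<xi>_def L_def U_def)
  let ?r = "rank A b" and ?K = "pad L (wsym A U [b]) [] \<star> pad [] \<xi> [b]"
    and ?\<psi> = "\<xi> \<star> \<phi> \<star> winv A \<xi>"
  define Ws where "Ws = map (\<lambda>j. group_word j B) ks @ (group_word k B @ [b]) # map (\<lambda>j. group_word j B) ls"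
  have c: "concat Ws = L @ [b] @ U" by (simp add: Ws_def L_def U_def group_words_def)
  have \<psi>: "?\<psi> \<in> whom (L @ U) (L @ U)" by (simp add: whom_def)
  have s: "slide L U ?\<psi> [b] \<in> whom (concat Ws) (concat Ws)"
    unfolding c by (rule slide_whom[OF \<psi>]) simp_all
  have f: "pad [] \<phi> [b] \<in> whom (block_word B @ [b]) (block_word B @ [b])"
    and l: "?K \<in> whom (block_word B @ [b]) (L @ [b] @ U)"
    and r: "winv A ?K \<in> whom (L @ [b] @ U) (block_word B @ [b])"
    by (simp_all add: whom_def)
  have "\<phi> \<diamondop> rel_mor A [(k, 1)] b = wscl A ?r (pad [] \<phi> [b])"
    using pad_wscl[OF wid_whom[of "[b]"], of "block_word B" "[]" ?r]
      wcmp_wscl(1)[OF wid_whom[of "block_word B @ [b]"], of "pad [] \<phi> [b]" "block_word B @ [b]" ?r]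
    by (simp add: rel_mor_closure rel_closure_generator wten_pad whom_def)
  moreover have "?K \<star> pad [] \<phi> [b] \<star> winv A ?K = slide L U ?\<psi> [b]"
    by (simp add: slide_def pad_cmp wcmp_assoc)
  ultimately have m: "?K \<star> (\<phi> \<diamondop> rel_mor A [(k, 1)] b) \<star> winv A ?K = wscl A ?r (slide L U ?\<psi> [b])"
    using wcmp_wscl(1)[OF f l, of ?r] wcmp_wscl(2)[OF whom_cmp[OF f l] r, of ?r] by simp
  have K: "grouping A [0..<n] (B @ [(k, [b])]) = ?K"
    unfolding N using grouping_generator[OF B(1) _ cov dist, of "[b]"] by (simp add: L_def U_def \<xi>_def)
  have ws: "map (\<lambda>j. group_word j (B @ [(k, [b])])) [0..<n] = Ws"
    unfolding N Ws_def using dist by auto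
  have p: "is_presentation (n, Rs @ [[(k, 1)]])" using pres k by (auto simp: is_presentation_def)
  have C: "map (\<lambda>(i, l). (i, opow A b l)) [(k, 1)] = [(k, [b])]" by (simp add: opow_def)
  have "Q_term A (n, Rs @ [[(k, 1)]]) (bs @ [b]) = itr Ws (wscl A ?r (slide L U ?\<psi> [b]))"
    using Q_term_snoc[OF len bs pres p b] unfolding C B_def[symmetric] \<phi>_def[symmetric] K ws m .
  also have "\<dots> = ?r * itr Ws (slide L U ?\<psi> [b])" by (rule itr_wscl[OF s])
  finally show ?thesis
    by (simp add: slide_trace_def Ws_def L_def U_def \<phi>_def group_words_def)
qed

text \<open>The group of y is the word \<open>[c, d]\<close>, whose trace to the unit has a single
  summand, cup and cap with weight r(c)^{-1}. This weight cancels the r(c) in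
  \<open>rel_mor\<close>, so the result contains no rank, in contrast to
  \<open>Q_term_generator\<close>.\<close>

lemma Q_term_commutator:
  fixes bs
  assumes len: "length Rs = length bs" and bs: "set bs \<subseteq> S" and pres: "is_presentation (n, Rs)" and b: "c \<in> S"
    and N: "[0..<n] = ks @ k # ls"
  defines "B \<equiv> blocks A Rs bs"
  defines "\<xi> \<equiv> grouping A (ks @ k # ls) B"
  shows "Q_term A (n + 1, Rs @ [[(k, 1), (n, 1), (k, - 1), (n, - 1)]]) (bs @ [c])
    = slide_trace (map (\<lambda>j. group_word j B) ks) (group_word k B) (map (\<lambda>j. group_word j B) ls)
        (\<xi> \<star> pres_mor A Rs bs \<star> winv A \<xi>) [c, dua A c]"
proof -
  define \<phi> where "\<phi> = pres_mor A Rs bs"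
  define L where "L = group_words (ks @ [k]) B"
  define U where "U = group_words ls B"
  define d where "d = dua A c"
  define R :: relator where "R = [(k, 1), (n, 1), (k, - 1), (n, - 1)]"
  define \<kappa> where "\<kappa> = rel_closure R c"
  have Rs: "\<forall>R\<in>set Rs. \<forall>(i, l)\<in>set R. i < n \<and> l \<noteq> 0" using pres by (simp add: is_presentation_def)
  have k: "k < n" using arg_cong[OF N, of set] by auto
  have dist: "distinct (ks @ k # ls)" unfolding N[symmetric] by simp
  have N': "[0..<n + 1] = ks @ k # ls @ [n]" using N by simp
  have dist': "distinct (ks @ k # ls @ [n])" unfolding N'[symmetric] by (rule distinct_upt)
  have B [simp]: "bob B" "warr \<phi>" "wsrc \<phi> = block_word B" "wtgt \<phi> = block_word B"
    and cov: "fst ` set B \<subseteq> set (ks @ k # ls)"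
    using blocks_props[OF len bs Rs] unfolding N[symmetric] by (auto simp: whom_def B_def \<phi>_def)
  have [simp]: "c \<in> Ob A" "d \<in> Ob A" "dua A c = d" "dua A d = c" using b by (simp_all add: d_def)
  have [simp]: "wob L" "wob U" using B by (simp_all add: L_def U_def)
  have \<xi> [simp]: "wiso \<xi>" "warr \<xi>" "wsrc \<xi> = block_word B" "wtgt \<xi> = L @ U"
    using grouping_word[OF B(1) dist] rest_word_covered[OF cov] by (simp_all add: \<xi>_def L_def U_def)
  have R: "\<forall>(i, l)\<in>set R. l \<noteq> 0" by (simp add: R_def)
  have \<kappa> [simp]: "warr \<kappa>" "wsrc \<kappa> = [c, c, d, d]" "wtgt \<kappa> = [c, c, d, d]"
    using rel_closure_word[OF R, of c] by (simp_all add: \<kappa>_def R_def rel_word_def opow_def)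
  let ?r = "rank A c" and ?K = "pad L (wsym A U [c, d]) []" and ?\<sigma> = "pad [c] (wsym A [c] [d]) [d]"
    and ?\<psi> = "\<xi> \<star> \<phi> \<star> winv A \<xi>"
  let ?V = "L @ [c, d] @ U" and ?K' = "pad [] ?K [c, d]"
  let ?\<xi> = "?K' \<star> (\<xi> \<diamondop> ?\<sigma>)"
  define Ws where "Ws = map (\<lambda>j. group_word j B) ks @ (group_word k B @ [c, d]) # map (\<lambda>j. group_word j B) ls"
  have cc: "concat Ws = ?V" by (simp add: Ws_def L_def U_def group_words_def)
  have \<psi>: "?\<psi> \<in> whom (L @ U) (L @ U)" by (simp add: whom_def)
  have s: "slide L U ?\<psi> [c, d] \<in> whom (concat Ws) (concat Ws)"
    unfolding cc by (rule slide_whom[OF \<psi>]) simp_all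
  define M where "M = ?\<xi> \<star> (\<phi> \<diamondop> \<kappa>) \<star> winv A ?\<xi>"
  have M: "M \<in> whom (?V @ [c, d]) (?V @ [c, d])" by (simp add: M_def whom_def)
  \<comment> \<open>Cap and cup of the trace over y move inward through the outer symmetries until
    they act on the commutator alone; \<open>rel_closure_commutator\<close> then replaces it by the
    identity of \<open>[c, d]\<close>.\<close>
  have tr: "pad ?V (wev A c) [] \<star> (M \<star> pad ?V (wcoev A d) []) = slide L U ?\<psi> [c, d]"
  proof -
    let ?ev = "pad [c, d] (wev A c) []" and ?coev = "pad [c, d] (wcoev A d) []"
    let ?LU = "wid A (L @ U)"
    have 1: "pad ?V (wev A c) [] \<star> ?K' = ?K \<star> (?LU \<diamondop> ?ev)"
      using exchange[of "wsym A U [c, d]" "wev A c" L "[]" "[]"] by (simp add: wten_wid_left)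
    have 2: "winv A ?K' \<star> pad ?V (wcoev A d) [] = (?LU \<diamondop> ?coev) \<star> winv A ?K"
      using exchange[of "wsym A [c, d] U" "wcoev A d" L "[]" "[]"] by (simp add: wten_wid_left)
    have \<sigma>: "winv A ?\<sigma> = pad [c] (wsym A [d] [c]) [d]" by simp
    have 3: "?ev \<star> (?\<sigma> \<star> (\<kappa> \<star> (winv A ?\<sigma> \<star> ?coev))) = wid A [c, d]"
      using rel_closure_commutator[of c d k n] unfolding \<sigma> by (simp add: \<kappa>_def R_def)
    have "pad ?V (wev A c) [] \<star> (M \<star> pad ?V (wcoev A d) [])
        = (pad ?V (wev A c) [] \<star> ?K') \<star> ((\<xi> \<diamondop> ?\<sigma>) \<star> ((\<phi> \<diamondop> \<kappa>) \<star>
          ((winv A \<xi> \<diamondop> winv A ?\<sigma>) \<star> (winv A ?K' \<star> pad ?V (wcoev A d) []))))"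
      by (simp add: M_def wcmp_assoc)
    also have "\<dots> = ?K \<star> (((?LU \<diamondop> ?ev) \<star> ((\<xi> \<diamondop> ?\<sigma>) \<star> ((\<phi> \<diamondop> \<kappa>) \<star>
          ((winv A \<xi> \<diamondop> winv A ?\<sigma>) \<star> (?LU \<diamondop> ?coev))))) \<star> winv A ?K)"
      unfolding 1 2 by (simp add: wcmp_assoc)
    also have "(?LU \<diamondop> ?ev) \<star> ((\<xi> \<diamondop> ?\<sigma>) \<star> ((\<phi> \<diamondop> \<kappa>) \<star> ((winv A \<xi> \<diamondop> winv A ?\<sigma>) \<star> (?LU \<diamondop> ?coev))))
        = ?\<psi> \<diamondop> wid A [c, d]"
      unfolding 3[symmetric] by (simp add: winterchange wcmp_assoc)
    also have "?K \<star> ((?\<psi> \<diamondop> wid A [c, d]) \<star> winv A ?K) = slide L U ?\<psi> [c, d]"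
      by (simp add: slide_def wten_wid_right)
    finally show ?thesis .
  qed
  have "itr (Ws @ [[c, d]]) M = itr Ws (pad ?V ([c, d], inverse ?r \<odot>\<^sub>h ev A c, []) [] \<star> M \<star> pad ?V (wcoev A d) [])"
    using itr_snoc[OF coev_ev_dual_bases[OF b], of Ws M] M unfolding cc by (simp add: wcoev_def)
  also have "([c, d], inverse ?r \<odot>\<^sub>h ev A c, []) = wscl A (inverse ?r) (wev A c)"
    by (simp add: wev_def)
  also have "pad ?V (wscl A (inverse ?r) (wev A c)) [] \<star> M \<star> pad ?V (wcoev A d) []
      = wscl A (inverse ?r) (slide L U ?\<psi> [c, d])"
  proof -
    have e: "wev A c \<in> whom [c, d] []" by (simp add: whom_def)
    have e': "pad ?V (wev A c) [] \<in> whom (?V @ [c, d]) ?V" by (simp add: whom_def)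
    have co: "pad ?V (wcoev A d) [] \<in> whom ?V (?V @ [c, d])" by (simp add: whom_def)
    have "pad ?V (wev A c) [] \<star> M \<star> pad ?V (wcoev A d) [] = slide L U ?\<psi> [c, d]"
      unfolding tr[symmetric] using whomD[OF M] by (simp add: wcmp_assoc)
    then show ?thesis
      using pad_wscl[OF e, of ?V "[]" "inverse ?r"] wcmp_wscl(2)[OF e' M, of "inverse ?r"]
        wcmp_wscl(2)[OF whom_cmp[OF M e'] co, of "inverse ?r"] by simp
  qed
  also have "itr Ws (wscl A (inverse ?r) (slide L U ?\<psi> [c, d])) = inverse ?r * itr Ws (slide L U ?\<psi> [c, d])"
    by (rule itr_wscl[OF s])
  finally have 1: "?r * itr (Ws @ [[c, d]]) M = itr Ws (slide L U ?\<psi> [c, d])"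
    using rank_nonzero[OF b] by simp
  have K: "grouping A [0..<n + 1] (B @ [(k, [c]), (n, [c]), (k, [d]), (n, [d])]) = ?\<xi>"
    unfolding N' using grouping_commutator[OF B(1) _ _ cov dist', of c d] by (simp add: L_def U_def \<xi>_def)
  have nB: "group_word n B = []" using absent_words(3)[of n B] cov dist' by auto
  have ws: "map (\<lambda>j. group_word j (B @ [(k, [c]), (n, [c]), (k, [d]), (n, [d])])) [0..<n + 1] = Ws @ [[c, d]]"
    unfolding N' Ws_def using dist' nB by auto
  have p: "is_presentation (n + 1, Rs @ [R])" using pres k by (auto simp: is_presentation_def R_def less_Suc_eq)
  have C: "map (\<lambda>(i, l). (i, opow A c l)) R = [(k, [c]), (n, [c]), (k, [d]), (n, [d])]"
    by (simp add: R_def opow_def)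
  have f: "\<phi> \<diamondop> \<kappa> \<in> whom (block_word B @ [c, c, d, d]) (block_word B @ [c, c, d, d])"
    and l: "?\<xi> \<in> whom (block_word B @ [c, c, d, d]) (?V @ [c, d])"
    and r: "winv A ?\<xi> \<in> whom (?V @ [c, d]) (block_word B @ [c, c, d, d])"
    by (simp_all add: whom_def)
  have "\<phi> \<diamondop> rel_mor A R c = wscl A ?r (\<phi> \<diamondop> \<kappa>)"
  proof -
    have "\<kappa> \<in> whom [c, c, d, d] [c, c, d, d]" by (simp add: whom_def)
    then show ?thesis
      using pad_wscl[of \<kappa> "[c, c, d, d]" "[c, c, d, d]" "block_word B" "[]" ?r]
        wcmp_wscl(1)[of "pad (block_word B) \<kappa> []" "block_word B @ [c, c, d, d]" "block_word B @ [c, c, d, d]"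
          "pad [] \<phi> [c, c, d, d]" "block_word B @ [c, c, d, d]" ?r]
      by (simp add: rel_mor_closure wten_pad(1) whom_def flip: \<kappa>_def)
  qed
  then have m: "?\<xi> \<star> (\<phi> \<diamondop> rel_mor A R c) \<star> winv A ?\<xi> = wscl A ?r M"
    unfolding M_def using wcmp_wscl(1)[OF f l, of ?r] wcmp_wscl(2)[OF whom_cmp[OF f l] r, of ?r] by (simp del: wiso_wcmp wiso_wten)
  have "Q_term A (n + 1, Rs @ [R]) (bs @ [c]) = itr (Ws @ [[c, d]]) (wscl A ?r M)"
    using Q_term_snoc[OF len bs pres p b] unfolding C B_def[symmetric] \<phi>_def[symmetric] K ws m .
  also have "\<dots> = ?r * itr (Ws @ [[c, d]]) M"
    by (rule itr_wscl) (use M cc in simp)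
  finally show ?thesis
    unfolding 1 R_def by (simp add: Ws_def slide_trace_def L_def U_def \<phi>_def group_words_def)
qed

text \<open>\<open>m b\<close> counts the summands \<open>b\<close> of \<open>w\<close>, and the
  bases attached to it identify this count with a dimension. It is kept as a length because
  \<open>hom_dim\<close> is a definite description, which is evaluated only over a finite
  field.\<close>

lemma slide_trace_multiplicity:
  assumes w: "wob w" and xs: "wob (concat xs)" and g: "wob g" and ys: "wob (concat ys)"
    and \<psi>: "\<psi> \<in> whom ((concat xs @ g) @ concat ys) ((concat xs @ g) @ concat ys)"
  shows "\<exists>m. (\<forall>b\<in>S. \<exists>es. is_basis A b (wprod A w) es \<and> length es = m b) \<and>
    slide_trace xs g ys \<psi> w = (\<Sum>b\<in>S. of_nat (m b) * slide_trace xs g ys \<psi> [b])"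
proof -
  have X: "wprod A w \<in> Ob A" using w by simp
  obtain as where as: "set as \<subseteq> S" "is_direct_sum A (wprod A w) as" using S_generates[OF X] by blast
  then obtain \<iota> \<pi> where io: "\<And>i. i < length as \<Longrightarrow> \<iota> i \<in> Hm A (as ! i) (wprod A w)"
      "\<And>i. i < length as \<Longrightarrow> \<pi> i \<in> Hm A (wprod A w) (as ! i)"
      "\<And>i j. i < length as \<Longrightarrow> j < length as \<Longrightarrow>
        \<pi> i \<cdot> \<iota> j = (if i = j then idn A (as ! i) else zer A (as ! j) (as ! i))"
      "hsum A (wprod A w) (wprod A w) (map (\<lambda>i. \<iota> i \<cdot> \<pi> i) [0..<length as]) = idn A (wprod A w)"
    unfolding is_direct_sum_def by blast
  define m where "m b = length (filter (\<lambda>i. as ! i = b) [0..<length as])" for b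
  let ?f = "\<lambda>b. slide_trace xs g ys \<psi> [b]"
  have basis: "\<exists>es. is_basis A b (wprod A w) es \<and> length es = m b" if "b \<in> S" for b
    using direct_sum_dual_bases[OF that X as(1) io] unfolding dual_bases_def m_def by fastforce
  have "slide_trace xs g ys \<psi> w = (\<Sum>i<length as. ?f (as ! i))"
    by (rule slide_trace_direct_sum[OF w xs g ys \<psi> as(1) io(1,2) _ io(4)]) (use io(3) in auto)
  also have "\<dots> = (\<Sum>b\<in>S. \<Sum>i\<in>{i \<in> {..<length as}. as ! i = b}. ?f (as ! i))"
    using as(1) by (intro sum.group[symmetric] S_finite) auto
  also have "\<dots> = (\<Sum>b\<in>S. of_nat (m b) * ?f b)"
  proof (rule sum.cong[OF refl])
    fix b
    have "m b = card {i \<in> {..<length as}. as ! i = b}"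
      unfolding m_def by (subst distinct_card[symmetric]) (auto intro: arg_cong[of _ _ card])
    then show "(\<Sum>i\<in>{i \<in> {..<length as}. as ! i = b}. ?f (as ! i)) = of_nat (m b) * ?f b" by simp
  qed
  finally show ?thesis using basis by blast
qed

text \<open>Splitting off the last label allows P' and P'' to be compared with the labels of their
  common relators held fixed.\<close>

lemma Q_inv_snoc:
  "Q_inv A S (m, Rs @ [R]) = (\<Sum>bs | set bs \<subseteq> S \<and> length bs = length Rs. \<Sum>c\<in>S. Q_term A (m, Rs @ [R]) (bs @ [c]))"
proof -
  let ?Z = "{bs. set bs \<subseteq> S \<and> length bs = length Rs}" and ?h = "\<lambda>(bs, c). bs @ [c]"
  have "{bs. set bs \<subseteq> S \<and> length bs = Suc (length Rs)} = ?h ` (?Z \<times> S)"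
  proof
    show "{bs. set bs \<subseteq> S \<and> length bs = Suc (length Rs)} \<subseteq> ?h ` (?Z \<times> S)"
    proof
      fix bs assume "bs \<in> {bs. set bs \<subseteq> S \<and> length bs = Suc (length Rs)}"
      then show "bs \<in> ?h ` (?Z \<times> S)" by (cases bs rule: rev_cases) (auto intro!: image_eqI)
    qed
  qed auto
  moreover have "inj_on ?h (?Z \<times> S)" by (auto simp: inj_on_def)
  ultimately show ?thesis
    by (simp add: Q_inv_def sum.reindex sum.cartesian_product comp_def case_prod_unfold)
qed

end

section \<open>Comparison of the two state sums\<close>

theorem mainTheorem4:
  fixes A :: "('o, 'm, 'p::prime_card mod_ring) tensor_cat"
    and S :: "'o set"
    and n k :: nat
    and Rs :: "relator list"
  assumes "gelfand_kazhdan_root_category A S"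
    and "\<forall>b\<in>S. inverse (rank A b) * of_nat (\<Sum>c\<in>S. hom_dim A b (tob A c (dua A c)))
               = of_nat (card S)"
    and "is_presentation (n, Rs)"
    and "k < n"
  shows "Q_inv A S (n + 1, Rs @ [[(k, 1), (n, 1), (k, - 1), (n, - 1)]])
       = of_nat (card S) * Q_inv A S (n, Rs @ [[(k, 1)]])"
proof -
  interpret semisimple_stable_category A S
    using assms(1) by (simp add: gelfand_kazhdan_root_category_def)
  let ?R' = "[(k, 1), (n, 1), (k, - 1), (n, - 1)] :: relator" and ?R'' = "[(k, 1)] :: relator"
  \<comment> \<open>The generators before and after x_k; their groups become the factors
    \<open>xs\<close> and \<open>ys\<close> of \<open>slide_trace\<close>.\<close>
  obtain ks ls where N: "[0..<n] = ks @ k # ls"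
    using split_list[of k "[0..<n]"] assms(4) by auto
  \<comment> \<open>The identity already holds for the sums over the label of the last relator, for
    each choice of the other labels.\<close>
  have "(\<Sum>c\<in>S. Q_term A (n + 1, Rs @ [?R']) (bs @ [c]))
      = of_nat (card S) * (\<Sum>b\<in>S. Q_term A (n, Rs @ [?R'']) (bs @ [b]))"
    if bs: "set bs \<subseteq> S" "length Rs = length bs" for bs
  proof -
    define B where "B = blocks A Rs bs"
    define \<xi> where "\<xi> = grouping A (ks @ k # ls) B"
    define \<psi> where "\<psi> = wcmp A (wcmp A \<xi> (pres_mor A Rs bs)) (winv A \<xi>)"
    define xs where "xs = map (\<lambda>j. group_word j B) ks"
    define ys where "ys = map (\<lambda>j. group_word j B) ls"
    let ?g = "group_word k B"
    define T where "T = slide_trace xs ?g ys \<psi>"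
    have B: "bob B" "fst ` set B \<subseteq> set (ks @ k # ls)" "pres_mor A Rs bs \<in> whom (block_word B) (block_word B)"
      using blocks_props[OF bs(2,1), of n] assms(3) unfolding N[symmetric] B_def is_presentation_def by auto
    have dist: "distinct (ks @ k # ls)" unfolding N[symmetric] by simp
    have c: "concat xs = group_words ks B" "concat ys = group_words ls B"
      by (simp_all add: xs_def ys_def group_words_def)
    have wobs: "wob (concat xs)" "wob ?g" "wob (concat ys)" using B(1) by (simp_all add: c)
    have \<psi>: "\<psi> \<in> whom ((concat xs @ ?g) @ concat ys) ((concat xs @ ?g) @ concat ys)"
      using grouping_word[OF B(1) dist] rest_word_covered[OF B(2)] whomD[OF B(3)]
      by (simp add: \<psi>_def \<xi>_def whom_def c)
    have mult: "T [c, dua A c] = (\<Sum>b\<in>S. of_nat (hom_dim A b (tob A c (dua A c))) * T [b])" if "c \<in> S" for c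
    proof -
      have cO: "c \<in> Ob A" using that by simp
      then have w: "wob [c, dua A c]" by simp
      obtain m where m: "\<And>b. b \<in> S \<Longrightarrow> \<exists>es. is_basis A b (wprod A [c, dua A c]) es \<and> length es = m b"
        "T [c, dua A c] = (\<Sum>b\<in>S. of_nat (m b) * T [b])"
        using slide_trace_multiplicity[OF w wobs \<psi>] unfolding T_def by blast
      \<comment> \<open>Finiteness of the ground field enters here: it makes \<open>hom_dim\<close>
        the length of any basis.\<close>
      have "hom_dim A b (tob A c (dua A c)) = m b" if "b \<in> S" for b
        using m(1)[OF that] hom_dim_eq_length[OF linear_category_axioms] that cO by fastforce
      then show ?thesis using m(2) by simp
    qed
    have "(\<Sum>c\<in>S. Q_term A (n + 1, Rs @ [?R']) (bs @ [c])) = (\<Sum>c\<in>S. T [c, dua A c])"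
      using Q_term_commutator[OF bs(2,1) assms(3) _ N]
      by (simp add: T_def xs_def ys_def \<psi>_def \<xi>_def B_def)
    also have "\<dots> = (\<Sum>c\<in>S. \<Sum>b\<in>S. of_nat (hom_dim A b (tob A c (dua A c))) * T [b])"
      by (simp add: mult)
    also have "\<dots> = (\<Sum>b\<in>S. of_nat (\<Sum>c\<in>S. hom_dim A b (tob A c (dua A c))) * T [b])"
      by (subst sum.swap) (simp add: sum_distrib_right)
    \<comment> \<open>After the exchange of sums the hypothesis applies to each \<open>b\<close>.
      Multiplying it by r(b) removes the inverse, which is legitimate because r(b) is
      nonzero.\<close>
    also have "\<dots> = (\<Sum>b\<in>S. of_nat (card S) * (rank A b * T [b]))"
    proof (rule sum.cong[OF refl])
      fix b assume b: "b \<in> S"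
      let ?m = "of_nat (\<Sum>c\<in>S. hom_dim A b (tob A c (dua A c))) :: 'p mod_ring"
      have "?m = rank A b * (inverse (rank A b) * ?m)"
        using rank_nonzero[OF b] by simp
      also have "\<dots> = rank A b * of_nat (card S)" using assms(2) b by simp
      finally show "?m * T [b] = of_nat (card S) * (rank A b * T [b])" by (simp only: mult_ac)
    qed
    also have "\<dots> = of_nat (card S) * (\<Sum>b\<in>S. Q_term A (n, Rs @ [?R'']) (bs @ [b]))"
      using Q_term_generator[OF bs(2,1) assms(3) _ N]
      by (simp add: sum_distrib_left T_def xs_def ys_def \<psi>_def \<xi>_def B_def)
    finally show ?thesis .
  qed
  then show ?thesis by (simp add: Q_inv_snoc sum_distrib_left)
qed

end
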